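(* Let $\mathcal C=\{L_1,L_2\}$ be a pseudo-fibered pair. If $g$ is a non-trivial laminar automorphism in $\operatorname{Aut}(\mathcal C)$, then $g$ falls into one of the following cases: (1) $g$ is elliptic and there is a weakly interleaving pair of ideal polygons of $\mathcal C$ preserved by $g$. (2) $g$ is parabolic and there is a weakly interleaving pair of crowns of $\mathcal C$ preserved by $g$. Furthermore, the pivot of the crowns is the fixed point of $g$. (3) $g$ is hyperbolic and each fixed point of $g$ is a rainbow point in both $L_1$ and $L_2$. (4) $g$ is a pA-like automorphism without fixed point and there is an interleaving pair $(G_1,G_2)$ of real ideal polygons preserved by $g$ such that $v(G_1)\cup v(G_2)=\operatorname{Per}(g)$. (5) $g$ is a properly pseudo-Anosov and there is an interleaving pair $(G_1,G_2)$ of real gaps preserved by $g$ such that $v(G_1)\cup v(G_2)=\operatorname{Fix}(g)$. Moreover, the tips of $G_i$ are attracting fixed points of $g$ and the tips of $G_{i+1}$ are repelling fixed points of $g$ for some $i\in\{1,2\}$ (cyclically indexed).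
   Context: Lamination systems. $S^1$ is the unit circle with its counter-clockwise circular order. For distinct $u,v\in S^1$, $(u,v)_{S^1}$ is the set of $z$ with $(u,z,v)$ counter-clockwise; such sets are called good intervals, and $(u,v)_{S^1}^*:=(v,u)_{S^1}$. For a good interval $I$ put $\ell(I)=\{I,I^*\}$; $\ell(I)$ lies on an open interval $J$ if $I\subseteq J$ or $I^*\subseteq J$. A lamination system is a nonempty set $L$ of good intervals such that (i) $I\in L\Rightarrow I^*\in L$; (ii) for $I,J\in L$, $\ell(I)$ lies on $J$ or on $J^*$; (iii) if $I_1\subseteq I_2\subseteq\cdots$ are in $L$ and $\bigcup_k I_k$ is a good interval, then $\bigcup_k I_k\in L$. The leaves of $L$ are the $\ell(I)$, $I\in L$. A gap of $L$ is a subset $G\subseteq L$ whose distinct elements are disjoint and such that every leaf of $L$ lies on some element of $G$. Each leaf is itself a gap; a non-leaf gap is a gap which is not a leaf. The vertex set of $G$ is $v(G)=S^1\setminus\bigcup G$; a tip of $G$ is an isolated point of $v(G)$. $E(L)=\bigcup_{I\in L}v(\ell(I))$. An ideal polygon is a gap with finitely many vertices (leaves included). A crown is a gap $G=\{(t_k,t_{k+1})_{S^1}:k\in\mathbb Z\}$ with $v(G)=\{t_k:k\in\mathbb Z\}\cup\{p\}$ and $p\neq t_k$ for all $k$; $p$ is its pivot. $L$ is quite full if every gap is an ideal polygon or a crown; a quite full $L$ is loose if distinct non-leaf gaps have disjoint vertex sets. A point $p$ is a rainbow point of $L$ if there is a descending sequence $\{I_k\}_{k\in\mathbb N}$ in $L$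 with $\bigcap_k I_k=\{p\}$. A sequence of leaves $\ell_k$ converges to a good interval $I$ if there are $I_k\in L$ with $\ell_k=\ell(I_k)$ and $I\subseteq\liminf I_k\subseteq\limsup I_k\subseteq\overline I$. $I\in L$ is isolated if there is no sequence of leaves $\ell_k\ne\ell(I)$ of $L$ lying on $I$ and converging to $I$. A gap is real if none of its elements is isolated. Pseudo-fibered pairs. A pair $\{L_1,L_2\}$ of lamination systems is pseudo-fibered if both are quite full and loose and $E(L_1)\cap E(L_2)=\emptyset$. Gaps $G_1$ of $L_1$ and $G_2$ of $L_2$ interleave if for each $i\in\{1,2\}$ (cyclic indices) $I\cap v(G_{i+1})$ is a singleton for every $I\in G_i$; then $(G_1,G_2)$ is an interleaving pair. They weakly interleave (and $(G_1,G_2)$ is a weakly interleaving pair) if one of the following holds: (a) for each $i$, $G_i=\{(u^i_n,u^i_{n+1})_{S^1}:n\in\mathbb Z_{n_i}\}$ for an integer $n_i\ge2$, and there is a natural number $d$ dividing $\gcd(n_1,n_2)$ such that for each $i$, whenever $u^i_n\in(u^{i+1}_m,u^{i+1}_{m+1})_{S^1}$, one has $u^i_{n+n_i/d}\in(u^{i+1}_{m+n_{i+1}/d},u^{i+1}_{m+n_{i+1}/d+1})_{S^1}$; (b) for each $i$, $G_i=\{(u^i_n,u^i_{n+1})_{S^1}:n\in\mathbb Z\}$, and there are natural numbers $d_1,d_2$ such that for each $i$, whenever $u^i_n\in(u^{i+1}_m,u^{i+1}_{m+1})_{S^1}$, one has $u^i_{n+d_i}\in(u^{i+1}_{m+d_{i+1}},u^{i+1}_{m+d_{i+1}+1})_{S^1}$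 (superscripts mod 2). Automorphisms. $\operatorname{Aut}(\mathcal C)$ is the group of orientation preserving homeomorphisms $g$ of $S^1$ with $g(L_1)=L_1$ and $g(L_2)=L_2$. $\operatorname{Fix}(g)$ and $\operatorname{Per}(g)$ are the sets of fixed and periodic points on $S^1$. A fixed point $p$ is attracting if there is a good interval $I$ with $I\cap\operatorname{Fix}(g)=\{p\}$ and $g(\overline I)\subset I$, and repelling if there is a good interval $I$ with $I\cap\operatorname{Fix}(g)=\{p\}$ and $I\subset g(\overline I)$. A non-trivial $g$ is elliptic if it has finite order, parabolic if it has a unique fixed point, hyperbolic if it has exactly two fixed points, one attracting and one repelling; $g\in\operatorname{Aut}(\mathcal C)$ is pA-like if it is neither elliptic nor parabolic and preserves an interleaving pair of $\mathcal C$; a properly pseudo-Anosov is a pA-like automorphism with non-empty fixed point set. *)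

theory Defs
  imports "HOL-Analysis.Analysis"
begin

section \<open>The circle and its circular order\<close>

abbreviation S1 :: "complex set" where
  "S1 \<equiv> sphere 0 1"

text \<open>\<open>ccw u z v\<close> says that the triple \<open>(u, z, v)\<close> is counter-clockwise. It entails that the
  three points are distinct points of the circle.\<close>

definition ccw :: "complex \<Rightarrow> complex \<Rightarrow> complex \<Rightarrow> bool" where
  "ccw u z v \<longleftrightarrow>
     (\<exists>a b c. a < b \<and> b < c \<and> c < a + 2 * pi \<and> u = cis a \<and> z = cis b \<and> v = cis c)"

definition open_arc :: "complex \<Rightarrow> complex \<Rightarrow> complex set" where
  "open_arc u v = {z. ccw u z v}"

definition good_interval :: "complex set \<Rightarrow> bool" where
  "good_interval I \<longleftrightarrow> (\<exists>u\<in>S1. \<exists>v\<in>S1. u \<noteq> v \<and> I = open_arc u v)"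

text \<open>The dual interval; well defined by \<open>dual_open_arc\<close> below.\<close>

definition dual :: "complex set \<Rightarrow> complex set" where
  "dual I = (THE J. \<exists>u\<in>S1. \<exists>v\<in>S1. u \<noteq> v \<and> I = open_arc u v \<and> J = open_arc v u)"

lemma cis_eq_iff_int: "cis x = cis y \<longleftrightarrow> (\<exists>n::int. x = y + 2 * pi * n)"
  using sin_cos_eq_iff[of x y] by (auto simp: complex_eq_iff)

lemma cis_shift: "cis (x + 2 * pi * of_int n) = cis x"
  using cis_eq_iff_int by blast

lemma open_arc_cis:
  assumes "a < c" "c < a + 2 * pi"
  shows "open_arc (cis a) (cis c) = cis ` {a<..<c}"
proof (rule set_eqI, rule iffI)
  fix z assume "z \<in> open_arc (cis a) (cis c)"
  then obtain a' b c' where h: "a' < b" "b < c'" "c' < a' + 2 * pi"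
      "cis a = cis a'" "z = cis b" "cis c = cis c'"
    by (auto simp: open_arc_def ccw_def)
  obtain m :: int where m: "a = a' + 2 * pi * m"
    using h(4) by (auto simp: cis_eq_iff_int)
  obtain n :: int where n: "c = c' + 2 * pi * n"
    using h(6) by (auto simp: cis_eq_iff_int)
  have "2 * pi * (real_of_int n - real_of_int m) = (c - a) - (c' - a')"
    using m n by (simp add: algebra_simps)
  moreover have "(c - a) - (c' - a') < 2 * pi" "-(2 * pi) < (c - a) - (c' - a')"
    using h assms by linarith+
  moreover have two_pi: "0 < 2 * pi" by simp
  ultimately have "2 * pi * (real_of_int n - real_of_int m) < 2 * pi * 1"
      "2 * pi * (-1) < 2 * pi * (real_of_int n - real_of_int m)"
    by linarith+
  then have "real_of_int n - real_of_int m < 1" "-1 < real_of_int n - real_of_int m"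
    by (simp_all only: mult_less_cancel_left_pos[OF two_pi])
  then have "m = n" by linarith
  then have "b + 2 * pi * m \<in> {a<..<c}" using m n h \<open>m = n\<close> by simp
  moreover have "z = cis (b + 2 * pi * m)"
    using h(5) by (simp add: cis_shift)
  ultimately show "z \<in> cis ` {a<..<c}" by blast
next
  fix z assume "z \<in> cis ` {a<..<c}"
  then obtain b where "a < b" "b < c" "z = cis b" by auto
  then show "z \<in> open_arc (cis a) (cis c)"
    using assms unfolding open_arc_def ccw_def by blast
qed

lemma S1_angles:
  assumes "u \<in> S1" "v \<in> S1" "u \<noteq> v"
  obtains a c where "a < c" "c < a + 2 * pi" "u = cis a" "v = cis c"
proof -
  have *: "z = cis (Arg2pi z)" if "z \<in> S1" for z
    using that Arg2pi_eq[of z] by (simp add: cis_conv_exp)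
  obtain \<alpha> \<beta> where u: "u = cis \<alpha>" "v = cis \<beta>"
      and b: "0 \<le> \<alpha>" "\<alpha> < 2 * pi" "0 \<le> \<beta>" "\<beta> < 2 * pi"
    using *[OF assms(1)] *[OF assms(2)] Arg2pi_lt_2pi Arg2pi_ge_0 by blast
  show thesis
  proof (cases "\<alpha> < \<beta>")
    case True
    moreover have "\<beta> < \<alpha> + 2 * pi" using b by linarith
    ultimately show thesis using that u by blast
  next
    case False
    then have "\<beta> < \<alpha>" using u assms(3) by (cases "\<alpha> = \<beta>") auto
    moreover have "cis (\<beta> + 2 * pi) = v"
      using u(2) cis_shift[of \<beta> 1] by simp
    moreover have "\<alpha> < \<beta> + 2 * pi" "\<beta> + 2 * pi < \<alpha> + 2 * pi"
      using b calculation(1) by linarith+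
    ultimately show thesis using that u(1) by metis
  qed
qed

lemma open_arc_swap:
  assumes "u \<in> S1" "v \<in> S1" "u \<noteq> v"
  shows "open_arc v u = S1 - closure (open_arc u v)"
proof -
  obtain a c where ac: "a < c" "c < a + 2 * pi" "u = cis a" "v = cis c"
    using S1_angles[OF assms] by blast
  have cont: "continuous_on A cis" for A by (intro continuous_intros)
  have "closure (cis ` {a<..<c}) = cis ` {a..c}"
  proof
    show "closure (cis ` {a<..<c}) \<subseteq> cis ` {a..c}"
      by (intro closure_minimal image_mono compact_imp_closed compact_continuous_image cont) auto
    have "cis ` closure {a<..<c} \<subseteq> closure (cis ` {a<..<c})"
      by (intro image_closure_subset cont closure_subset) auto
    then show "cis ` {a..c} \<subseteq> closure (cis ` {a<..<c})" using ac by simp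
  qed
  then have cl: "closure (open_arc u v) = cis ` {a..c}"
    unfolding ac(3,4) open_arc_cis[OF ac(1,2)] .
  have u': "u = cis (a + 2 * pi)"
    using ac(3) cis_shift[of a 1] by simp
  have sw: "open_arc v u = cis ` {c<..<a + 2 * pi}"
    unfolding ac(4) u' by (rule open_arc_cis) (use ac in auto)
  have "cis s \<noteq> cis t" if "a \<le> s" "s \<le> c" "c < t" "t < a + 2 * pi" for s t
  proof
    assume "cis s = cis t"
    then obtain m :: int where m: "t = s + 2 * pi * m"
      using cis_eq_iff_int[of t s] by auto
    have "2 * pi * 0 < 2 * pi * m" "2 * pi * m < 2 * pi * 1" using m that by linarith+
    then show False by (simp add: zero_less_mult_iff)
  qed
  then have neq: "cis s \<noteq> cis t" if "s \<in> {a..c}" "t \<in> {c<..<a + 2 * pi}" for s t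
    using that unfolding atLeastAtMost_iff greaterThanLessThan_iff by blast
  have disj: "cis ` {c<..<a + 2 * pi} \<inter> cis ` {a..c} = {}"
  proof (rule equals0I)
    fix z assume "z \<in> cis ` {c<..<a + 2 * pi} \<inter> cis ` {a..c}"
    then obtain s t where "s \<in> {a..c}" "z = cis s" "t \<in> {c<..<a + 2 * pi}" "z = cis t"
      by blast
    then show False using neq[of s t] by simp
  qed
  have cover: "z \<in> cis ` {c<..<a + 2 * pi} \<union> cis ` {a..c}" if z: "z \<in> S1" for z
  proof (cases "z = u")
    case True
    moreover have "a \<in> {a..c}" using ac by simp
    ultimately show ?thesis using ac(3) by blast
  next
    case False
    obtain s t where st: "s < t" "t < s + 2 * pi" "u = cis s" "z = cis t"
      using S1_angles[OF assms(1) z False[symmetric]] by blast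
    then obtain m :: int where m: "a = s + 2 * pi * m"
      using ac(3) cis_eq_iff_int[of a s] by auto
    have "z = cis (t + 2 * pi * m)"
      using st by (simp add: cis_shift)
    moreover have "a < t + 2 * pi * m" "t + 2 * pi * m < a + 2 * pi" using m st by linarith+
    moreover from this have "t + 2 * pi * m \<in> {c<..<a + 2 * pi} \<union> {a..c}" by auto
    ultimately show ?thesis by blast
  qed
  have sub: "cis ` {c<..<a + 2 * pi} \<subseteq> S1" by auto
  have "A = S - B" if "A \<inter> B = {}" "\<And>z. z \<in> S \<Longrightarrow> z \<in> A \<union> B" "A \<subseteq> S" for A B S :: "complex set"
    using that by blast
  from this[OF disj cover sub] show ?thesis unfolding cl sw .
qed

lemma dual_open_arc:
  assumes "u \<in> S1" "v \<in> S1" "u \<noteq> v"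
  shows "dual (open_arc u v) = open_arc v u"
  unfolding dual_def
proof (rule the_equality)
  show "\<exists>u'\<in>S1. \<exists>v'\<in>S1. u' \<noteq> v' \<and> open_arc u v = open_arc u' v' \<and> open_arc v u = open_arc v' u'"
    using assms by blast
next
  fix J assume "\<exists>u'\<in>S1. \<exists>v'\<in>S1. u' \<noteq> v' \<and> open_arc u v = open_arc u' v' \<and> J = open_arc v' u'"
  then obtain u' v' where J: "u' \<in> S1" "v' \<in> S1" "u' \<noteq> v'"
      "open_arc u v = open_arc u' v'" "J = open_arc v' u'"
    by blast
  have "J = S1 - closure (open_arc u v)"
    unfolding J(4,5) using J(1-3) by (rule open_arc_swap)
  also have "\<dots> = open_arc v u"
    using assms by (rule open_arc_swap[symmetric])
  finally show "J = open_arc v u" .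
qed


section \<open>Lamination systems\<close>

definition leaf :: "complex set \<Rightarrow> complex set set" where
  "leaf I = {I, dual I}"

definition lies_on :: "complex set \<Rightarrow> complex set \<Rightarrow> bool" where
  "lies_on I J \<longleftrightarrow> I \<subseteq> J \<or> dual I \<subseteq> J"

definition lamination_system :: "complex set set \<Rightarrow> bool" where
  "lamination_system L \<longleftrightarrow>
     L \<noteq> {} \<and> (\<forall>I\<in>L. good_interval I) \<and>
     (\<forall>I\<in>L. dual I \<in> L) \<and>
     (\<forall>I\<in>L. \<forall>J\<in>L. lies_on I J \<or> lies_on I (dual J)) \<and>
     (\<forall>I :: nat \<Rightarrow> complex set.
        incseq I \<and> range I \<subseteq> L \<and> good_interval (\<Union>k. I k) \<longrightarrow> (\<Union>k. I k) \<in> L)"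

definition gap :: "complex set set \<Rightarrow> complex set set \<Rightarrow> bool" where
  "gap L G \<longleftrightarrow> G \<subseteq> L \<and> disjoint G \<and> (\<forall>I\<in>L. \<exists>J\<in>G. lies_on I J)"

definition non_leaf_gap :: "complex set set \<Rightarrow> complex set set \<Rightarrow> bool" where
  "non_leaf_gap L G \<longleftrightarrow> gap L G \<and> (\<forall>I\<in>L. G \<noteq> leaf I)"

definition vertices :: "complex set set \<Rightarrow> complex set" where
  "vertices G = S1 - \<Union>G"

definition tip :: "complex set set \<Rightarrow> complex \<Rightarrow> bool" where
  "tip G p \<longleftrightarrow> p isolated_in vertices G"

definition endpoints :: "complex set set \<Rightarrow> complex set" where
  "endpoints L = (\<Union>I\<in>L. vertices (leaf I))"

definition ideal_polygon :: "complex set set \<Rightarrow> complex set set \<Rightarrow> bool" where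
  "ideal_polygon L G \<longleftrightarrow> gap L G \<and> finite (vertices G)"

definition crown_with_pivot ::
    "complex set set \<Rightarrow> complex set set \<Rightarrow> complex \<Rightarrow> bool" where
  "crown_with_pivot L G p \<longleftrightarrow> gap L G \<and>
     (\<exists>t :: int \<Rightarrow> complex. G = range (\<lambda>k. open_arc (t k) (t (k + 1))) \<and>
        vertices G = range t \<union> {p} \<and> (\<forall>k. p \<noteq> t k))"

definition crown :: "complex set set \<Rightarrow> complex set set \<Rightarrow> bool" where
  "crown L G \<longleftrightarrow> (\<exists>p. crown_with_pivot L G p)"

definition quite_full :: "complex set set \<Rightarrow> bool" where
  "quite_full L \<longleftrightarrow> lamination_system L \<and> (\<forall>G. gap L G \<longrightarrow> ideal_polygon L G \<or> crown L G)"

definition loose :: "complex set set \<Rightarrow> bool" where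
  "loose L \<longleftrightarrow> quite_full L \<and>
     (\<forall>G H. non_leaf_gap L G \<and> non_leaf_gap L H \<and> G \<noteq> H \<longrightarrow> vertices G \<inter> vertices H = {})"

definition rainbow_point :: "complex set set \<Rightarrow> complex \<Rightarrow> bool" where
  "rainbow_point L p \<longleftrightarrow>
     (\<exists>I :: nat \<Rightarrow> complex set. decseq I \<and> range I \<subseteq> L \<and> (\<Inter>k. I k) = {p})"

definition leaves_converge ::
    "complex set set \<Rightarrow> (nat \<Rightarrow> complex set set) \<Rightarrow> complex set \<Rightarrow> bool" where
  "leaves_converge L l I \<longleftrightarrow>
     (\<exists>J :: nat \<Rightarrow> complex set. (\<forall>k. J k \<in> L \<and> l k = leaf (J k)) \<and>
        I \<subseteq> liminf J \<and> liminf J \<subseteq> limsup J \<and> limsup J \<subseteq> closure I)"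

definition isolated_interval :: "complex set set \<Rightarrow> complex set \<Rightarrow> bool" where
  "isolated_interval L I \<longleftrightarrow> I \<in> L \<and>
     \<not> (\<exists>J :: nat \<Rightarrow> complex set.
          (\<forall>k. J k \<in> L \<and> leaf (J k) \<noteq> leaf I \<and> lies_on (J k) I) \<and>
          leaves_converge L (\<lambda>k. leaf (J k)) I)"

definition real_gap :: "complex set set \<Rightarrow> complex set set \<Rightarrow> bool" where
  "real_gap L G \<longleftrightarrow> gap L G \<and> (\<forall>I\<in>G. \<not> isolated_interval L I)"


section \<open>Pseudo-fibered pairs\<close>

definition pseudo_fibered :: "complex set set \<Rightarrow> complex set set \<Rightarrow> bool" where
  "pseudo_fibered L1 L2 \<longleftrightarrow>
     quite_full L1 \<and> loose L1 \<and> quite_full L2 \<and> loose L2 \<and> endpoints L1 \<inter> endpoints L2 = {}"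

definition interleaving_pair ::
    "complex set set \<Rightarrow> complex set set \<Rightarrow> complex set set \<Rightarrow> complex set set \<Rightarrow> bool" where
  "interleaving_pair L1 L2 G1 G2 \<longleftrightarrow> gap L1 G1 \<and> gap L2 G2 \<and>
     (\<forall>I\<in>G1. is_singleton (I \<inter> vertices G2)) \<and>
     (\<forall>I\<in>G2. is_singleton (I \<inter> vertices G1))"

definition shift_compatible ::
    "(int \<Rightarrow> complex) \<Rightarrow> int \<Rightarrow> (int \<Rightarrow> complex) \<Rightarrow> int \<Rightarrow> bool" where
  "shift_compatible u a w b \<longleftrightarrow>
     (\<forall>n m. u n \<in> open_arc (w m) (w (m + 1)) \<longrightarrow> u (n + a) \<in> open_arc (w (m + b)) (w (m + b + 1)))"

text \<open>Families indexed by the integers modulo \<open>n\<close> are encoded as \<open>n\<close>-periodic families indexed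
  by the integers.\<close>

definition weakly_interleaving_pair ::
    "complex set set \<Rightarrow> complex set set \<Rightarrow> complex set set \<Rightarrow> complex set set \<Rightarrow> bool" where
  "weakly_interleaving_pair L1 L2 G1 G2 \<longleftrightarrow> gap L1 G1 \<and> gap L2 G2 \<and>
     ((\<exists>(n1::nat) (n2::nat) u1 u2.
         n1 \<ge> 2 \<and> (\<forall>k. u1 (k + int n1) = u1 k) \<and> G1 = range (\<lambda>k. open_arc (u1 k) (u1 (k + 1))) \<and>
         n2 \<ge> 2 \<and> (\<forall>k. u2 (k + int n2) = u2 k) \<and> G2 = range (\<lambda>k. open_arc (u2 k) (u2 (k + 1))) \<and>
         (\<exists>d::nat. d dvd gcd n1 n2 \<and>
            shift_compatible u1 (int (n1 div d)) u2 (int (n2 div d)) \<and>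
            shift_compatible u2 (int (n2 div d)) u1 (int (n1 div d)))) \<or>
      (\<exists>(u1 :: int \<Rightarrow> complex) u2.
         G1 = range (\<lambda>k. open_arc (u1 k) (u1 (k + 1))) \<and>
         G2 = range (\<lambda>k. open_arc (u2 k) (u2 (k + 1))) \<and>
         (\<exists>(d1::nat) (d2::nat). d1 \<ge> 1 \<and> d2 \<ge> 1 \<and>
            shift_compatible u1 (int d1) u2 (int d2) \<and>
            shift_compatible u2 (int d2) u1 (int d1))))"


section \<open>Automorphisms\<close>

text \<open>A self-map of the circle is represented by a function on the complex plane, whose values off
  the circle are irrelevant.\<close>

definition circle_homeo_op :: "(complex \<Rightarrow> complex) \<Rightarrow> bool" where
  "circle_homeo_op g \<longleftrightarrow> (\<exists>h. homeomorphism S1 S1 g h) \<and>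
     (\<forall>u z v. ccw u z v \<longrightarrow> ccw (g u) (g z) (g v))"

definition preserves :: "(complex \<Rightarrow> complex) \<Rightarrow> complex set set \<Rightarrow> bool" where
  "preserves g X \<longleftrightarrow> (\<lambda>I. g ` I) ` X = X"

definition laminar_Aut :: "complex set set \<Rightarrow> complex set set \<Rightarrow> (complex \<Rightarrow> complex) set" where
  "laminar_Aut L1 L2 = {g. circle_homeo_op g \<and> preserves g L1 \<and> preserves g L2}"

definition nontrivial :: "(complex \<Rightarrow> complex) \<Rightarrow> bool" where
  "nontrivial g \<longleftrightarrow> (\<exists>x\<in>S1. g x \<noteq> x)"

definition Fix :: "(complex \<Rightarrow> complex) \<Rightarrow> complex set" where
  "Fix g = {x \<in> S1. g x = x}"

definition Per :: "(complex \<Rightarrow> complex) \<Rightarrow> complex set" where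
  "Per g = {x \<in> S1. \<exists>n>0. (g ^^ n) x = x}"

definition attracting :: "(complex \<Rightarrow> complex) \<Rightarrow> complex \<Rightarrow> bool" where
  "attracting g p \<longleftrightarrow> (\<exists>I. good_interval I \<and> I \<inter> Fix g = {p} \<and> g ` closure I \<subseteq> I)"

definition repelling :: "(complex \<Rightarrow> complex) \<Rightarrow> complex \<Rightarrow> bool" where
  "repelling g p \<longleftrightarrow> (\<exists>I. good_interval I \<and> I \<inter> Fix g = {p} \<and> I \<subseteq> g ` closure I)"

definition elliptic :: "(complex \<Rightarrow> complex) \<Rightarrow> bool" where
  "elliptic g \<longleftrightarrow> nontrivial g \<and> (\<exists>n>0. \<forall>x\<in>S1. (g ^^ n) x = x)"

definition parabolic :: "(complex \<Rightarrow> complex) \<Rightarrow> bool" where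
  "parabolic g \<longleftrightarrow> nontrivial g \<and> (\<exists>p. Fix g = {p})"

definition hyperbolic :: "(complex \<Rightarrow> complex) \<Rightarrow> bool" where
  "hyperbolic g \<longleftrightarrow> nontrivial g \<and>
     (\<exists>p q. p \<noteq> q \<and> Fix g = {p, q} \<and> attracting g p \<and> repelling g q)"

definition pA_like :: "complex set set \<Rightarrow> complex set set \<Rightarrow> (complex \<Rightarrow> complex) \<Rightarrow> bool" where
  "pA_like L1 L2 g \<longleftrightarrow> g \<in> laminar_Aut L1 L2 \<and> \<not> elliptic g \<and> \<not> parabolic g \<and>
     (\<exists>G1 G2. interleaving_pair L1 L2 G1 G2 \<and> preserves g G1 \<and> preserves g G2)"

definition properly_pseudo_Anosov ::
    "complex set set \<Rightarrow> complex set set \<Rightarrow> (complex \<Rightarrow> complex) \<Rightarrow> bool" where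
  "properly_pseudo_Anosov L1 L2 g \<longleftrightarrow> pA_like L1 L2 g \<and> Fix g \<noteq> {}"

end

(*
  If g fixes an endpoint of L1, it fixes the (at most two) leaves of L1 ending there. So every fixed
  point that is isolated from one side is an endpoint of one lamination and a rainbow point of the
  other one, or a rainbow point of both; near a rainbow point the leaves around it are nested with
  their images, which makes the point attracting or repelling and produces either exactly one more
  fixed point or an invariant leaf of the other lamination around it. If an endpoint occurs, walking
  around the circle the fixed points alternate between attracting endpoints of one lamination and
  repelling endpoints of the other one, and consecutive fixed endpoints of one lamination span the
  sides of one real gap: this is the pseudo-Anosov case. If none occurs, g is hyperbolic. A unique
  fixed point is a rainbow point of neither lamination, hence the common pivot of two crowns, which
  g shifts. Without fixed points, each lamination has an invariant polygon, so some power of g has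
  fixed points and is either trivial or of pseudo-Anosov type.
*)
theory Submission
  imports Defs
begin

section \<open>Arcs in angular coordinates\<close>

text \<open>Quite fullness leaves only two possibilities to a point that is not an endpoint, rainbow
  point or pivot of a crown, and they behave oppositely: leaves shrink to the first, while fixed
  tips would accumulate at the second from both sides. Looseness and the disjointness of the
  endpoint sets act together: the endpoints of one lamination are dense, so they separate any two
  leaves of the other one with a common end, and looseness then allows at most two leaves there.
  This is what makes fixedness spread along leaves. The obstacle is that a crown has infinitely many
  vertices, so the fixed set can be infinite and cannot be numbered. All dynamics is therefore read
  off on single arcs without fixed points, and the gap of the pseudo-Anosov case is found by walking
  along a gap chosen beforehand. That gap must be saturated, with no non-leaf gap across any of its
  sides: this gives realness and forces neighbouring fixed endpoints to be consecutive vertices. For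
  an automorphism without fixed points, the gaps of its power are invariant because the fixed set of
  the power determines them.\<close>

declare mem_sphere [simp del] mem_sphere_0 [simp del]

text \<open>The counter-clockwise angle from \<open>p\<close> to \<open>x\<close>. Reading the angles of finitely many points from a
  common base point turns every question about their circular order into linear arithmetic.\<close>

definition ang :: "complex \<Rightarrow> complex \<Rightarrow> real" where
  "ang p x = Arg2pi (x / p)"

lemma ang_ge0: "0 \<le> ang p x" and ang_lt_2pi: "ang p x < 2 * pi"
  by (auto simp: ang_def Arg2pi_ge_0 Arg2pi_lt_2pi)

lemma ang_eq:
  assumes "p \<in> S1" "x \<in> S1" shows "p * cis (ang p x) = x"
proof -
  have "p \<noteq> 0" using assms by (auto simp: mem_sphere_0)
  moreover have "norm (x / p) = 1" using assms by (simp add: norm_divide mem_sphere_0)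
  ultimately show ?thesis
    using Arg2pi_eq[of "x / p"] by (simp add: ang_def cis_conv_exp)
qed

lemma ang_mult_cis:
  assumes "p \<in> S1" "0 \<le> t" "t < 2 * pi" shows "ang p (p * cis t) = t"
proof -
  have "p \<noteq> 0" using assms by (auto simp: mem_sphere_0)
  then show ?thesis
    unfolding ang_def using assms
    by (intro Arg2pi_unique[of 1]) (auto simp: cis_conv_exp)
qed

lemma mult_cis_S1 [simp]: "p \<in> S1 \<Longrightarrow> p * cis t \<in> S1"
  by (simp add: norm_mult mem_sphere_0)

lemma one_S1 [simp]: "1 \<in> S1" and cis_S1 [simp]: "cis t \<in> S1"
  by (simp_all add: mem_sphere_0)

lemma S1_eq_cis: "p \<in> S1 \<Longrightarrow> \<exists>t. p = cis t"
  using ang_eq[of 1 p] by (metis one_S1 mult_1)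

lemma ang_inj: "\<lbrakk>p \<in> S1; x \<in> S1; y \<in> S1; ang p x = ang p y\<rbrakk> \<Longrightarrow> x = y"
  by (metis ang_eq)

lemma ang_self [simp]: "p \<in> S1 \<Longrightarrow> ang p p = 0"
  using ang_mult_cis[of p 0] by simp

lemma ang_pos: "\<lbrakk>p \<in> S1; x \<in> S1; x \<noteq> p\<rbrakk> \<Longrightarrow> 0 < ang p x"
  by (metis ang_inj ang_self ang_ge0 order_le_less)

lemma cis_neq:
  assumes "a < b" "b < a + 2 * pi" shows "cis a \<noteq> cis b"
proof
  assume "cis a = cis b"
  then obtain n :: int where n: "b = a + 2 * pi * n" using cis_eq_iff_int[of b a] by auto
  then have "2 * pi * 0 < 2 * pi * n" "2 * pi * n < 2 * pi * 1" using assms by linarith+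
  then show False by (simp add: zero_less_mult_iff)
qed

lemma ccw_S1: "ccw u z v \<Longrightarrow> u \<in> S1 \<and> z \<in> S1 \<and> v \<in> S1 \<and> u \<noteq> z \<and> z \<noteq> v \<and> u \<noteq> v"
  unfolding ccw_def
  by (elim exE conjE, hypsubst) (auto dest: cis_neq simp: cis_neq)

lemma ccw_asym: assumes "ccw u z v" shows "\<not> ccw v z u"
proof -
  have 1: "u \<in> S1" "v \<in> S1" "u \<noteq> v" using ccw_S1[OF assms] by auto
  have "z \<in> open_arc u v" using assms by (simp add: open_arc_def)
  then have "z \<notin> open_arc v u"
    unfolding open_arc_swap[OF 1] using closure_subset by blast
  then show ?thesis by (simp add: open_arc_def)
qed

text \<open>Cutting the circle at \<open>p\<close> turns a cyclic order into one of its three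
  rotations; when the cut falls inside the triple, the point on the far side of it is lifted by one
  full turn more or less.\<close>

lemma ccw_ang_aux:
  assumes p: "p \<in> S1" and "x \<in> S1" "y \<in> S1" "z \<in> S1"
    and "ang p x < ang p y \<and> ang p y < ang p z \<or> ang p y < ang p z \<and> ang p z < ang p x \<or>
       ang p z < ang p x \<and> ang p x < ang p y"
  shows "ccw x y z"
proof -
  obtain \<theta> where t: "p = cis \<theta>" using S1_eq_cis p by blast
  have e: "w = cis (\<theta> + ang p w)" "w = cis (\<theta> + ang p w + 2 * pi)" "w = cis (\<theta> + ang p w - 2 * pi)"
    if "w \<in> S1" for w
  proof -
    show 1: "w = cis (\<theta> + ang p w)" using ang_eq[OF p that] t by (simp add: cis_mult)
    show "w = cis (\<theta> + ang p w + 2 * pi)" "w = cis (\<theta> + ang p w - 2 * pi)"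
      using cis_shift[of "\<theta> + ang p w" 1] cis_shift[of "\<theta> + ang p w" "-1"] 1 by simp_all
  qed
  have b: "0 \<le> ang p w" "ang p w < 2 * pi" for w by (rule ang_ge0 ang_lt_2pi)+
  from assms(5) show ?thesis
  proof (elim disjE)
    assume "ang p x < ang p y \<and> ang p y < ang p z"
    then show ?thesis unfolding ccw_def
      using e(1)[OF assms(2)] e(1)[OF assms(3)] e(1)[OF assms(4)] b[of x] b[of z]
      by (intro exI[of _ "\<theta> + ang p x"] exI[of _ "\<theta> + ang p y"] exI[of _ "\<theta> + ang p z"] conjI) (assumption | linarith)+
  next
    assume "ang p y < ang p z \<and> ang p z < ang p x"
    then show ?thesis unfolding ccw_def
      using e(3)[OF assms(2)] e(1)[OF assms(3)] e(1)[OF assms(4)] b[of x] b[of y] b[of z]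
      by (intro exI[of _ "\<theta> + ang p x - 2 * pi"] exI[of _ "\<theta> + ang p y"] exI[of _ "\<theta> + ang p z"] conjI) (assumption | linarith)+
  next
    assume "ang p z < ang p x \<and> ang p x < ang p y"
    then show ?thesis unfolding ccw_def
      using e(1)[OF assms(2)] e(1)[OF assms(3)] e(2)[OF assms(4)] b[of x] b[of y] b[of z]
      by (intro exI[of _ "\<theta> + ang p x"] exI[of _ "\<theta> + ang p y"] exI[of _ "\<theta> + ang p z + 2 * pi"] conjI) (assumption | linarith)+
  qed
qed

lemma ccw_ang:
  assumes p: "p \<in> S1"
  shows "ccw x y z \<longleftrightarrow> x \<in> S1 \<and> y \<in> S1 \<and> z \<in> S1 \<and>
      (ang p x < ang p y \<and> ang p y < ang p z \<or> ang p y < ang p z \<and> ang p z < ang p x \<or>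
       ang p z < ang p x \<and> ang p x < ang p y)" (is "_ \<longleftrightarrow> ?R x y z")
proof
  assume c: "ccw x y z"
  have d: "x \<in> S1" "y \<in> S1" "z \<in> S1" "x \<noteq> y" "y \<noteq> z" "x \<noteq> z" using ccw_S1[OF c] by auto
  then have "ang p x \<noteq> ang p y" "ang p y \<noteq> ang p z" "ang p x \<noteq> ang p z"
    using ang_inj[OF p] by blast+
  moreover have "\<not> ?R z y x" using ccw_ang_aux[OF p, of z y x] ccw_asym[OF c] by blast
  ultimately show "?R x y z" using d(1-3) by linarith
qed (use ccw_ang_aux[OF p] in blast)

lemma mem_open_arc:
  "p \<in> S1 \<Longrightarrow> z \<in> open_arc u v \<longleftrightarrow> u \<in> S1 \<and> z \<in> S1 \<and> v \<in> S1 \<and>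
      (ang p u < ang p z \<and> ang p z < ang p v \<or> ang p z < ang p v \<and> ang p v < ang p u \<or>
       ang p v < ang p u \<and> ang p u < ang p z)"
  by (simp add: open_arc_def ccw_ang[of p])

lemma mem_open_arc0:
  "u \<in> S1 \<Longrightarrow> z \<in> open_arc u v \<longleftrightarrow> z \<in> S1 \<and> v \<in> S1 \<and> 0 < ang u z \<and> ang u z < ang u v"
  using ang_ge0[of u v] ang_ge0[of u z] by (auto simp: mem_open_arc[of u])

lemma mem_open_arc1:
  assumes "u \<in> S1" "x \<in> S1"
  shows "z \<in> open_arc x u \<longleftrightarrow> z \<in> S1 \<and> x \<noteq> u \<and> ang u x < ang u z"
  using assms ang_ge0[of u x] ang_ge0[of u z] ang_pos[of u x]
  by (cases "x = u") (auto simp: mem_open_arc[of u])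

lemma open_arc_subset_S1: "open_arc u v \<subseteq> S1"
  by (auto simp: mem_open_arc[of 1])

lemma open_arc_ends: "u \<notin> open_arc u v \<and> v \<notin> open_arc u v"
  by (auto simp: mem_open_arc[of 1])

lemma open_arc_disjoint: "open_arc u v \<inter> open_arc v u = {}"
  by (auto simp: mem_open_arc[of 1])

lemma open_arc_nonempty_D: "z \<in> open_arc u v \<Longrightarrow> u \<in> S1 \<and> v \<in> S1 \<and> z \<in> S1 \<and> u \<noteq> v"
  by (auto simp: mem_open_arc[of 1])

lemma open_arc_between:
  assumes "p \<in> S1" "0 \<le> s" "s < t" "t \<le> 2 * pi"
  obtains z where "z \<in> S1" "s < ang p z" "ang p z < t"
proof -
  have "s < (s + t) / 2" "(s + t) / 2 < t" using assms by auto
  moreover have "ang p (p * cis ((s + t) / 2)) = (s + t) / 2"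
    using assms calculation by (intro ang_mult_cis) auto
  ultimately show thesis using that[of "p * cis ((s + t) / 2)"] assms(1) by simp
qed

lemma open_arc_nonempty:
  assumes "u \<in> S1" "v \<in> S1" "u \<noteq> v"
  obtains z where "z \<in> open_arc u v"
proof -
  have "0 < ang u v" using assms by (intro ang_pos) auto
  then obtain z where "z \<in> S1" "0 < ang u z" "ang u z < ang u v"
    using open_arc_between[of u 0 "ang u v"] assms ang_lt_2pi[of u v] by (metis less_imp_le order_refl)
  then show thesis using that[of z] assms by (simp add: mem_open_arc0)
qed

lemma open_arc_trichotomy:
  assumes "u \<in> S1" "v \<in> S1" "u \<noteq> v" "z \<in> S1"
  shows "z = u \<or> z = v \<or> z \<in> open_arc u v \<or> z \<in> open_arc v u"
proof -
  have "0 < ang u z" if "z \<noteq> u" using that assms ang_pos by blast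
  moreover have "ang u z \<noteq> ang u v" if "z \<noteq> v" using that assms ang_inj by blast
  moreover have "0 < ang u v" using assms by (intro ang_pos) auto
  ultimately show ?thesis using assms mem_open_arc0[of u z v] mem_open_arc1[of u v z] by fastforce
qed

text \<open>An end of the inner arc lying off the closed outer arc, or at its wrong end, would have
  points of the inner arc next to it that are outside the outer arc; each case exhibits such a
  point.\<close>

lemma open_arc_subset_ends:
  assumes sub: "open_arc a b \<subseteq> open_arc x y" and S: "a \<in> S1" "b \<in> S1" "a \<noteq> b"
  shows "(a = x \<or> a \<in> open_arc x y) \<and> (b = y \<or> b \<in> open_arc x y)"
proof -
  obtain w where "w \<in> open_arc a b" using open_arc_nonempty[OF S] .
  then have xy: "x \<in> S1" "y \<in> S1" "x \<noteq> y" using sub open_arc_nonempty_D by blast+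
  have A0: "0 < ang x y" using ang_pos xy by auto
  have ne: "ang x a \<noteq> ang x b" using S ang_inj xy by blast
  have pa: "a = x \<or> 0 < ang x a" "b = x \<or> 0 < ang x b" using S xy ang_pos by blast+
  have lt: "ang x a < 2 * pi" "ang x b < 2 * pi" "ang x y < 2 * pi" "0 \<le> ang x a" "0 \<le> ang x b"
    by (rule ang_ge0 ang_lt_2pi)+
  have mem: "z \<in> open_arc x y \<longleftrightarrow> z \<in> S1 \<and> 0 < ang x z \<and> ang x z < ang x y" for z
    using mem_open_arc0 xy by blast
  have "a = x \<or> a \<in> open_arc x y"
  proof (rule ccontr)
    assume "\<not> ?thesis"
    then have h: "0 < ang x a" "ang x y \<le> ang x a" using pa mem[of a] S by auto
    \<comment> \<open>\<open>t\<close> is the angle at which the inner arc stops when followed from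
      \<open>a\<close>: at \<open>b\<close>, or after the full turn if it passes \<open>x\<close>
      first.\<close>
    define t where "t = (if ang x b > ang x a then ang x b else 2 * pi)"
    have "ang x a < t" "t \<le> 2 * pi" using lt less_imp_le by (auto simp: t_def)
    then obtain z where z: "z \<in> S1" "ang x a < ang x z" "ang x z < t"
      using open_arc_between[of x "ang x a" t] xy h by (metis less_imp_le)
    then have "z \<in> open_arc a b" using S xy ne
      by (auto simp: mem_open_arc[of x] t_def split: if_splits)
    then show False using sub mem[of z] z h by auto
  qed
  moreover have "b = y \<or> b \<in> open_arc x y"
  proof (rule ccontr)
    assume n: "\<not> ?thesis"
    have "ang x b \<noteq> ang x y" using n S xy ang_inj by blast
    then have h: "ang x b = 0 \<or> ang x y < ang x b" using n mem[of b] S lt by fastforce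
    show False
    proof (cases "ang x b = 0")
      case True
      then have "0 < ang x a" using ne lt by linarith
      obtain z where z: "z \<in> S1" "max (ang x a) (ang x y) < ang x z" "ang x z < 2 * pi"
        using open_arc_between[of x "max (ang x a) (ang x y)" "2 * pi"] xy lt
        by (metis le_max_iff_disj max_less_iff_conj order_refl)
      then have "z \<in> open_arc a b" using S xy True \<open>0 < ang x a\<close>
        by (auto simp: mem_open_arc[of x])
      then show False using sub mem[of z] z by auto
    next
      case False
      then have h: "ang x y < ang x b" using h by blast
      \<comment> \<open>Now the point is sought just before \<open>b\<close>; the \<open>max\<close>
        keeps it inside the inner arc and beyond \<open>y\<close> at once.\<close>
      define s where "s = (if ang x a < ang x b then max (ang x a) (ang x y) else ang x y)"
      have "s < ang x b" "0 \<le> s" using h A0 by (auto simp: s_def)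
      then obtain z where z: "z \<in> S1" "s < ang x z" "ang x z < ang x b"
        using open_arc_between[of x s "ang x b"] xy lt by (metis less_imp_le)
      then have "z \<in> open_arc a b" using S xy ne
        by (auto simp: mem_open_arc[of x] s_def split: if_splits)
      moreover have "ang x y < ang x z" using z by (auto simp: s_def split: if_splits)
      ultimately show False using sub mem[of z] by auto
    qed
  qed
  ultimately show ?thesis by blast
qed

lemma open_arc_inject:
  assumes "open_arc a b = open_arc c d" "a \<in> S1" "b \<in> S1" "a \<noteq> b"
  shows "a = c \<and> b = d"
  using open_arc_subset_ends[of a b c d] assms open_arc_ends by (metis order_refl)

lemma open_arc_eq_cis:
  assumes "u \<in> S1" "v \<in> S1" "u \<noteq> v"
  shows "open_arc u v = (\<lambda>t. u * cis t) ` {0<..<ang u v}"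
proof (intro set_eqI iffI)
  fix z assume "z \<in> open_arc u v"
  then have "z \<in> S1" "0 < ang u z" "ang u z < ang u v" using mem_open_arc0 assms by auto
  then show "z \<in> (\<lambda>t. u * cis t) ` {0<..<ang u v}"
    using ang_eq[of u z] assms by (intro image_eqI[of _ _ "ang u z"]) auto
next
  fix z assume "z \<in> (\<lambda>t. u * cis t) ` {0<..<ang u v}"
  then obtain t where t: "z = u * cis t" "0 < t" "t < ang u v"
    by (elim imageE) (simp only: greaterThanLessThan_iff)
  then have "ang u z = t" using ang_mult_cis[of u t] assms ang_lt_2pi[of u v] by simp
  then show "z \<in> open_arc u v" using mem_open_arc0[of u z v] t assms by simp
qed

lemma continuous_on_mult_cis: "continuous_on A (\<lambda>t. u * cis t)"
  by (intro continuous_intros)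

lemma connected_open_arc: "connected (open_arc u v)"
proof (cases "u \<in> S1 \<and> v \<in> S1 \<and> u \<noteq> v")
  case True
  then show ?thesis
    using open_arc_eq_cis[of u v] connected_continuous_image[OF continuous_on_mult_cis, of "{0<..<ang u v}" u]
    by simp
next
  case False
  then have "open_arc u v = {}" using open_arc_nonempty_D by blast
  then show ?thesis by simp
qed

lemma closure_S1_subset: "A \<subseteq> S1 \<Longrightarrow> closure A \<subseteq> S1"
  by (simp add: closure_minimal)

lemma openin_open_arc: "openin (top_of_set S1) (open_arc u v)"
proof (cases "u \<in> S1 \<and> v \<in> S1 \<and> u \<noteq> v")
  case True
  then have "open_arc u v = S1 - closure (open_arc v u)"
    using open_arc_swap[of v u] by auto
  then show ?thesis
    by (metis Diff_eq closed_closure open_Compl openin_open_Int)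
next
  case False
  then have "open_arc u v = {}" using open_arc_nonempty_D by blast
  then show ?thesis by simp
qed

lemma closure_open_arc:
  assumes "u \<in> S1" "v \<in> S1" "u \<noteq> v"
  shows "closure (open_arc u v) = open_arc u v \<union> {u, v}"
proof -
  have "closure (open_arc u v) = S1 - open_arc v u"
    using open_arc_swap[OF assms] closure_S1_subset[OF open_arc_subset_S1] by blast
  also have "\<dots> = open_arc u v \<union> {u, v}"
  proof (intro set_eqI iffI)
    fix z assume "z \<in> S1 - open_arc v u"
    then show "z \<in> open_arc u v \<union> {u, v}" using open_arc_trichotomy[OF assms, of z] by blast
  next
    fix z assume "z \<in> open_arc u v \<union> {u, v}"
    then show "z \<in> S1 - open_arc v u"
      using assms(1,2) open_arc_ends[of v u] open_arc_disjoint[of u v] open_arc_subset_S1[of u v]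
      by (elim UnE insertE) auto
  qed
  finally show ?thesis .
qed

lemma continuous_on_ang:
  assumes "p \<in> S1" shows "continuous_on (S1 - {p}) (ang p)"
proof -
  have p0: "p \<noteq> 0" using assms by (auto simp: mem_sphere_0)
  have "isCont Arg2pi (x / p)" if "x \<in> S1 - {p}" for x
  proof (rule continuous_at_Arg2pi, rule notI)
    assume "x / p \<in> \<real>\<^sub>\<ge>\<^sub>0"
    then obtain r where r: "x / p = of_real r" "r \<ge> 0" by (auto elim: nonneg_Reals_cases)
    have "norm (x / p) = 1" using that assms by (simp add: norm_divide mem_sphere_0)
    then have "r = 1" using r by simp
    then show False using r that p0 by (simp add: field_simps)
  qed
  then have "isCont (\<lambda>x. Arg2pi (x / p)) x" if "x \<in> S1 - {p}" for x
    using that p0 by (intro isCont_o2[of x "\<lambda>x. x / p" Arg2pi]) (auto intro!: continuous_intros)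
  then show ?thesis unfolding ang_def by (intro continuous_at_imp_continuous_on) blast
qed

lemma connected_open_real:
  fixes T :: "real set"
  assumes "open T" "connected T" "T \<noteq> {}" "T \<subseteq> {l..r}"
  shows "\<exists>a b. a < b \<and> T = {a<..<b}"
proof -
  have bd: "bdd_below T" "bdd_above T" using assms(4) by (meson bdd_below_Icc bdd_above_Icc bdd_below_mono bdd_above_mono)+
  have "T = {Inf T<..<Sup T}"
  proof (intro set_eqI iffI)
    fix x assume x: "x \<in> T"
    obtain e where e: "e > 0" "ball x e \<subseteq> T" using assms(1) x openE by blast
    then have "x - e / 2 \<in> T" "x + e / 2 \<in> T" by (auto simp: subset_iff dist_real_def)
    then have "Inf T \<le> x - e / 2" "x + e / 2 \<le> Sup T" using bd by (auto intro: cInf_lower cSup_upper)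
    then show "x \<in> {Inf T<..<Sup T}" using e(1) by auto
  next
    fix x assume "x \<in> {Inf T<..<Sup T}"
    then obtain a b where "a \<in> T" "a < x" "b \<in> T" "x < b"
      using cInf_less_iff[OF assms(3) bd(1)] less_cSup_iff[OF assms(3) bd(2)] by auto
    then show "x \<in> T" using connectedD_interval[OF assms(2), of a b x] by auto
  qed
  moreover have "Inf T < Sup T" using assms(3) calculation by fastforce
  ultimately show ?thesis by blast
qed

section \<open>Good intervals, duality, and cutting the circle at the ends of an arc\<close>

lemma good_interval_open_arc [simp, intro]:
  "\<lbrakk>u \<in> S1; v \<in> S1; u \<noteq> v\<rbrakk> \<Longrightarrow> good_interval (open_arc u v)"
  unfolding good_interval_def by blast

lemma good_intervalE:
  assumes "good_interval I"
  obtains u v where "u \<in> S1" "v \<in> S1" "u \<noteq> v" "I = open_arc u v"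
  using assms unfolding good_interval_def by blast

lemma good_interval_arcD:
  "good_interval (open_arc u v) \<Longrightarrow> u \<in> S1 \<and> v \<in> S1 \<and> u \<noteq> v"
  by (metis good_intervalE open_arc_nonempty open_arc_nonempty_D)

text \<open>Cut at the missing point \<open>q\<close>, the set becomes an open subinterval of one
  turn, and only the full turn fails to be a good interval. Unions of chains of sides are recognized
  as sides in this way.\<close>

lemma connected_openin_S1:
  assumes C: "connected C" "openin (top_of_set S1) C" "C \<noteq> {}" and q: "q \<in> S1" "q \<notin> C"
  shows "good_interval C \<or> C = S1 - {q}"
proof -
  have CS: "C \<subseteq> S1 - {q}" using C(2) q openin_imp_subset by fastforce
  define T where "T = ang q ` C"
  have T: "T = {t \<in> {0<..<2 * pi}. q * cis t \<in> C}"
  proof (intro set_eqI iffI)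
    fix t assume "t \<in> T"
    then obtain x where "x \<in> C" "t = ang q x" by (auto simp: T_def)
    then show "t \<in> {t \<in> {0<..<2 * pi}. q * cis t \<in> C}"
      using CS ang_pos[of q x] ang_eq[of q x] ang_lt_2pi[of q x] q by auto
  next
    fix t assume "t \<in> {t \<in> {0<..<2 * pi}. q * cis t \<in> C}"
    then show "t \<in> T" unfolding T_def using ang_mult_cis[of q t] q by (intro image_eqI) auto
  qed
  have "openin (top_of_set {0<..<2 * pi}) ({0<..<2 * pi} \<inter> (\<lambda>t. q * cis t) -` C)"
    by (rule continuous_openin_preimage[OF continuous_on_mult_cis _ C(2)]) (use q in auto)
  then have "open T" unfolding T
    by (simp add: openin_open_eq Int_def vimage_def)
  moreover have "connected T" unfolding T_def
    using C(1) continuous_on_subset[OF continuous_on_ang[OF q(1)] CS] by (rule connected_continuous_image[rotated])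
  moreover have "T \<subseteq> {0..2 * pi}" unfolding T by auto
  ultimately obtain a b where ab: "a < b" "T = {a<..<b}"
    using connected_open_real[of T 0 "2 * pi"] C(3) unfolding T_def by blast
  have "0 \<le> a \<and> b \<le> 2 * pi"
  proof -
    have "{a<..<b} \<subseteq> {0..2 * pi}" using ab(2) \<open>T \<subseteq> {0..2 * pi}\<close> by simp
    then show ?thesis using ab(1) by (simp add: greaterThanLessThan_subseteq_atLeastAtMost_iff)
  qed
  have C': "x \<in> C \<longleftrightarrow> x \<in> S1 \<and> a < ang q x \<and> ang q x < b" for x
  proof
    assume "x \<in> C"
    then show "x \<in> S1 \<and> a < ang q x \<and> ang q x < b" using CS ab(2) unfolding T_def by auto
  next
    assume x: "x \<in> S1 \<and> a < ang q x \<and> ang q x < b"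
    then have "ang q x \<in> T" using ab(2) by simp
    then obtain y where "y \<in> C" "ang q y = ang q x" unfolding T_def by force
    then show "x \<in> C" using ang_inj[of q x y] x q CS by auto
  qed
  show ?thesis
  proof (cases "a = 0 \<and> b = 2 * pi")
    case True
    have "x \<in> C" if "x \<in> S1 - {q}" for x
      using C'[of x] that True ang_pos[of q x] ang_lt_2pi[of q x] q by auto
    then show ?thesis using CS by blast
  next
    case False
    show ?thesis
    proof (cases "b = 2 * pi")
      case True
      \<comment> \<open>The right end is \<open>q\<close> itself, whose angle is 0 rather than a
        full turn, so this case cannot be read off like the generic one.\<close>
      define u where "u = q * cis a"
      have a: "0 < a" "a < 2 * pi" using False True ab \<open>0 \<le> a \<and> b \<le> 2 * pi\<close> by auto
      have u: "u \<in> S1" "ang q u = a" unfolding u_def using q a ang_mult_cis[of q a] by simp_all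
      then have "u \<noteq> q" using a q by auto
      then have "C = open_arc u q"
        using C' mem_open_arc1[of q u] u q True ang_lt_2pi by (intro set_eqI) simp
      then show ?thesis using u q \<open>u \<noteq> q\<close> by auto
    next
      case b: False
      define u v where "u = q * cis a" and "v = q * cis b"
      have a: "0 \<le> a" "a < 2 * pi" "0 \<le> b" "b < 2 * pi" using b ab \<open>0 \<le> a \<and> b \<le> 2 * pi\<close> by auto
      have u: "u \<in> S1" "ang q u = a" "v \<in> S1" "ang q v = b" unfolding u_def v_def
        using q a ang_mult_cis[of q a] ang_mult_cis[of q b] by simp_all
      then have "C = open_arc u v" using C' mem_open_arc[of q _ u v] q ab(1)
        by (intro set_eqI) auto
      moreover have "u \<noteq> v" using u ab by auto
      ultimately show ?thesis using u by auto
    qed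
  qed
qed

lemma good_subset_S1: "good_interval I \<Longrightarrow> I \<subseteq> S1"
  by (elim good_intervalE) (simp add: open_arc_subset_S1)

lemma good_openin: "good_interval I \<Longrightarrow> openin (top_of_set S1) I"
  by (elim good_intervalE) (simp add: openin_open_arc)

lemma good_connected: "good_interval I \<Longrightarrow> connected I"
  by (elim good_intervalE) (simp add: connected_open_arc)

lemma good_nonempty: "good_interval I \<Longrightarrow> I \<noteq> {}"
  by (metis good_intervalE open_arc_nonempty emptyE)

lemma good_dual [simp]: "good_interval I \<Longrightarrow> good_interval (dual I)"
  by (elim good_intervalE) (auto simp: dual_open_arc)

lemma dual_dual [simp]: "good_interval I \<Longrightarrow> dual (dual I) = I"
  by (elim good_intervalE) (auto simp: dual_open_arc)

lemma dual_eq: "good_interval I \<Longrightarrow> dual I = S1 - closure I"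
  by (elim good_intervalE) (simp add: dual_open_arc open_arc_swap[symmetric])

lemma dual_disjoint: "good_interval I \<Longrightarrow> I \<inter> dual I = {}"
  using closure_subset[of I] by (auto simp: dual_eq)

lemma dual_mono: "\<lbrakk>good_interval I; good_interval J; I \<subseteq> J\<rbrakk> \<Longrightarrow> dual J \<subseteq> dual I"
  using closure_mono[of I J] by (auto simp: dual_eq)

lemma dual_subset_swap: "\<lbrakk>good_interval I; good_interval J; dual I \<subseteq> J\<rbrakk> \<Longrightarrow> dual J \<subseteq> I"
  using dual_mono[of "dual I" J] by simp

lemma dual_mono_iff: "\<lbrakk>good_interval I; good_interval J\<rbrakk> \<Longrightarrow> dual J \<subseteq> dual I \<longleftrightarrow> I \<subseteq> J"
  using dual_mono[of I J] dual_mono[of "dual J" "dual I"] by auto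

text \<open>The dual is the complement of the closure, and an open set disjoint from
  \<open>J\<close> is disjoint from its closure.\<close>

lemma subset_dual_iff:
  assumes "good_interval I" "good_interval J" shows "I \<subseteq> dual J \<longleftrightarrow> I \<inter> J = {}"
proof
  assume "I \<inter> J = {}"
  moreover have "openin (top_of_set S1) I" and J: "J \<subseteq> S1" using assms good_openin good_subset_S1 by auto
  then obtain T where T: "open T" "I = S1 \<inter> T" unfolding openin_open by auto
  ultimately have "T \<inter> J = {}" using J by blast
  then have "I \<inter> closure J = {}" using open_Int_closure_eq_empty[OF T(1), of J] T(2) by blast
  then show "I \<subseteq> dual J" using assms good_subset_S1[of I] by (auto simp: dual_eq)
qed (use assms dual_disjoint[of J] in blast)

lemma vertices_leaf: "\<lbrakk>u \<in> S1; v \<in> S1; u \<noteq> v\<rbrakk> \<Longrightarrow> vertices (leaf (open_arc u v)) = {u, v}"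
proof -
  assume h: "u \<in> S1" "v \<in> S1" "u \<noteq> v"
  have "vertices (leaf (open_arc u v)) = S1 - (open_arc u v \<union> open_arc v u)"
    unfolding vertices_def leaf_def dual_open_arc[OF h] by simp
  also have "\<dots> = {u, v}"
  proof (intro set_eqI iffI)
    fix z assume "z \<in> S1 - (open_arc u v \<union> open_arc v u)"
    then show "z \<in> {u, v}" using open_arc_trichotomy[OF h, of z] by blast
  next
    fix z assume "z \<in> {u, v}"
    then show "z \<in> S1 - (open_arc u v \<union> open_arc v u)"
      using h open_arc_ends[of u v] open_arc_ends[of v u] by (elim insertE) auto
  qed
  finally show ?thesis .
qed

text \<open>Removing \<open>u\<close> and \<open>v\<close> leaves two disjoint open arcs, and a
  connected set stays in the one it meets.\<close>

lemma connected_subset_arc: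
  assumes "connected A" "A \<subseteq> S1" "A \<inter> open_arc u v \<noteq> {}" "u \<notin> A" "v \<notin> A"
  shows "A \<subseteq> open_arc u v"
proof (rule ccontr)
  assume n: "\<not> A \<subseteq> open_arc u v"
  have h: "u \<in> S1" "v \<in> S1" "u \<noteq> v" using assms(3) open_arc_nonempty_D by auto
  have sub: "A \<subseteq> open_arc u v \<union> open_arc v u" using open_arc_trichotomy[OF h] assms by blast
  obtain U V where UV: "open U" "open_arc u v = S1 \<inter> U" "open V" "open_arc v u = S1 \<inter> V"
    using openin_open_arc[of u v] openin_open_arc[of v u] unfolding openin_open by auto
  have "U \<inter> V \<inter> A = {}" using UV open_arc_disjoint[of u v] assms(2) by blast
  moreover have "A \<subseteq> U \<union> V" "U \<inter> A \<noteq> {}" "V \<inter> A \<noteq> {}" using sub UV assms n by blast+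
  ultimately show False using connectedD[OF assms(1), of U V] UV by auto
qed

text \<open>Each arc is a connected set avoiding the ends of the other one. Sides of different gaps
  are identified in this way.\<close>

lemma good_eqI:
  assumes "open_arc a b \<inter> open_arc c d \<noteq> {}"
    and "a \<notin> open_arc c d" "b \<notin> open_arc c d" "c \<notin> open_arc a b" "d \<notin> open_arc a b"
  shows "open_arc a b = open_arc c d"
  using connected_subset_arc[OF connected_open_arc open_arc_subset_S1, of a b c d]
    connected_subset_arc[OF connected_open_arc open_arc_subset_S1, of c d a b] assms by blast

lemma open_arc_left_mono:
  assumes "p \<in> S1" "b \<in> S1" "ang p a \<le> ang p b" shows "open_arc p a \<subseteq> open_arc p b"
  using assms by (auto simp: mem_open_arc0)

lemma open_arc_left_nested:
  assumes "p \<in> S1" "a \<in> S1" "b \<in> S1" shows "open_arc p a \<subseteq> open_arc p b \<or> open_arc p b \<subseteq> open_arc p a"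
  using open_arc_left_mono[of p b a] open_arc_left_mono[of p a b] assms by (cases "ang p a \<le> ang p b") auto

lemma open_arc_left_meet:
  assumes "p \<in> S1" "a \<in> S1" "b \<in> S1" "p \<noteq> a" "p \<noteq> b" shows "open_arc p a \<inter> open_arc p b \<noteq> {}"
  using open_arc_left_nested[of p a b] assms good_nonempty good_interval_open_arc by blast

lemma infinite_open_arc:
  assumes "u \<in> S1" "v \<in> S1" "u \<noteq> v" shows "infinite (open_arc u v)"
proof -
  have "0 < ang u v" using ang_pos assms by auto
  moreover have "inj_on (\<lambda>t. u * cis t) {0<..<ang u v}"
  proof (rule inj_onI)
    fix s t assume "s \<in> {0<..<ang u v}" "t \<in> {0<..<ang u v}" "u * cis s = u * cis t"
    moreover from this have "ang u (u * cis s) = s" "ang u (u * cis t) = t"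
      using ang_mult_cis[of u s] ang_mult_cis[of u t] assms(1) ang_lt_2pi[of u v] by simp_all
    ultimately show "s = t" by metis
  qed
  ultimately show ?thesis
    unfolding open_arc_eq_cis[OF assms] by (simp add: finite_image_iff)
qed

lemma infinite_good: "good_interval I \<Longrightarrow> infinite I"
  by (metis good_intervalE infinite_open_arc)

lemma good_avoid_finite:
  assumes "good_interval I" "finite B" obtains x where "x \<in> I" "x \<notin> B"
  using infinite_good[OF assms(1)] assms(2) by (metis finite_subset subsetI)

lemma open_arc_subarc:
  assumes "z \<in> open_arc u v"
  shows "open_arc u z \<subseteq> open_arc u v" "open_arc z v \<subseteq> open_arc u v"
    "z \<notin> open_arc u z" "z \<notin> open_arc z v" "open_arc u z \<inter> open_arc z v = {}"
  using assms open_arc_nonempty_D[OF assms] by (auto simp: mem_open_arc[of u])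

lemma closure_good: 
  assumes "good_interval I" "x \<in> closure I" "x \<notin> I"
  shows "x \<in> vertices (leaf I)"
  using assms closure_S1_subset[OF good_subset_S1[OF assms(1)]] by (auto simp: vertices_def leaf_def dual_eq)

lemma good_cut:
  assumes "good_interval I" "p \<in> S1" "p \<notin> vertices (leaf I)"
  shows "p \<in> I \<longleftrightarrow> p \<notin> dual I"
  using assms dual_disjoint[of I] by (auto simp: vertices_def leaf_def)


section \<open>Gaps of lamination systems\<close>

lemma lam_good: "\<lbrakk>lamination_system L; I \<in> L\<rbrakk> \<Longrightarrow> good_interval I"
  by (simp add: lamination_system_def)

lemma lam_dual: "\<lbrakk>lamination_system L; I \<in> L\<rbrakk> \<Longrightarrow> dual I \<in> L"
  by (simp add: lamination_system_def)

lemma lam_arc_swap: "\<lbrakk>lamination_system L; open_arc u v \<in> L\<rbrakk> \<Longrightarrow> open_arc v u \<in> L"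
  using lam_dual dual_open_arc good_interval_arcD lam_good by metis

lemma lam_arcD: "\<lbrakk>lamination_system L; open_arc u v \<in> L\<rbrakk> \<Longrightarrow> u \<in> S1 \<and> v \<in> S1 \<and> u \<noteq> v"
  using good_interval_arcD lam_good by blast

lemma lam_arcE:
  assumes "lamination_system L" "I \<in> L"
  obtains u v where "I = open_arc u v" "u \<in> S1" "v \<in> S1" "u \<noteq> v"
  using assms lam_good good_intervalE by metis

text \<open>A working form of the axiom that leaves do not cross. The last alternative, where the
  two sides cover all but the ends of \<open>I\<close>, is refuted in applications by a point of
  \<open>dual I\<close> outside \<open>J\<close>.\<close>

lemma noncross:
  assumes "lamination_system L" "I \<in> L" "J \<in> L"
  shows "I \<subseteq> J \<or> J \<subseteq> I \<or> I \<inter> J = {} \<or> dual I \<subseteq> J"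
proof -
  have g: "good_interval I" "good_interval J" using assms lam_good by auto
  have "lies_on I J \<or> lies_on I (dual J)" using assms unfolding lamination_system_def by blast
  then show ?thesis unfolding lies_on_def
    using g subset_dual_iff[of I J] dual_mono_iff[of J I] by auto
qed

lemma endpoints_iff:
  assumes "lamination_system L"
  shows "p \<in> endpoints L \<longleftrightarrow> (\<exists>a. open_arc p a \<in> L)"
proof
  assume "p \<in> endpoints L"
  then obtain I where I: "I \<in> L" "p \<in> vertices (leaf I)" by (auto simp: endpoints_def)
  then obtain u v where uv: "I = open_arc u v" "u \<in> S1" "v \<in> S1" "u \<noteq> v"
    using lam_arcE assms by metis
  then show "\<exists>a. open_arc p a \<in> L" using I lam_arc_swap[OF assms, of u v] vertices_leaf[of u v] by auto
next
  assume "\<exists>a. open_arc p a \<in> L"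
  then obtain a where a: "open_arc p a \<in> L" by blast
  then have "p \<in> vertices (leaf (open_arc p a))" using lam_arcD[OF assms a] vertices_leaf by simp
  then show "p \<in> endpoints L" using a by (auto simp: endpoints_def)
qed

lemma endpointsI:
  assumes "lamination_system L" "open_arc u v \<in> L" shows "u \<in> endpoints L" "v \<in> endpoints L"
  using endpoints_iff[OF assms(1)] assms(2) lam_arc_swap[OF assms] by blast+

lemma endpoints_leafI: "\<lbrakk>I \<in> L; p \<in> vertices (leaf I)\<rbrakk> \<Longrightarrow> p \<in> endpoints L"
  by (auto simp: endpoints_def)

text \<open>The closure axiom speaks of increasing sequences, while the chains met below may be
  uncountable; the Lindelof property bridges the two.\<close>

lemma chain_sequence:
  assumes "F \<noteq> {}" "\<And>I. I \<in> F \<Longrightarrow> good_interval I"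
    and chain: "\<And>I J. I \<in> F \<Longrightarrow> J \<in> F \<Longrightarrow> I \<subseteq> J \<or> J \<subseteq> I"
  obtains J :: "nat \<Rightarrow> complex set" where "incseq J" "range J \<subseteq> F" "(\<Union>k. J k) = \<Union>F"
proof -
  obtain F' where F': "F' \<subseteq> F" "countable F'" "\<Union>F' = \<Union>F"
    by (rule Lindelof_openin[of F S1]) (use good_openin assms(2) in blast)+
  have "\<Union>F \<noteq> {}" using assms(1,2) good_nonempty by fastforce
  then have ne: "F' \<noteq> {}" using F' by auto
  define e where "e = from_nat_into F'"
  have r: "range e = F'" using F' ne by (simp add: e_def)
  \<comment> \<open>The enumeration of the countable subfamily need not be increasing. Its partial
    unions are, and a finite union in a chain is one of its members.\<close>
  define J where "J n = (\<Union>i\<le>n. e i)" for n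
  have "J n \<in> F" for n
  proof (induction n)
    case 0
    then show ?case using r F' by (auto simp: J_def)
  next
    case (Suc n)
    have "J (Suc n) = J n \<union> e (Suc n)" by (simp add: J_def atMost_Suc Un_commute)
    then show ?case using chain[OF Suc, of "e (Suc n)"] Suc r F'
      by (metis Un_absorb1 Un_absorb2 rangeI subsetD)
  qed
  moreover have "incseq J" unfolding incseq_def J_def by (fastforce intro: order_trans)
  moreover have "(\<Union>k. J k) = (\<Union>k. e k)" by (auto simp: J_def)
  then have "(\<Union>k. J k) = \<Union>F" using r F' by simp
  ultimately show thesis using that by blast
qed

lemma chain_Union_mem:
  assumes L: "lamination_system L" and F: "F \<noteq> {}" "F \<subseteq> L"
    and chain: "\<And>I J. I \<in> F \<Longrightarrow> J \<in> F \<Longrightarrow> I \<subseteq> J \<or> J \<subseteq> I"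
    and good: "good_interval (\<Union>F)"
  shows "\<Union>F \<in> L"
proof -
  have gF: "good_interval I" if "I \<in> F" for I using F(2) lam_good[OF L] that by auto
  obtain J where J: "incseq J" "range J \<subseteq> F" "(\<Union>k. J k) = \<Union>F"
    by (rule chain_sequence[OF F(1) gF chain])
  have "(\<Union>k. J k) \<in> L"
    using L J F(2) good unfolding lamination_system_def by (metis (no_types, lifting) subset_trans)
  then show ?thesis using J by simp
qed

lemma Union_good_cases:
  assumes "F \<noteq> {}" "\<And>I. I \<in> F \<Longrightarrow> good_interval I \<and> x \<in> I \<and> q \<notin> I" "q \<in> S1"
  shows "good_interval (\<Union>F) \<or> \<Union>F = S1 - {q}"
proof (rule connected_openin_S1)
  show "connected (\<Union>F)" using assms good_connected by (intro connected_Union) auto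
  show "openin (top_of_set S1) (\<Union>F)" using assms good_openin by (intro openin_Union) auto
  show "\<Union>F \<noteq> {}" using assms by auto
qed (use assms in auto)

text \<open>The sides of the gap are the maximal members of the family, and \<open>sup\<close> says
  that the maximal member around each point exists. The gaps at a pivot, beside a leaf and around a
  centre of rotation are all obtained from it.\<close>

lemma gap_of_laminar_family:
  assumes L: "lamination_system L" and S: "S \<subseteq> L"
    and lam: "\<And>I J. I \<in> S \<Longrightarrow> J \<in> S \<Longrightarrow> I \<subseteq> J \<or> J \<subseteq> I \<or> I \<inter> J = {}"
    and cover: "\<And>I. I \<in> L \<Longrightarrow> \<exists>J\<in>S. I \<subseteq> J \<or> dual I \<subseteq> J"
    and sup: "\<And>x J. J \<in> S \<Longrightarrow> x \<in> J \<Longrightarrow> \<Union>{J \<in> S. x \<in> J} \<in> S"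
  shows "gap L {\<Union>{J \<in> S. x \<in> J} | x. x \<in> \<Union>S}" (is "gap L ?G")
  unfolding gap_def
proof (intro conjI ballI)
  have GS: "?G \<subseteq> S" using sup by auto
  show "?G \<subseteq> L" using GS S by blast
  have max: "J \<subseteq> U" if h: "U \<in> ?G" "J \<in> S" "J \<inter> U \<noteq> {}" for U J
  proof -
    obtain x where x: "U = \<Union>{J \<in> S. x \<in> J}" "x \<in> \<Union>S" using h(1) by auto
    then obtain K where "K \<in> S" "x \<in> K" by blast
    then have "U \<in> S" "x \<in> U" using x sup by blast+
    from lam[OF this(1) h(2)] h(3) have "U \<subseteq> J \<or> J \<subseteq> U" by blast
    then show ?thesis using x \<open>x \<in> U\<close> h(2) by auto
  qed
  show "disjoint ?G"
  proof (rule disjointI)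
    fix U V assume h: "U \<in> ?G" "V \<in> ?G" "U \<noteq> V"
    have "U \<in> S" "V \<in> S" using h(1,2) GS by (blast dest: subsetD)+
    then show "U \<inter> V = {}" using max[OF h(1), of V] max[OF h(2), of U] h(3) by blast
  qed
  show "\<exists>J\<in>?G. lies_on I J" if I: "I \<in> L" for I
  proof -
    have *: "\<exists>U\<in>?G. J \<subseteq> U" if J: "J \<in> S" for J
    proof -
      obtain x where "x \<in> J" using J S lam_good[OF L] good_nonempty by blast
      then show ?thesis using J by (intro bexI[of _ "\<Union>{J \<in> S. x \<in> J}"]) auto
    qed
    show ?thesis using cover[OF I] * unfolding lies_on_def by (meson subset_trans)
  qed
qed

lemma gap_disjoint: "\<lbrakk>gap L G; I \<in> G; J \<in> G; I \<inter> J \<noteq> {}\<rbrakk> \<Longrightarrow> I = J"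
  unfolding gap_def disjoint_def by blast

lemma gap_mem: "\<lbrakk>gap L G; I \<in> G\<rbrakk> \<Longrightarrow> I \<in> L"
  unfolding gap_def by blast

lemma gap_nonempty: "\<lbrakk>lamination_system L; gap L G\<rbrakk> \<Longrightarrow> G \<noteq> {}"
  unfolding gap_def lamination_system_def by blast

text \<open>A side containing an end of another side would, being open, meet that side, against
  disjointness.\<close>

lemma gap_vertices:
  assumes L: "lamination_system L" and G: "gap L G" and I: "open_arc u v \<in> G"
  shows "u \<in> vertices G" "v \<in> vertices G"
proof -
  have uv: "u \<in> S1" "v \<in> S1" "u \<noteq> v" using lam_arcD[OF L] gap_mem[OF G I] by auto
  have *: "w \<in> vertices G" if w: "w = u \<or> w = v" for w
  proof (rule ccontr)
    assume "w \<notin> vertices G"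
    then obtain J where J: "J \<in> G" "w \<in> J" using w uv by (auto simp: vertices_def)
    have "good_interval J" using L G J gap_mem lam_good by blast
    then obtain T where T: "open T" "J = S1 \<inter> T" using good_openin openin_open by metis
    have "w \<in> closure (open_arc u v)" using w uv by (auto simp: closure_open_arc)
    then have "T \<inter> open_arc u v \<noteq> {}"
      using T J open_Int_closure_eq_empty[OF T(1), of "open_arc u v"] by blast
    then have "J \<inter> open_arc u v \<noteq> {}" using T open_arc_subset_S1 by blast
    then have "J = open_arc u v" using gap_disjoint[OF G J(1) I] by blast
    then show False using J w open_arc_ends[of u v] by auto
  qed
  show "u \<in> vertices G" "v \<in> vertices G" using * by auto
qed

lemma leaf_gap:
  assumes L: "lamination_system L" and I: "I \<in> L" shows "gap L (leaf I)"
  unfolding gap_def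
proof (intro conjI ballI)
  show "leaf I \<subseteq> L" using I lam_dual[OF L] by (auto simp: leaf_def)
  show "disjoint (leaf I)"
    using dual_disjoint[OF lam_good[OF L I]] by (auto simp: leaf_def disjoint_def)
  show "\<exists>J\<in>leaf I. lies_on K J" if "K \<in> L" for K
    using L I that by (auto simp: leaf_def lamination_system_def)
qed

text \<open>A third side would lie in \<open>dual I\<close>, being disjoint from \<open>I\<close>,
  and yet be disjoint from \<open>dual I\<close>.\<close>

lemma gap_leaf_eq:
  assumes L: "lamination_system L" and G: "gap L G" and I: "I \<in> G" "dual I \<in> G"
  shows "G = leaf I"
proof -
  have gI: "good_interval I" using L G I gap_mem lam_good by blast
  have "K \<in> leaf I" if K: "K \<in> G" for K
  proof (rule ccontr)
    assume n: "K \<notin> leaf I"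
    have gK: "good_interval K" using L G K gap_mem lam_good by blast
    have "K \<inter> I = {}" "K \<inter> dual I = {}" using n gap_disjoint[OF G K] I by (auto simp: leaf_def)
    then have "K \<subseteq> dual I" using subset_dual_iff gI gK by blast
    then show False using \<open>K \<inter> dual I = {}\<close> good_nonempty[OF gK] by blast
  qed
  then show ?thesis using I by (auto simp: leaf_def)
qed

section \<open>Enumerating the sides of polygons and crowns by the integers\<close>

definition enumerates :: "(int \<Rightarrow> complex) \<Rightarrow> complex set set \<Rightarrow> bool" where
  "enumerates t G \<longleftrightarrow> G = range (\<lambda>k. open_arc (t k) (t (k + 1)))"

lemma enumeratesD:
  assumes "lamination_system L" "gap L G" "enumerates t G"
  shows "open_arc (t k) (t (k + 1)) \<in> G" "t k \<in> S1" "t k \<noteq> t (k + 1)" "t k \<in> endpoints L"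
    "t k \<in> vertices G"
proof -
  show G: "open_arc (t k) (t (k + 1)) \<in> G" using assms by (auto simp: enumerates_def)
  show "t k \<in> S1" "t k \<noteq> t (k + 1)" using lam_arcD[OF assms(1)] gap_mem[OF assms(2) G] by auto
  show "t k \<in> endpoints L" using endpointsI[OF assms(1)] gap_mem[OF assms(2) G] by auto
  show "t k \<in> vertices G" using gap_vertices[OF assms(1,2) G] by blast
qed

text \<open>Vertices are sorted by their angle from the base point 1 and indexed modulo their
  number. Indexing by all integers lets polygons and crowns be walked along by the same
  inductions.\<close>

lemma polygon_enumeration:
  assumes L: "lamination_system L" and G: "ideal_polygon L G"
  obtains n :: nat and t :: "int \<Rightarrow> complex" where "n \<ge> 2" "\<And>k. t (k + int n) = t k"
    "enumerates t G" "vertices G = range t"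
proof -
  have gap: "gap L G" and fin: "finite (vertices G)" using G by (auto simp: ideal_polygon_def)
  define V where "V = vertices G"
  have VS: "V \<subseteq> S1" by (auto simp: V_def vertices_def)
  define xs where "xs = sorted_list_of_set (ang 1 ` V)"
  define n where "n = length xs"
  have set: "set xs = ang 1 ` V" and sorted: "sorted_wrt (<) xs"
    using fin by (auto simp: xs_def V_def)
  have nth_less: "i < j \<Longrightarrow> j < n \<Longrightarrow> xs ! i < xs ! j" for i j
    using sorted by (simp add: sorted_wrt_iff_nth_less n_def)
  have card: "n = card V"
    using VS ang_inj[of 1] unfolding n_def xs_def by (simp add: card_image inj_on_def subset_iff)
  obtain I where "I \<in> G" using gap_nonempty[OF L gap] by blast
  then obtain u v where uv: "open_arc u v \<in> G" "u \<noteq> v" using lam_arcE[OF L gap_mem[OF gap]] by metis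
  then have "{u, v} \<subseteq> V" using gap_vertices[OF L gap uv(1)] by (auto simp: V_def)
  then have n2: "n \<ge> 2" using card_mono[of V "{u, v}"] fin uv(2) card by (simp add: V_def)
  define t where "t k = cis (xs ! nat (k mod int n))" for k
  have idx: "nat (k mod int n) < n" for k using n2 by (simp add: nat_less_iff)
  have per: "t (k + int n) = t k" for k by (simp add: t_def)
  have angt: "ang 1 (t k) = xs ! nat (k mod int n)" "t k \<in> V" for k
  proof -
    have "xs ! nat (k mod int n) \<in> ang 1 ` V" using idx set nth_mem n_def by blast
    then obtain x where x: "x \<in> V" "ang 1 x = xs ! nat (k mod int n)" by auto
    then have "t k = x" using ang_eq[of 1 x] VS by (auto simp: t_def)
    then show "ang 1 (t k) = xs ! nat (k mod int n)" "t k \<in> V" using x by auto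
  qed
  have rng: "range t = V"
  proof
    show "V \<subseteq> range t"
    proof
      fix x assume x: "x \<in> V"
      then obtain i where i: "i < n" "xs ! i = ang 1 x" using set by (metis imageI in_set_conv_nth n_def)
      then have "ang 1 (t (int i)) = ang 1 x" using angt(1)[of "int i"] by simp
      then have "t (int i) = x" using ang_inj[of 1 "t (int i)" x] angt(2) x VS by auto
      then show "x \<in> range t" by blast
    qed
  qed (use angt in auto)
  have step: "open_arc (t k) (t (k + 1)) \<inter> V = {} \<and> t k \<noteq> t (k + 1)" for k
  proof -
    define i where "i = nat (k mod int n)"
    have i: "i < n" "int i = k mod int n" using idx n2 by (auto simp: i_def)
    have ak: "ang 1 (t k) = xs ! i" using angt i_def by simp
    have no: "z \<notin> open_arc (t k) (t (k + 1))" if "z \<in> V" and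
      c: "i + 1 < n \<and> ang 1 (t (k + 1)) = xs ! (i + 1) \<or> i = n - 1 \<and> ang 1 (t (k + 1)) = xs ! 0" for z
    proof -
      obtain j where j: "j < n" "ang 1 z = xs ! j" using \<open>z \<in> V\<close> set by (metis imageI in_set_conv_nth n_def)
      from c show ?thesis
      proof
        assume c: "i + 1 < n \<and> ang 1 (t (k + 1)) = xs ! (i + 1)"
        have "j \<le> i \<or> i + 1 \<le> j" by auto
        then have "xs ! j \<le> xs ! i \<or> xs ! (i + 1) \<le> xs ! j"
          using nth_less[of j i] nth_less[of "i + 1" j] i j by (auto simp: le_less)
        moreover have "xs ! i < xs ! (i + 1)" using nth_less[of i "i + 1"] c by simp
        ultimately show ?thesis using c ak j by (auto simp: mem_open_arc[of 1])
      next
        assume c: "i = n - 1 \<and> ang 1 (t (k + 1)) = xs ! 0"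
        have "j < i \<or> j = i" using j(1) c by linarith
        then have "xs ! j \<le> xs ! i" using nth_less[of j i] i(1) by (auto intro: less_imp_le)
        moreover have "xs ! 0 \<le> xs ! j" using nth_less[of 0 j] j by (cases "j = 0") auto
        ultimately show ?thesis using c ak j by (auto simp: mem_open_arc[of 1])
      qed
    qed
    \<comment> \<open>The successor of the last vertex is the first one: that arc passes the base
      point, so the order of the two angles is reversed.\<close>
    have cases: "i + 1 < n \<and> ang 1 (t (k + 1)) = xs ! (i + 1) \<or> i = n - 1 \<and> ang 1 (t (k + 1)) = xs ! 0"
    proof (cases "i + 1 < n")
      case True
      have "(k + 1) mod int n = (int i + 1) mod int n" using i(2) by (simp add: mod_add_left_eq)
      also have "\<dots> = int (i + 1)" using True by simp
      finally show ?thesis using True angt(1)[of "k + 1"] by (simp add: nat_add_distrib)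
    next
      case False
      then have "i = n - 1" using i by simp
      moreover have "(k + 1) mod int n = (int i + 1) mod int n" using i(2) by (simp add: mod_add_left_eq)
      moreover have "int i + 1 = int n" using \<open>i = n - 1\<close> n2 by simp
      ultimately show ?thesis using angt(1)[of "k + 1"] by simp
    qed
    moreover have "t k \<noteq> t (k + 1)"
    proof
      assume "t k = t (k + 1)"
      then have "ang 1 (t (k + 1)) = xs ! i" using ak by simp
      moreover have "xs ! i < xs ! (i + 1)" if "i + 1 < n" using nth_less[of i "i + 1"] that by linarith
      moreover have "xs ! 0 < xs ! i" if "i = n - 1" using nth_less[of 0 i] i(1) that n2 by linarith
      ultimately show False using cases by linarith
    qed
    ultimately show ?thesis using no by blast
  qed
  have tS: "t k \<in> S1" for k using angt(2) VS by blast
  have IV: "I \<inter> V = {}" if "I \<in> G" for I using that by (auto simp: V_def vertices_def)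
  have inG: "open_arc (t k) (t (k + 1)) \<in> G" for k
  proof -
    \<comment> \<open>The side through an interior point \<open>x\<close> has its ends among the
      vertices, and neither of the two arcs contains a vertex, so they coincide.\<close>
    obtain x where x: "x \<in> open_arc (t k) (t (k + 1))" using open_arc_nonempty tS step by metis
    then have "x \<notin> V" "x \<in> S1" using step[of k] open_arc_subset_S1 by blast+
    then obtain I where I: "I \<in> G" "x \<in> I" by (auto simp: V_def vertices_def)
    then obtain u v where uv: "I = open_arc u v" using lam_arcE[OF L gap_mem[OF gap]] by metis
    then have "u \<in> V" "v \<in> V" using gap_vertices[OF L gap] I by (auto simp: V_def)
    then have "open_arc (t k) (t (k + 1)) = open_arc u v"
      using x I uv step[of k] IV[OF I(1)] angt(2)[of k] angt(2)[of "k + 1"]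
      by (intro good_eqI) blast+
    then show ?thesis using I uv by simp
  qed
  have "enumerates t G"
    unfolding enumerates_def
  proof
    show "G \<subseteq> range (\<lambda>k. open_arc (t k) (t (k + 1)))"
    proof
      fix I assume I: "I \<in> G"
      then obtain u v where uv: "I = open_arc u v" "u \<in> S1" "v \<in> S1" "u \<noteq> v"
        using lam_arcE[OF L gap_mem[OF gap]] by metis
      then have "u \<in> V" using gap_vertices[OF L gap] I by (auto simp: V_def)
      then obtain k where k: "u = t k" using rng by blast
      have "I = open_arc (t k) (t (k + 1))"
        using gap_disjoint[OF gap I inG[of k]] open_arc_left_meet[of u v "t (k + 1)"] uv k tS step[of k]
        by auto
      then show "I \<in> range (\<lambda>k. open_arc (t k) (t (k + 1)))" by blast
    qed
  qed (use inG in auto)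
  then show thesis by (intro that[of n t] n2 per) (use rng V_def in simp_all)
qed

definition crown_enum :: "complex set set \<Rightarrow> complex set set \<Rightarrow> complex \<Rightarrow> (int \<Rightarrow> complex) \<Rightarrow> bool" where
  "crown_enum L G p t \<longleftrightarrow> gap L G \<and> enumerates t G \<and> vertices G = range t \<union> {p} \<and> p \<notin> range t"

lemma crown_with_pivot_iff: "crown_with_pivot L G p \<longleftrightarrow> (\<exists>t. crown_enum L G p t)"
  by (auto simp: crown_with_pivot_def crown_enum_def enumerates_def)

lemma crown_pivot_S1: "crown_enum L G p t \<Longrightarrow> p \<in> S1"
  by (auto simp: crown_enum_def vertices_def)

lemma quite_full_lam: "quite_full L \<Longrightarrow> lamination_system L"
  by (simp add: quite_full_def)

lemma gap_cases:
  assumes "quite_full L" "gap L G"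
  obtains (polygon) t where "ideal_polygon L G" "enumerates t G" "vertices G = range t"
  | (crown) p t where "crown_enum L G p t"
  using assms polygon_enumeration[OF quite_full_lam] crown_with_pivot_iff
  unfolding quite_full_def crown_def by metis

text \<open>The pivot lies in no side, so in angles from the pivot no side wraps around and its ends
  stay in order.\<close>

lemma crown_arc:
  assumes L: "lamination_system L" and c: "crown_enum L G p t"
    and z: "z \<in> S1" "z \<noteq> p" "z \<notin> range t"
  obtains k where "ang p (t k) < ang p z" "ang p z < ang p (t (k + 1))"
proof -
  have p: "p \<in> S1" using c crown_pivot_S1 by blast
  have gap: "gap L G" "enumerates t G" using c by (auto simp: crown_enum_def)
  have "z \<notin> vertices G" using z c by (auto simp: crown_enum_def)
  then obtain k where k: "z \<in> open_arc (t k) (t (k + 1))"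
    using z gap by (auto simp: vertices_def enumerates_def)
  have "p \<in> vertices G" using c by (auto simp: crown_enum_def)
  then have "p \<notin> open_arc (t k) (t (k + 1))" using enumeratesD(1)[OF L gap, of k] by (auto simp: vertices_def)
  moreover have "0 < ang p (t k)" for k
    using c ang_pos[of p "t k"] enumeratesD(2)[OF L gap, of k] p by (auto simp: crown_enum_def)
  ultimately have "ang p (t k) < ang p z \<and> ang p z < ang p (t (k + 1))"
    using k p by (auto simp: mem_open_arc[of p])
  then show thesis using that by blast
qed

text \<open>A point \<open>z\<close> between the pivot and \<open>d\<close> is a vertex or lies in a
  side; the end of that side facing the pivot is then between them too.\<close>

lemma crown_approaches_pivot:
  assumes L: "lamination_system L" and c: "crown_enum L G p t" and d: "d \<in> S1" "d \<noteq> p"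
  shows "\<exists>k. t k \<in> open_arc p d" "\<exists>k. t k \<in> open_arc d p"
proof -
  have p: "p \<in> S1" using c crown_pivot_S1 by blast
  have tk: "t k \<in> S1" "0 < ang p (t k)" for k
    using c ang_pos[of p "t k"] enumeratesD(2)[OF L, of G t k] p by (auto simp: crown_enum_def)
  show "\<exists>k. t k \<in> open_arc p d"
  proof (rule ccontr)
    assume n: "\<not> ?thesis"
    obtain z where z: "z \<in> open_arc p d" using open_arc_nonempty p d by metis
    then have z': "z \<in> S1" "z \<noteq> p" "0 < ang p z" "ang p z < ang p d" using p by (auto simp: mem_open_arc0)
    obtain k where "ang p (t k) < ang p z" "ang p z < ang p (t (k + 1))"
      by (rule crown_arc[OF L c z'(1,2)]) (use n z in auto)
    then have "t k \<in> open_arc p d" using z' tk[of k] p d by (simp add: mem_open_arc0)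
    then show False using n by blast
  qed
  show "\<exists>k. t k \<in> open_arc d p"
  proof (rule ccontr)
    assume n: "\<not> ?thesis"
    obtain z where z: "z \<in> open_arc d p" using open_arc_nonempty p d by metis
    then have z': "z \<in> S1" "z \<noteq> p" "ang p d < ang p z"
      using p d mem_open_arc1[of p d z] open_arc_ends[of d p] by auto
    obtain k where "ang p (t k) < ang p z" "ang p z < ang p (t (k + 1))"
      by (rule crown_arc[OF L c z'(1,2)]) (use n z in auto)
    then have "t (k + 1) \<in> open_arc d p" using z' tk[of "k + 1"] p d mem_open_arc1[of p d] by auto
    then show False using n by blast
  qed
qed

text \<open>The sides of leaves that avoid \<open>p\<close> form a laminar family; if \<open>p\<close> is not a rainbow point, its
  maximal members form the gap with \<open>p\<close> among its vertices.\<close>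

lemma pivot_or_rainbow:
  assumes qf: "quite_full L" and p: "p \<in> S1" "p \<notin> endpoints L" "\<not> rainbow_point L p"
  obtains G t where "non_leaf_gap L G" "crown_enum L G p t"
proof -
  have L: "lamination_system L" using qf quite_full_lam by blast
  define S where "S = {J \<in> L. p \<notin> J}"
  have pd: "p \<in> dual I \<longleftrightarrow> p \<notin> I" if "I \<in> L" for I
    using good_cut[OF lam_good[OF L that] p(1)] endpoints_leafI[OF that] p(2) by blast
  have lam: "I \<subseteq> J \<or> J \<subseteq> I \<or> I \<inter> J = {}" if "I \<in> S" "J \<in> S" for I J
    using noncross[OF L, of I J] that pd[of I] by (auto simp: S_def)
  have gap: "gap L {\<Union>{J \<in> S. x \<in> J} | x. x \<in> \<Union>S}" (is "gap L ?G")
  proof (rule gap_of_laminar_family[OF L _ lam])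
    show "S \<subseteq> L" by (auto simp: S_def)
    show "\<exists>J\<in>S. I \<subseteq> J \<or> dual I \<subseteq> J" if "I \<in> L" for I
      using that pd[OF that] lam_dual[OF L that] by (auto simp: S_def)
    fix x J assume J: "J \<in> S" "x \<in> J"
    define F where "F = {J \<in> S. x \<in> J}"
    have F: "F \<noteq> {}" "F \<subseteq> L" using J by (auto simp: F_def S_def)
    have chain: "I \<subseteq> J \<or> J \<subseteq> I" if "I \<in> F" "J \<in> F" for I J using that lam[of I J] by (auto simp: F_def)
    have gF: "good_interval I" if "I \<in> F" for I using that lam_good[OF L] by (auto simp: F_def S_def)
    have "good_interval (\<Union>F) \<or> \<Union>F = S1 - {p}"
      using F gF p(1) by (intro Union_good_cases[of F x]) (auto simp: F_def S_def)
    \<comment> \<open>A chain of sides exhausting the punctured circle has duals shrinking to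
      \<open>p\<close>, which would make \<open>p\<close> a rainbow point.\<close>
    moreover have "\<Union>F \<noteq> S1 - {p}"
    proof
      assume U: "\<Union>F = S1 - {p}"
      obtain J where J: "incseq J" "range J \<subseteq> F" "(\<Union>k. J k) = \<Union>F"
        by (rule chain_sequence[OF F(1) gF chain])
      have JL: "J k \<in> L" "p \<notin> J k" for k using J(2) by (auto simp: F_def S_def)
      have "decseq (\<lambda>k. dual (J k))"
        using J(1) dual_mono lam_good[OF L] JL unfolding incseq_def decseq_def by blast
      moreover have "range (\<lambda>k. dual (J k)) \<subseteq> L" using lam_dual[OF L] JL by blast
      moreover have "(\<Inter>k. dual (J k)) = {p}"
      proof
        show "{p} \<subseteq> (\<Inter>k. dual (J k))" using pd JL by blast
        have "dual (J k) \<subseteq> S1 - J k" for k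
          using dual_disjoint[of "J k"] good_subset_S1[of "dual (J k)"] lam_good[OF L JL(1)[of k]] by auto
        then have "(\<Inter>k. dual (J k)) \<subseteq> S1 - (\<Union>k. J k)" by blast
        also have "\<dots> = {p}" using J(3) U p(1) by auto
        finally show "(\<Inter>k. dual (J k)) \<subseteq> {p}" .
      qed
      ultimately show False using p(3) unfolding rainbow_point_def by blast
    qed
    ultimately have "\<Union>F \<in> L" using chain_Union_mem[OF L F chain] by blast
    then show "\<Union>{J \<in> S. x \<in> J} \<in> S" unfolding F_def[symmetric] by (auto simp: S_def F_def)
  qed
  define G where "G = ?G"
  have gap: "gap L G" using gap by (simp only: G_def)
  have pv: "p \<in> vertices G" using p(1) by (auto simp: vertices_def S_def G_def)
  have "G \<noteq> leaf I" if "I \<in> L" for I using pv p(2) endpoints_leafI[OF that, of p] by blast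
  then have "non_leaf_gap L G" unfolding non_leaf_gap_def using gap by blast
  \<comment> \<open>All vertices of a polygon, and all vertices of a crown but its pivot, are
    endpoints. As \<open>p\<close> is not, the gap is a crown with pivot \<open>p\<close>.\<close>
  moreover have "\<exists>t. crown_enum L G p t"
    using qf gap
  proof (cases rule: gap_cases)
    case (polygon t)
    then show ?thesis using pv p(2) enumeratesD(4)[OF L gap, of t] by (metis imageE)
  next
    case (crown p' t)
    then show ?thesis using pv p(2) enumeratesD(4)[OF L gap, of t]
      by (metis (no_types, lifting) Un_iff crown_enum_def imageE singletonD)
  qed
  ultimately show thesis using that by blast
qed

lemma rainbow_memE:
  assumes "rainbow_point L p" "finite B" "p \<notin> B"
  obtains K where "K \<in> L" "p \<in> K" "K \<inter> B = {}"
proof -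
  obtain I where I: "decseq I" "range I \<subseteq> L" "(\<Inter>k. I k) = {p}"
    using assms(1) unfolding rainbow_point_def by auto
  have "\<exists>k. I k \<inter> B = {}" using assms(2,3)
  proof (induction B rule: finite_induct)
    case (insert b B)
    then obtain k where k: "I k \<inter> B = {}" by auto
    have "b \<notin> (\<Inter>k. I k)" using insert.prems I by auto
    then obtain l where "b \<notin> I l" by blast
    moreover have "I (max k l) \<subseteq> I k" "I (max k l) \<subseteq> I l" using I(1) by (auto simp: decseq_def)
    ultimately show ?case using k by blast
  qed auto
  then show thesis using that I by blast
qed

text \<open>A rainbow point of \<open>A\<close> has a side around it missing another point of
  \<open>A\<close>, so an end of that side lies in the connected set \<open>A\<close>. At a pivot,
  the other vertices of its crown accumulate.\<close>

lemma endpoints_dense: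
  assumes qf: "quite_full L" and A: "good_interval A"
  obtains e where "e \<in> A" "e \<in> endpoints L"
proof -
  have L: "lamination_system L" using qf quite_full_lam by blast
  obtain u v where uv: "A = open_arc u v" "u \<in> S1" "v \<in> S1" "u \<noteq> v" using A good_intervalE by blast
  obtain p where p: "p \<in> A" using good_nonempty[OF A] by blast
  then have pS: "p \<in> S1" using good_subset_S1[OF A] by blast
  have "\<exists>e\<in>A. e \<in> endpoints L"
  proof (cases "p \<in> endpoints L")
    case False
    show ?thesis
    proof (cases "rainbow_point L p")
      case True
      obtain p' where p': "p' \<in> A" "p' \<noteq> p" by (rule good_avoid_finite[OF A, of "{p}"]) auto
      obtain K where K: "K \<in> L" "p \<in> K" "p' \<notin> K"
        by (rule rainbow_memE[OF True, of "{p'}"]) (use p' in auto)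
      obtain x y where xy: "K = open_arc x y" using lam_arcE[OF L K(1)] by metis
      then have "x \<in> A \<or> y \<in> A"
        using connected_subset_arc[of A x y] good_connected[OF A] good_subset_S1[OF A] K p p' by blast
      then show ?thesis using endpointsI[OF L, of x y] K xy by blast
    next
      case r: False
      obtain G t where G: "crown_enum L G p t" by (rule pivot_or_rainbow[OF qf pS False r])
      have "v \<noteq> p" using p uv open_arc_ends by blast
      then obtain k where "t k \<in> open_arc p v" using crown_approaches_pivot[OF L G uv(3)] by blast
      moreover have "open_arc p v \<subseteq> A" using open_arc_subarc(2)[of p u v] p uv by blast
      moreover have "t k \<in> endpoints L" using enumeratesD(4)[OF L] G unfolding crown_enum_def by blast
      ultimately show ?thesis by blast
    qed
  qed (use p in blast)
  then show thesis using that by blast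
qed

text \<open>Two sides inside \<open>I\<close> cannot cover the circle together, since both miss
  \<open>dual I\<close>.\<close>

lemma nested_inside:
  assumes L: "lamination_system L" and I: "good_interval I"
    and K: "K \<in> L" "K \<subseteq> I" "K' \<in> L" "K' \<subseteq> I"
  shows "K \<subseteq> K' \<or> K' \<subseteq> K \<or> K \<inter> K' = {}"
proof -
  obtain q where q: "q \<in> dual I" using good_nonempty[of "dual I"] I by auto
  then have "q \<in> dual K" using dual_mono[OF lam_good[OF L K(1)] I K(2)] by blast
  moreover have "q \<notin> K'" using q dual_disjoint[OF I] K by blast
  ultimately show ?thesis using noncross[OF L K(1,3)] by blast
qed

section \<open>Leaves with a common endpoint\<close>

text \<open>The gap bordering the leaf of \<open>I\<close> from inside \<open>I\<close> consists of
  \<open>dual I\<close> and the maximal sides strictly inside \<open>I\<close>. It exists unless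
  such sides through one point exhaust \<open>I\<close>, and that alternative is the source of
  approximating leaves later.\<close>

lemma side_gap:
  assumes L: "lamination_system L" and I: "I \<in> L"
    and no: "\<And>x. x \<in> I \<Longrightarrow> \<Union>{K \<in> L. K \<subset> I \<and> x \<in> K} \<noteq> I"
  obtains G where "non_leaf_gap L G" "dual I \<in> G"
    "\<And>K. \<lbrakk>K \<in> L; K \<subset> I; \<And>K'. \<lbrakk>K' \<in> L; K' \<subset> I; K \<subseteq> K'\<rbrakk> \<Longrightarrow> K' = K\<rbrakk> \<Longrightarrow> K \<in> G"
proof -
  have gI: "good_interval I" using lam_good L I by blast
  define S where "S = insert (dual I) {K \<in> L. K \<subset> I}"
  define U where "U x = \<Union>{J \<in> S. x \<in> J}" for x
  have disj: "K \<inter> dual I = {}" if "K \<subseteq> I" for K using that dual_disjoint[OF gI] by blast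
  have nest: "K \<subseteq> K' \<or> K' \<subseteq> K \<or> K \<inter> K' = {}" if "K \<in> L" "K \<subset> I" "K' \<in> L" "K' \<subset> I" for K K'
    using nested_inside[OF L gI] that by blast
  have Ud: "U x = dual I" if "x \<in> dual I" for x
    using that disj by (auto simp: U_def S_def)
  have Uin: "U x \<in> L \<and> U x \<subset> I \<and> K \<subseteq> U x" if K: "K \<in> L" "K \<subset> I" "x \<in> K" for x K
  proof -
    define F where "F = {K \<in> L. K \<subset> I \<and> x \<in> K}"
    have UF: "U x = \<Union>F" using disj K by (auto simp: U_def S_def F_def)
    obtain q where q: "q \<in> dual I" using good_nonempty[of "dual I"] gI by auto
    then have qS: "q \<in> S1" using good_subset_S1[of "dual I"] gI by auto
    have chain: "K \<subseteq> K' \<or> K' \<subseteq> K" if "K \<in> F" "K' \<in> F" for K K'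
      using nest[of K K'] that by (auto simp: F_def)
    have F: "F \<noteq> {}" "F \<subseteq> L" using K by (auto simp: F_def)
    have sub: "\<Union>F \<subseteq> I" by (auto simp: F_def)
    have "good_interval (\<Union>F) \<or> \<Union>F = S1 - {q}"
      using F lam_good[OF L] qS disj[OF sub] q by (intro Union_good_cases[of F x]) (auto simp: F_def)
    \<comment> \<open>The union misses all of \<open>dual I\<close>, which is infinite, so it is not
      the circle with only \<open>q\<close> removed.\<close>
    moreover have "\<Union>F \<noteq> S1 - {q}"
    proof
      assume "\<Union>F = S1 - {q}"
      then have "dual I \<subseteq> {q}" using disj[OF sub] good_subset_S1[of "dual I"] gI by auto
      then show False using infinite_good[of "dual I"] gI finite_subset by auto
    qed
    ultimately have "\<Union>F \<in> L" using chain_Union_mem[OF L F chain] by blast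
    moreover have "\<Union>F \<noteq> I" using no[of x] K by (auto simp: F_def)
    moreover have "K \<subseteq> \<Union>F" using K by (auto simp: F_def)
    ultimately show ?thesis using sub UF by auto
  qed
  have SL: "S \<subseteq> L" using I lam_dual[OF L] by (auto simp: S_def)
  define G where "G = {\<Union>{J \<in> S. x \<in> J} | x. x \<in> \<Union>S}"
  have G: "G = {U x | x. x \<in> \<Union>S}" by (simp add: G_def U_def)
  have gap: "gap L G" unfolding G_def
  proof (rule gap_of_laminar_family[OF L SL])
    show "J \<subseteq> K \<or> K \<subseteq> J \<or> J \<inter> K = {}" if "J \<in> S" "K \<in> S" for J K
      using that nest[of J K] disj[of J] disj[of K] by (auto simp: S_def)
    show "\<exists>J\<in>S. M \<subseteq> J \<or> dual M \<subseteq> J" if M: "M \<in> L" for M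
    proof -
      have gM: "good_interval M" using lam_good L M by blast
      from noncross[OF L M I] consider "M \<subset> I" | "M = I" | "I \<subseteq> M" | "M \<inter> I = {}" | "dual M \<subset> I" | "dual M = I"
        by blast
      then show ?thesis
      proof cases
        case 3 then show ?thesis using dual_mono[OF gI gM] by (auto simp: S_def)
      next
        case 4 then show ?thesis using subset_dual_iff[OF gM gI] by (auto simp: S_def)
      next
        case 6 then show ?thesis using gM by (auto simp: S_def)
      qed (use M lam_dual[OF L M] in \<open>auto simp: S_def\<close>)
    qed
    fix x J assume J: "J \<in> S" "x \<in> J"
    show "\<Union>{J \<in> S. x \<in> J} \<in> S" unfolding U_def[symmetric]
      using J Ud[of x] Uin[of J x] by (auto simp: S_def)
  qed
  have dG: "dual I \<in> G"
  proof -
    obtain q where q: "q \<in> dual I" using good_nonempty[of "dual I"] gI by auto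
    then show ?thesis unfolding G using Ud[OF q] by (auto simp: S_def)
  qed
  \<comment> \<open>Were the gap a leaf containing \<open>dual I\<close>, its other side would be
    \<open>I\<close>.\<close>
  have "I \<notin> G"
  proof
    assume "I \<in> G"
    then obtain x K where x: "I = U x" "x \<in> K" "K \<in> S" unfolding G by blast
    then show False using Ud[of x] Uin[of K x] disj[of I] good_nonempty[OF gI] by (auto simp: S_def)
  qed
  then have "G \<noteq> leaf M" if "M \<in> L" for M
    using dG dual_dual[OF gI] dual_dual[OF lam_good[OF L that]] unfolding leaf_def by (metis insertCI insertE singletonD)
  then have "non_leaf_gap L G" using gap by (auto simp: non_leaf_gap_def)
  moreover have "K \<in> G" if K: "K \<in> L" "K \<subset> I" "\<And>K'. \<lbrakk>K' \<in> L; K' \<subset> I; K \<subseteq> K'\<rbrakk> \<Longrightarrow> K' = K" for K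
  proof -
    obtain x where x: "x \<in> K" using good_nonempty lam_good[OF L K(1)] by blast
    then have "U x = K" using Uin[of K x] K by blast
    then show ?thesis using x K unfolding G by (auto simp: S_def)
  qed
  ultimately show thesis using that dG by blast
qed

text \<open>The leaves at \<open>p\<close> closest to \<open>e\<close> on either side are sides of one gap. Endpoints \<open>e\<close> of the
  other lamination are available between any two leaves at \<open>p\<close>, so that looseness leaves room for
  two leaves at \<open>p\<close> only.\<close>

lemma wedge_at:
  assumes L: "lamination_system L" and a: "open_arc p a1 \<in> L" "open_arc p a2 \<in> L"
    and e: "e \<in> S1" "e \<notin> endpoints L" "ang p a1 < ang p e" "ang p e < ang p a2"
  obtains G a b where "non_leaf_gap L G" "open_arc p a \<in> G" "open_arc b p \<in> G"
    "ang p a1 \<le> ang p a" "ang p a < ang p e" "ang p e < ang p b" "ang p b \<le> ang p a2"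
proof -
  have S: "p \<in> S1" "a1 \<in> S1" "a2 \<in> S1" "p \<noteq> a1" "p \<noteq> a2" using lam_arcD[OF L] a by auto
  have ep: "e \<noteq> p" using e(3) ang_ge0[of p a1] S(1) by auto
  \<comment> \<open>Sides that start at \<open>p\<close> and stop before \<open>e\<close>. Their
    union is the longest of them, by the closure axiom, and it stops strictly before
    \<open>e\<close> because \<open>e\<close> is not an endpoint.\<close>
  define F where "F = {J \<in> L. \<exists>x. J = open_arc p x \<and> open_arc p a1 \<subseteq> J \<and> e \<notin> J}"
  define U where "U = \<Union>F"
  obtain z1 where z1: "z1 \<in> open_arc p a1" using open_arc_nonempty S by metis
  have F1: "open_arc p a1 \<in> F" using a e S by (auto simp: F_def mem_open_arc0)
  have Fchain: "I \<subseteq> J \<or> J \<subseteq> I" if "I \<in> F" "J \<in> F" for I J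
  proof -
    obtain x y where xy: "I = open_arc p x" "J = open_arc p y" "I \<in> L" "J \<in> L" using \<open>I \<in> F\<close> \<open>J \<in> F\<close> by (auto simp: F_def)
    then show ?thesis using open_arc_left_nested[of p x y] lam_arcD[OF L, of p x] lam_arcD[OF L, of p y] by simp
  qed
  have "good_interval U \<or> U = S1 - {p}" unfolding U_def
    by (rule Union_good_cases[of F z1]) (use F1 z1 S lam_good[OF L] open_arc_ends in \<open>auto simp: F_def\<close>)
  moreover have "e \<notin> U" "p \<notin> U" using open_arc_ends by (auto simp: U_def F_def)
  ultimately have gU: "good_interval U" using e(1) ep by blast
  have UL: "U \<in> L" unfolding U_def
    by (rule chain_Union_mem[OF L _ _ Fchain]) (use F1 gU in \<open>auto simp: F_def U_def\<close>)
  have subU: "open_arc p a1 \<subseteq> U" using F1 by (auto simp: U_def)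
  obtain u a where ua: "U = open_arc u a" "u \<in> S1" "a \<in> S1" "u \<noteq> a" using lam_arcE[OF L UL] by metis
  have up: "u = p" and a1: "a1 = a \<or> a1 \<in> open_arc p a"
    using open_arc_subset_ends[of p a1 u a] subU ua S \<open>p \<notin> U\<close> by auto
  have Ua: "U = open_arc p a" using ua up by simp
  have "a \<noteq> e" using endpointsI[OF L, of p a] UL Ua e(2) by blast
  then have ae: "ang p a < ang p e"
    using \<open>e \<notin> U\<close> ang_inj[of p a e] ang_pos[of p e] Ua S ua e ep by (fastforce simp: mem_open_arc0)
  have a1a: "ang p a1 \<le> ang p a" using a1 S by (auto simp: mem_open_arc0)

  \<comment> \<open>The mirror family: sides that begin after \<open>e\<close> and end at
    \<open>p\<close>.\<close>
  define F' where "F' = {J \<in> L. \<exists>x. J = open_arc x p \<and> open_arc a2 p \<subseteq> J \<and> e \<notin> J}"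
  define V where "V = \<Union>F'"
  have a2L: "open_arc a2 p \<in> L" using lam_arc_swap[OF L a(2)] .
  obtain z2 where z2: "z2 \<in> open_arc a2 p" using open_arc_nonempty S by metis
  have F2: "open_arc a2 p \<in> F'" using a2L e S mem_open_arc1[of p a2 e] by (auto simp: F'_def)
  have F'chain: "I \<subseteq> J \<or> J \<subseteq> I" if "I \<in> F'" "J \<in> F'" for I J
  proof -
    obtain x y where xy: "I = open_arc x p" "J = open_arc y p" "I \<in> L" "J \<in> L" using \<open>I \<in> F'\<close> \<open>J \<in> F'\<close> by (auto simp: F'_def)
    have xyS: "x \<in> S1" "y \<in> S1" "x \<noteq> p" "y \<noteq> p" using xy lam_arcD[OF L, of x p] lam_arcD[OF L, of y p] by auto
    show ?thesis
    proof (cases "ang p x \<le> ang p y")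
      case True
      then have "J \<subseteq> I" using mem_open_arc1[OF S(1) xyS(1)] mem_open_arc1[OF S(1) xyS(2)] xy xyS by auto
      then show ?thesis by blast
    next
      case False
      then have "I \<subseteq> J" using mem_open_arc1[OF S(1) xyS(1)] mem_open_arc1[OF S(1) xyS(2)] xy xyS by auto
      then show ?thesis by blast
    qed
  qed
  have "good_interval V \<or> V = S1 - {p}" unfolding V_def
    by (rule Union_good_cases[of F' z2]) (use F2 z2 S lam_good[OF L] open_arc_ends in \<open>auto simp: F'_def\<close>)
  moreover have "e \<notin> V" "p \<notin> V" using open_arc_ends by (auto simp: V_def F'_def)
  ultimately have gV: "good_interval V" using e(1) ep by blast
  have VL: "V \<in> L" unfolding V_def
    by (rule chain_Union_mem[OF L _ _ F'chain]) (use F2 gV in \<open>auto simp: F'_def V_def\<close>)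
  have subV: "open_arc a2 p \<subseteq> V" using F2 by (auto simp: V_def)
  obtain b v where bv: "V = open_arc b v" "b \<in> S1" "v \<in> S1" "b \<noteq> v" using lam_arcE[OF L VL] by metis
  have vp: "v = p" and a2: "a2 = b \<or> a2 \<in> open_arc b p"
    using open_arc_subset_ends[of a2 p b v] subV bv S \<open>p \<notin> V\<close> by auto
  have Vb: "V = open_arc b p" and bp: "b \<noteq> p" using bv vp by auto
  have "b \<noteq> e" using endpointsI[OF L, of b p] VL Vb e(2) by blast
  then have eb: "ang p e < ang p b"
    using \<open>e \<notin> V\<close> ang_inj[of p b e] Vb S bv e bp mem_open_arc1[of p b e] by fastforce
  have ba2: "ang p b \<le> ang p a2" using a2 S mem_open_arc1[of p b a2] bv by auto

  define W where "W = open_arc p b"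
  have WL: "W \<in> L" using lam_arc_swap[OF L] VL Vb W_def by blast
  have dW: "dual W = V" using dual_open_arc[of p b] S bv bp Vb W_def by simp
  have gW: "good_interval W" using lam_good[OF L WL] .
  have eW: "e \<in> W" using e eb S bv ep ang_pos[of p e] by (simp add: W_def mem_open_arc0)
  have UW: "U \<subset> W" using Ua ae eb eW \<open>e \<notin> U\<close> open_arc_left_mono[of p b a] S bv by (auto simp: W_def)
  \<comment> \<open>A side \<open>K\<close> inside \<open>W\<close> that contains \<open>U\<close>
    also starts at \<open>p\<close>. If it contained \<open>e\<close>, its dual would belong to the
    mirror family and \<open>K\<close> could not be smaller than \<open>W\<close>; so it misses
    \<open>e\<close> and is already contained in \<open>U\<close>.\<close>
  have key: "K \<subseteq> U" if K: "K \<in> L" "K \<subset> W" "K \<inter> U \<noteq> {}" for K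
  proof -
    have gK: "good_interval K" using lam_good[OF L K(1)] .
    have VK: "V \<subseteq> dual K" using dual_mono[OF gK gW] K dW by blast
    have "V \<inter> U = {}" using UW dual_disjoint[OF gW] dW by blast
    then have "\<not> dual K \<subseteq> U" using VK good_nonempty[OF gV] by blast
    then consider "K \<subseteq> U" | "U \<subseteq> K" using noncross[OF L K(1) UL] K(3) by blast
    then show ?thesis
    proof cases
      case 2
      obtain u v where uv: "K = open_arc u v" "u \<in> S1" "v \<in> S1" "u \<noteq> v" using lam_arcE[OF L K(1)] by metis
      have "p \<notin> K" using K open_arc_ends[of p b] by (auto simp: W_def)
      then have up: "u = p" using open_arc_subset_ends[of p a u v] uv 2 Ua ua S up by auto
      have dK: "dual K = open_arc v p" using dual_open_arc[of u v] uv up by simp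
      have "e \<notin> K"
      proof
        assume "e \<in> K"
        then have "e \<notin> dual K" using dual_disjoint[OF gK] by blast
        then have "dual K \<in> F'" using lam_dual[OF L K(1)] dK subV VK by (auto simp: F'_def)
        then have "dual K \<subseteq> dual W" using dW by (auto simp: V_def)
        then show False using dual_mono_iff[OF gW gK] K by blast
      qed
      then have "K \<in> F" using K uv up subU 2 by (auto simp: F_def)
      then show ?thesis by (auto simp: U_def)
    qed
  qed
  obtain G where G: "non_leaf_gap L G" "dual W \<in> G"
    "\<And>K. \<lbrakk>K \<in> L; K \<subset> W; \<And>K'. \<lbrakk>K' \<in> L; K' \<subset> W; K \<subseteq> K'\<rbrakk> \<Longrightarrow> K' = K\<rbrakk> \<Longrightarrow> K \<in> G"
  proof (rule side_gap[OF L WL])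
    fix x assume x: "x \<in> W"
    \<comment> \<open>By \<open>key\<close>, sides through one point cannot reach both
      \<open>U\<close> and \<open>e\<close>.\<close>
    show "\<Union>{K \<in> L. K \<subset> W \<and> x \<in> K} \<noteq> W"
    proof
      assume eq: "\<Union>{K \<in> L. K \<subset> W \<and> x \<in> K} = W"
      obtain K1 where K1: "K1 \<in> L" "K1 \<subset> W" "x \<in> K1" "e \<in> K1" using eq eW by blast
      obtain y where y: "y \<in> U" using good_nonempty[OF gU] by blast
      then obtain K2 where K2: "K2 \<in> L" "K2 \<subset> W" "x \<in> K2" "y \<in> K2" using eq UW by blast
      have "x \<in> U" using key[of K2] K2 y by blast
      then have "K1 \<subseteq> U" using key[of K1] K1 by blast
      then show False using K1 \<open>e \<notin> U\<close> by blast
    qed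
  qed blast
  have "U \<in> G" using G(3)[OF UL UW] key good_nonempty[OF gU] by blast
  then show thesis using that[OF G(1), of a b] G(2) dW Ua Vb a1a ae eb ba2 by simp
qed

lemma pseudo_fibered_sym: "pseudo_fibered L M \<Longrightarrow> pseudo_fibered M L"
  by (auto simp: pseudo_fibered_def)

lemma pseudo_fiberedD:
  assumes "pseudo_fibered L M"
  shows "quite_full L" "quite_full M" "lamination_system L" "lamination_system M"
    "\<And>p. p \<in> endpoints L \<Longrightarrow> p \<notin> endpoints M"
  using assms quite_full_lam by (auto simp: pseudo_fibered_def)

lemma loose_unique:
  assumes "pseudo_fibered L M" "non_leaf_gap L G" "non_leaf_gap L H" "p \<in> vertices G" "p \<in> vertices H"
  shows "G = H"
  using assms unfolding pseudo_fibered_def loose_def by blast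

text \<open>The wedges between the first two and between the last two leaves share the vertex
  \<open>p\<close>, so they are one gap. Its unique side starting at \<open>p\<close> would end
  before \<open>a2\<close> and also not before \<open>a2\<close>.\<close>

lemma no_three_leaves:
  assumes pf: "pseudo_fibered L M"
    and a: "open_arc p a1 \<in> L" "open_arc p a2 \<in> L" "open_arc p a3 \<in> L"
    and lt: "ang p a1 < ang p a2" "ang p a2 < ang p a3"
  shows False
proof -
  note L = pseudo_fiberedD(3)[OF pf]
  have S: "p \<in> S1" "a1 \<in> S1" "a2 \<in> S1" "a3 \<in> S1" using lam_arcD[OF L] a by auto
  have e: "\<exists>e. e \<in> S1 \<and> e \<notin> endpoints L \<and> ang p x < ang p e \<and> ang p e < ang p y"
    if xy: "x \<in> S1" "y \<in> S1" "ang p x < ang p y" for x y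
  proof -
    have "good_interval (open_arc x y)" using xy by (intro good_interval_open_arc) auto
    then obtain e where "e \<in> open_arc x y" "e \<in> endpoints M"
      by (rule endpoints_dense[OF pseudo_fiberedD(2)[OF pf]])
    then show ?thesis using pseudo_fiberedD(5)[OF pf] xy S(1) by (auto simp: mem_open_arc[of p])
  qed
  obtain e where e1: "e \<in> S1" "e \<notin> endpoints L" "ang p a1 < ang p e" "ang p e < ang p a2"
    using e[OF S(2,3) lt(1)] by auto
  obtain f where f: "f \<in> S1" "f \<notin> endpoints L" "ang p a2 < ang p f" "ang p f < ang p a3"
    using e[OF S(3,4) lt(2)] by auto
  obtain G a b where G: "non_leaf_gap L G" "open_arc p a \<in> G" "ang p a < ang p e" 
    using wedge_at[OF L a(1,2) e1] by metis
  obtain H a' b' where H: "non_leaf_gap L H" "open_arc p a' \<in> H" "ang p a2 \<le> ang p a'"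
    using wedge_at[OF L a(2,3) f] by metis
  have gG: "gap L G" "gap L H" using G H by (auto simp: non_leaf_gap_def)
  have "G = H" using loose_unique[OF pf G(1) H(1)] gap_vertices(1)[OF L gG(1) G(2)] gap_vertices(1)[OF L gG(2) H(2)] by blast
  have arcs: "open_arc p a \<in> L" "open_arc p a' \<in> L" using gap_mem gG G(2) H(2) by blast+
  have "open_arc p a \<inter> open_arc p a' \<noteq> {}"
    using open_arc_left_meet lam_arcD[OF L arcs(1)] lam_arcD[OF L arcs(2)] by blast
  then have "open_arc p a = open_arc p a'" using gap_disjoint[OF gG(1) G(2)] H(2) \<open>G = H\<close> by blast
  then have "a = a'" using open_arc_inject lam_arcD[OF L arcs(1)] by blast
  then show False using G(3) H(3) e1 by auto
qed

text \<open>The sides that \<open>wedge_at\<close> finds between the two leaves must belong to these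
  leaves, since a third leaf at \<open>p\<close> is impossible.\<close>

lemma wedge:
  assumes pf: "pseudo_fibered L M"
    and a: "open_arc p b \<in> L" "open_arc p a \<in> L" "ang p b < ang p a"
  obtains G where "non_leaf_gap L G" "open_arc p b \<in> G" "open_arc a p \<in> G"
proof -
  note L = pseudo_fiberedD(3)[OF pf]
  have S: "p \<in> S1" "a \<in> S1" "b \<in> S1" using lam_arcD[OF L] a by auto
  have "good_interval (open_arc b a)" using S a(3) by (intro good_interval_open_arc) auto
  then obtain e where "e \<in> open_arc b a" "e \<in> endpoints M"
    by (rule endpoints_dense[OF pseudo_fiberedD(2)[OF pf]])
  then have e: "e \<in> S1" "e \<notin> endpoints L" "ang p b < ang p e" "ang p e < ang p a"
    using pseudo_fiberedD(5)[OF pf] a(3) S by (auto simp: mem_open_arc[of p])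
  obtain G a' b' where G: "non_leaf_gap L G" "open_arc p a' \<in> G" "open_arc b' p \<in> G"
    "ang p b \<le> ang p a'" "ang p a' < ang p e" "ang p e < ang p b'" "ang p b' \<le> ang p a"
    using wedge_at[OF L a(1,2) e] by metis
  have gG: "gap L G" using G by (auto simp: non_leaf_gap_def)
  have L': "open_arc p a' \<in> L" "open_arc p b' \<in> L"
    using gap_mem[OF gG] G(2,3) lam_arc_swap[OF L] by blast+
  have "ang p b = ang p a'" using no_three_leaves[OF pf a(1) L'] G(4-6) by fastforce
  then have 1: "b = a'" using ang_inj lam_arcD[OF L L'(1)] S by blast
  have "ang p b' = ang p a" using no_three_leaves[OF pf L' a(2)] G(5-7) by fastforce
  then have "b' = a" using ang_inj lam_arcD[OF L L'(2)] S by blast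
  then show thesis using that G 1 by blast
qed

section \<open>Saturated gaps and their realness\<close>

lemma gap_or_approx:
  assumes L: "lamination_system L" and I: "I \<in> L" and no: "\<And>G. non_leaf_gap L G \<Longrightarrow> dual I \<notin> G"
  obtains x where "x \<in> I" "\<Union>{K \<in> L. K \<subset> I \<and> x \<in> K} = I"
  using side_gap[OF L I] no by metis

text \<open>By looseness every non-leaf gap is saturated, and a leaf is saturated unless it is a side of a
  non-leaf gap.\<close>

definition sat_gap :: "complex set set \<Rightarrow> complex set set \<Rightarrow> bool" where
  "sat_gap L G \<longleftrightarrow> gap L G \<and> (\<forall>I\<in>G. \<forall>H. non_leaf_gap L H \<longrightarrow> dual I \<notin> H)"

text \<open>Take a non-leaf gap having a chosen leaf at \<open>p\<close> on its boundary if there is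
  one, and this leaf itself otherwise. In the first case a non-leaf gap across a side would share a
  vertex, hence coincide by looseness and contain a side together with its dual.\<close>

lemma sat_gap_exists:
  assumes pf: "pseudo_fibered L M" and p: "p \<in> endpoints L"
  obtains G where "sat_gap L G" "p \<in> vertices G"
proof -
  note L = pseudo_fiberedD(3)[OF pf]
  obtain a where a: "open_arc p a \<in> L" using endpoints_iff[OF L] p by blast
  define I where "I = open_arc p a"
  have pa: "p \<in> S1" "a \<in> S1" "p \<noteq> a" using lam_arcD[OF L a] by auto
  have dI: "dual I = open_arc a p" using dual_open_arc pa by (simp add: I_def)
  show thesis
  proof (cases "\<exists>H. non_leaf_gap L H \<and> (I \<in> H \<or> dual I \<in> H)")
    case True
    then obtain H where H: "non_leaf_gap L H" "I \<in> H \<or> dual I \<in> H" by blast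
    have gap: "gap L H" using H by (auto simp: non_leaf_gap_def)
    have "p \<in> vertices H" using H(2) gap_vertices[OF L gap] dI I_def by auto
    moreover have "sat_gap L H" unfolding sat_gap_def
    proof (intro conjI gap ballI allI impI notI)
      fix J H' assume J: "J \<in> H" "non_leaf_gap L H'" "dual J \<in> H'"
      obtain u v where uv: "J = open_arc u v" "u \<in> S1" "v \<in> S1" "u \<noteq> v"
        using lam_arcE[OF L gap_mem[OF gap J(1)]] by metis
      have gap': "gap L H'" using J by (auto simp: non_leaf_gap_def)
      have "dual J = open_arc v u" using dual_open_arc uv by simp
      then have "u \<in> vertices H" "u \<in> vertices H'"
        using gap_vertices[OF L gap] gap_vertices[OF L gap'] J uv by auto
      then have "H = H'" using loose_unique[OF pf H(1) J(2)] by blast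
      then have "H = leaf J" using gap_leaf_eq[OF L gap] J by blast
      then show False using H(1) gap_mem[OF gap J(1)] by (auto simp: non_leaf_gap_def)
    qed
    ultimately show thesis using that by blast
  next
    case False
    have "sat_gap L (leaf I)" unfolding sat_gap_def
      using leaf_gap[OF L, of I] a False lam_good[OF L a] by (auto simp: I_def leaf_def)
    moreover have "p \<in> vertices (leaf I)" using vertices_leaf pa by (simp add: I_def)
    ultimately show thesis using that by blast
  qed
qed

text \<open>With no non-leaf gap across the side \<open>I\<close>, \<open>gap_or_approx\<close>
  exhausts \<open>I\<close> by nested sides strictly inside it; an increasing sequence of them
  converges to \<open>I\<close>.\<close>

lemma sat_gap_real:
  assumes L: "lamination_system L" and sat: "sat_gap L G"
  shows "real_gap L G"
  unfolding real_gap_def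
proof (intro conjI ballI notI)
  show gap: "gap L G" using sat by (simp add: sat_gap_def)
  fix I assume I: "I \<in> G" and iso: "isolated_interval L I"
  have IL: "I \<in> L" using gap_mem[OF gap I] .
  have gI: "good_interval I" using lam_good[OF L IL] .
  obtain x where x: "x \<in> I" "\<Union>{K \<in> L. K \<subset> I \<and> x \<in> K} = I"
    by (rule gap_or_approx[OF L IL]) (use sat I in \<open>auto simp: sat_gap_def\<close>)
  define F where "F = {K \<in> L. K \<subset> I \<and> x \<in> K}"
  have "F \<noteq> {}" using x by (auto simp: F_def)
  moreover have "good_interval K" if "K \<in> F" for K using that lam_good[OF L] by (auto simp: F_def)
  moreover have "K \<subseteq> K' \<or> K' \<subseteq> K" if K: "K \<in> F" "K' \<in> F" for K K'
    using nested_inside[OF L gI, of K K'] K x by (auto simp: F_def)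
  ultimately obtain J where J: "incseq J" "range J \<subseteq> F" "(\<Union>k. J k) = \<Union>F"
    by (rule chain_sequence)
  have JF: "J k \<in> L" "J k \<subset> I" for k using J(2) by (auto simp: F_def)
  have UJ: "(\<Union>k. J k) = I" using J x by (simp add: F_def)
  have "leaf (J k) \<noteq> leaf I" for k
  proof
    assume "leaf (J k) = leaf I"
    then have "J k = dual I" using JF(2)[of k] by (auto simp: leaf_def doubleton_eq_iff)
    then show False using JF(2)[of k] dual_disjoint[OF gI] good_nonempty[of "dual I"] gI by auto
  qed
  moreover have "leaves_converge L (\<lambda>k. leaf (J k)) I"
    unfolding leaves_converge_def
  proof (intro exI[of _ J] conjI allI)
    show "I \<subseteq> liminf J"
    proof
      fix y assume "y \<in> I"
      then obtain k where "y \<in> J k" using UJ by blast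
      then have "\<forall>m\<ge>k. y \<in> J m" using J(1) by (auto simp: incseq_def)
      then show "y \<in> liminf J" by (auto simp: liminf_SUP_INF)
    qed
    show "liminf J \<subseteq> limsup J"
    proof
      fix y assume "y \<in> liminf J"
      then obtain k where "\<forall>m\<ge>k. y \<in> J m" by (auto simp: liminf_SUP_INF)
      then have "\<exists>m\<ge>n. y \<in> J m" for n by (intro exI[of _ "max k n"]) auto
      then show "y \<in> limsup J" by (auto simp: limsup_INF_SUP)
    qed
    have "limsup J \<subseteq> I"
    proof
      fix y assume "y \<in> limsup J"
      then obtain m where "y \<in> J m" by (auto simp: limsup_INF_SUP)
      then show "y \<in> I" using JF(2)[of m] by auto
    qed
    then show "limsup J \<subseteq> closure I" using closure_subset by blast
  qed (use JF in auto)
  ultimately show False using iso JF unfolding isolated_interval_def lies_on_def by blast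
qed

section \<open>Circle automorphisms\<close>

text \<open>The inverse \<open>h\<close> is carried along, which makes all results symmetric in \<open>g\<close> and its inverse;
  repelling points of \<open>g\<close> are treated as attracting points of \<open>h\<close>.\<close>

definition circle_aut :: "(complex \<Rightarrow> complex) \<Rightarrow> (complex \<Rightarrow> complex) \<Rightarrow> bool" where
  "circle_aut g h \<longleftrightarrow> continuous_on S1 g \<and> continuous_on S1 h \<and>
     (\<forall>x\<in>S1. g x \<in> S1 \<and> h x \<in> S1 \<and> h (g x) = x \<and> g (h x) = x) \<and>
     (\<forall>u z v. ccw u z v \<longrightarrow> ccw (g u) (g z) (g v) \<and> ccw (h u) (h z) (h v))"

lemma circle_aut_sym: "circle_aut g h \<Longrightarrow> circle_aut h g"
  by (auto simp: circle_aut_def)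

lemma circle_autD:
  assumes "circle_aut g h" "x \<in> S1"
  shows "g x \<in> S1" "h x \<in> S1" "h (g x) = x" "g (h x) = x"
  using assms by (auto simp: circle_aut_def)

lemma circle_aut_eq_iff: "\<lbrakk>circle_aut g h; x \<in> S1; y \<in> S1\<rbrakk> \<Longrightarrow> g x = g y \<longleftrightarrow> x = y"
  by (metis circle_autD(3))

lemma circle_homeo_op_aut:
  assumes "circle_homeo_op g" obtains h where "circle_aut g h"
proof -
  obtain h where h: "homeomorphism S1 S1 g h" and ccw: "\<And>u z v. ccw u z v \<Longrightarrow> ccw (g u) (g z) (g v)"
    using assms by (auto simp: circle_homeo_op_def)
  have S: "g x \<in> S1" "h x \<in> S1" "h (g x) = x" "g (h x) = x" if "x \<in> S1" for x
    using h that unfolding homeomorphism_def by auto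
  \<comment> \<open>Three distinct points are ordered one way or the other; the reversed order would
    be carried by \<open>g\<close> to the reverse of the given one.\<close>
  have "ccw (h u) (h z) (h v)" if c: "ccw u z v" for u z v
  proof (rule ccontr)
    assume n: "\<not> ccw (h u) (h z) (h v)"
    have d: "u \<in> S1" "z \<in> S1" "v \<in> S1" "u \<noteq> z" "z \<noteq> v" "u \<noteq> v" using ccw_S1[OF c] by auto
    then have "h u \<noteq> h z" "h z \<noteq> h v" "h u \<noteq> h v" using S by metis+
    then have "ccw (h v) (h z) (h u)"
      using open_arc_trichotomy[of "h u" "h v" "h z"] n S d by (auto simp: open_arc_def)
    then have "ccw v z u" using ccw[of "h v" "h z" "h u"] S d by simp
    then show False using ccw_asym c by blast
  qed
  moreover have "continuous_on S1 g" "continuous_on S1 h" using h by (simp_all add: homeomorphism_def)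
  ultimately have "circle_aut g h" using S ccw by (simp add: circle_aut_def)
  then show thesis using that by blast
qed

lemma circle_aut_comp:
  assumes "circle_aut g h" "circle_aut g' h'" shows "circle_aut (g \<circ> g') (h' \<circ> h)"
proof -
  have c: "continuous_on S1 g" "continuous_on S1 h" "continuous_on S1 g'" "continuous_on S1 h'"
    using assms by (simp_all add: circle_aut_def)
  have im: "g' ` S1 \<subseteq> S1" "h ` S1 \<subseteq> S1" using assms by (auto simp: circle_aut_def)
  have "continuous_on S1 (g \<circ> g')" "continuous_on S1 (h' \<circ> h)"
    using continuous_on_compose2[OF c(1,3) im(1)] continuous_on_compose2[OF c(4,2) im(2)]
    by (simp_all add: comp_def)
  then show ?thesis using assms by (simp add: circle_aut_def)
qed

lemma circle_aut_pow: "circle_aut g h \<Longrightarrow> circle_aut (g ^^ n) (h ^^ n)"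
proof (induction n)
  case 0
  then show ?case by (auto simp: circle_aut_def)
next
  case (Suc n)
  have "circle_aut (g \<circ> (g ^^ n)) ((h ^^ n) \<circ> h)" using circle_aut_comp Suc by blast
  moreover have "(h ^^ n) \<circ> h = h ^^ Suc n" by (simp only: funpow_Suc_right)
  ultimately show ?case by (simp add: comp_def)
qed

lemma aut_image_image: "\<lbrakk>circle_aut g h; I \<subseteq> S1\<rbrakk> \<Longrightarrow> h ` g ` I = I"
  unfolding image_image using circle_autD(3)[of g h] by (force simp: subset_iff)

lemma aut_image_arc:
  assumes a: "circle_aut g h" and S: "u \<in> S1" "v \<in> S1"
  shows "g ` open_arc u v = open_arc (g u) (g v)"
proof (intro set_eqI iffI)
  fix z assume "z \<in> g ` open_arc u v"
  then show "z \<in> open_arc (g u) (g v)" using a by (auto simp: open_arc_def circle_aut_def)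
next
  fix z assume z: "z \<in> open_arc (g u) (g v)"
  then have "ccw (h (g u)) (h z) (h (g v))" using a by (auto simp: open_arc_def circle_aut_def)
  then have "h z \<in> open_arc u v" using circle_autD[OF a] S by (simp add: open_arc_def)
  moreover have "g (h z) = z" using circle_autD[OF a] z open_arc_subset_S1 by blast
  ultimately show "z \<in> g ` open_arc u v" by force
qed

lemma aut_image_good: "\<lbrakk>circle_aut g h; good_interval I\<rbrakk> \<Longrightarrow> good_interval (g ` I)"
  by (elim good_intervalE) (auto simp: aut_image_arc circle_autD circle_aut_eq_iff)

lemma aut_image_dual: "\<lbrakk>circle_aut g h; good_interval I\<rbrakk> \<Longrightarrow> g ` dual I = dual (g ` I)"
  by (elim good_intervalE) (auto simp: aut_image_arc circle_autD circle_aut_eq_iff dual_open_arc)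

lemma aut_image_S1: "circle_aut g h \<Longrightarrow> g ` S1 = S1"
proof (intro equalityI subsetI)
  fix x assume a: "circle_aut g h" and "x \<in> S1"
  then show "x \<in> g ` S1" using circle_autD[OF a, of x] by (intro image_eqI[of _ _ "h x"]) auto
qed (use circle_autD(1) in blast)

lemma aut_inj: "circle_aut g h \<Longrightarrow> inj_on g S1"
  using circle_aut_eq_iff by (intro inj_onI) blast

lemma Fix_S1: "x \<in> Fix g \<Longrightarrow> x \<in> S1 \<and> g x = x"
  by (simp add: Fix_def)

lemma Fix_inverse: "circle_aut g h \<Longrightarrow> Fix h = Fix g"
  unfolding Fix_def using circle_autD[of g h] by (metis (no_types, lifting))

lemma Fix_pow: "x \<in> Fix g \<Longrightarrow> (g ^^ n) x = x"
  by (induction n) (auto simp: Fix_def)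

section \<open>Fixed points and orbits on arcs without fixed points\<close>

lemma arc_fixed_ends:
  assumes "circle_aut g h" "g ` open_arc u v = open_arc u v" "good_interval (open_arc u v)"
  shows "u \<in> Fix g" "v \<in> Fix g"
proof -
  have S: "u \<in> S1" "v \<in> S1" "u \<noteq> v" using assms(3) good_interval_arcD by blast+
  have "open_arc u v = open_arc (g u) (g v)" using aut_image_arc[OF assms(1) S(1,2)] assms(2) by simp
  then have "u = g u \<and> v = g v" using open_arc_inject S by blast
  then show "u \<in> Fix g" "v \<in> Fix g" using S by (auto simp: Fix_def)
qed

lemma aut_subarc_ends:
  assumes "circle_aut g h" "good_interval (open_arc u v)" "g ` open_arc u v \<subseteq> open_arc u v"
  shows "g u = u \<or> g u \<in> open_arc u v" "g v = v \<or> g v \<in> open_arc u v"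
proof -
  have S: "u \<in> S1" "v \<in> S1" "u \<noteq> v" using assms(2) good_interval_arcD by blast+
  show "g u = u \<or> g u \<in> open_arc u v" "g v = v \<or> g v \<in> open_arc u v"
    using open_arc_subset_ends[of "g u" "g v" u v] assms aut_image_arc[OF assms(1) S(1,2)] S
      circle_autD[OF assms(1)] circle_aut_eq_iff[OF assms(1)] by auto
qed

text \<open>Brouwer's theorem on the closed arc, which the angle from \<open>u\<close> identifies
  with a compact interval. The fixed point may be an end of \<open>I\<close>.\<close>

lemma aut_fixed_point:
  assumes a: "circle_aut g h" and I: "good_interval I" "g ` I \<subseteq> I"
  shows "Fix g \<noteq> {}"
proof -
  obtain u v where uv: "I = open_arc u v" "u \<in> S1" "v \<in> S1" "u \<noteq> v"
    using I(1) good_intervalE by metis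
  have cl: "closure I = I \<union> {u, v}" using closure_open_arc uv by simp
  have gcl: "g x \<in> closure I" if "x \<in> closure I" for x
    using that aut_subarc_ends[OF a, of u v] I uv unfolding cl by auto
  define \<alpha> where "\<alpha> = ang u v"
  have \<alpha>: "0 < \<alpha>" "\<alpha> < 2 * pi" using ang_pos ang_lt_2pi uv by (auto simp: \<alpha>_def)
  define \<phi> where "\<phi> t = u * cis t" for t
  have ins: "{0..\<alpha>} = insert 0 (insert \<alpha> {0<..<\<alpha>})" using \<alpha> by auto
  have im: "\<phi> ` {0..\<alpha>} = closure I"
  proof -
    have "\<phi> ` {0<..<\<alpha>} = I" using open_arc_eq_cis[OF uv(2-4)] uv(1) by (simp add: \<phi>_def \<alpha>_def)
    moreover have "\<phi> 0 = u" "\<phi> \<alpha> = v" using ang_eq[OF uv(2,3)] by (simp_all add: \<phi>_def \<alpha>_def)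
    ultimately show ?thesis unfolding cl ins by auto
  qed
  have "inj_on \<phi> {0..\<alpha>}"
  proof (rule inj_onI)
    fix s t assume "s \<in> {0..\<alpha>}" "t \<in> {0..\<alpha>}" "\<phi> s = \<phi> t"
    moreover from this have "ang u (\<phi> s) = s" "ang u (\<phi> t) = t"
      using ang_mult_cis uv(2) \<alpha> by (simp_all add: \<phi>_def)
    ultimately show "s = t" by metis
  qed
  then obtain \<psi> where \<psi>: "homeomorphism {0..\<alpha>} (closure I) \<phi> \<psi>"
    using homeomorphism_compact[of "{0..\<alpha>}" \<phi> "closure I"] im continuous_on_mult_cis unfolding \<phi>_def by auto
  have clS: "closure I \<subseteq> S1" using closure_S1_subset good_subset_S1 I by blast
  have "continuous_on {0..\<alpha>} (\<lambda>t. \<psi> (g (\<phi> t)))"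
  proof (rule continuous_on_compose2[of "closure I" \<psi>])
    show "continuous_on (closure I) \<psi>" using \<psi> by (simp add: homeomorphism_def)
    show "continuous_on {0..\<alpha>} (\<lambda>t. g (\<phi> t))"
      by (rule continuous_on_compose2[of "closure I" g])
        (use a \<psi> clS im continuous_on_subset in \<open>auto simp: circle_aut_def homeomorphism_def\<close>)
  qed (use gcl im in auto)
  moreover have "(\<lambda>t. \<psi> (g (\<phi> t))) ` {0..\<alpha>} \<subseteq> {0..\<alpha>}"
    using gcl im \<psi> unfolding homeomorphism_def by blast
  ultimately obtain t where t: "t \<in> {0..\<alpha>}" "\<psi> (g (\<phi> t)) = t"
    using brouwer[of "{0..\<alpha>}" "\<lambda>t. \<psi> (g (\<phi> t))"] \<alpha> by (auto simp: image_subset_iff_funcset)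
  have "\<phi> t \<in> closure I" using t im by blast
  moreover have "g (\<phi> t) = \<phi> t"
    using t \<psi> gcl[OF \<open>\<phi> t \<in> closure I\<close>] unfolding homeomorphism_def by metis
  ultimately show ?thesis using clS by (auto simp: Fix_def)
qed

text \<open>The arc from \<open>p\<close> to \<open>y\<close> goes to the arc from \<open>p\<close>
  to \<open>g y\<close>, so membership of \<open>x\<close> is preserved. Orbits can thus be compared
  as under an increasing map of the line.\<close>

lemma aut_ang_mono:
  assumes "circle_aut g h" "p \<in> Fix g" "x \<in> S1" "y \<in> S1" "ang p x < ang p y"
  shows "ang p (g x) < ang p (g y)"
proof -
  have p: "p \<in> S1" "g p = p" using assms(2) Fix_S1 by blast+
  have y: "g y \<in> S1" using circle_autD assms by blast
  have yp: "y \<noteq> p" using assms(5) p ang_ge0[of p x] by auto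
  show ?thesis
  proof (cases "x = p")
    case True
    have "g y \<noteq> p" using circle_aut_eq_iff[OF assms(1) assms(4) p(1)] p yp by simp
    then show ?thesis using True p y ang_pos[of p "g y"] by simp
  next
    case False
    then have "x \<in> open_arc p y" using assms p ang_pos[of p x] by (simp add: mem_open_arc0)
    then have "g x \<in> open_arc p (g y)" using aut_image_arc[OF assms(1) p(1) assms(4)] p by auto
    then show ?thesis using p by (simp add: mem_open_arc0)
  qed
qed

text \<open>The angular displacement is continuous away from \<open>p\<close> and vanishes only at
  fixed points, so it keeps its sign on a connected set.\<close>

lemma aut_direction:
  assumes a: "circle_aut g h" and p: "p \<in> Fix g" and C: "connected C" "C \<subseteq> S1 - {p}" "C \<inter> Fix g = {}"
  shows "(\<forall>x\<in>C. ang p (g x) < ang p x) \<or> (\<forall>x\<in>C. ang p x < ang p (g x))"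
proof -
  have pS: "p \<in> S1" "g p = p" using p Fix_S1 by blast+
  define f where "f x = ang p (g x) - ang p x" for x
  have gC: "g x \<in> S1 - {p}" if "x \<in> C" for x
    using that C circle_autD[OF a, of x] circle_aut_eq_iff[OF a, of x p] pS by auto
  have "continuous_on C f" unfolding f_def
  proof (rule continuous_on_diff)
    show "continuous_on C (\<lambda>x. ang p (g x))"
    proof (rule continuous_on_compose2[OF continuous_on_ang[OF pS(1)]])
      show "continuous_on C g" using a C continuous_on_subset unfolding circle_aut_def by blast
    qed (use gC in auto)
    show "continuous_on C (ang p)" using continuous_on_ang[OF pS(1)] C continuous_on_subset by blast
  qed
  then have conn: "connected (f ` C)" using C(1) connected_continuous_image by blast
  have "f x \<noteq> 0" if "x \<in> C" for x
  proof
    assume "f x = 0"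
    then have "g x = x" using gC[OF that] that C ang_inj[of p "g x" x] pS by (auto simp: f_def)
    then show False using that C by (auto simp: Fix_def)
  qed
  then have "0 \<notin> f ` C" by force
  then have "\<not> (\<exists>x\<in>C. \<exists>y\<in>C. f x \<le> 0 \<and> 0 \<le> f y)"
    using connectedD_interval[OF conn] by (meson imageI)
  then show ?thesis unfolding f_def by (smt (verit))
qed

lemma limit_of_orbit_fixed:
  assumes a: "circle_aut g h" and x: "x \<in> S1" "y \<in> S1" "(\<lambda>n. (g ^^ n) x) \<longlonglongrightarrow> y"
  shows "y \<in> Fix g"
proof -
  have S: "(g ^^ n) x \<in> S1" for n using circle_autD[OF circle_aut_pow[OF a]] x by blast
  have "(\<lambda>n. g ((g ^^ n) x)) \<longlonglongrightarrow> g y"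
    using continuous_on_tendsto_compose[of S1 g "\<lambda>n. (g ^^ n) x" y] a x S unfolding circle_aut_def by auto
  moreover have "(\<lambda>n. g ((g ^^ n) x)) \<longlonglongrightarrow> y"
    using LIMSEQ_Suc[OF x(3)] by simp
  ultimately show ?thesis using LIMSEQ_unique x(2) by (auto simp: Fix_def)
qed

text \<open>Angles along an orbit are monotone and bounded. The limit is a fixed point of the closed
  arc, hence an end of it, and the direction of motion tells which.\<close>

lemma orbits_on_free_arc_aux:
  assumes a: "circle_aut g h" and p: "p \<in> Fix g" "d \<in> Fix g" "p \<noteq> d"
    and free: "open_arc p d \<inter> Fix g = {}" and dir: "\<And>x. x \<in> open_arc p d \<Longrightarrow> ang p (g x) < ang p x"
    and x: "x \<in> open_arc p d"
  shows "(\<lambda>n. (g ^^ n) x) \<longlonglongrightarrow> p" "(\<lambda>n. (h ^^ n) x) \<longlonglongrightarrow> d"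
proof -
  have S: "p \<in> S1" "d \<in> S1" "g p = p" "g d = d" "h p = p" "h d = d"
    using p Fix_S1 Fix_inverse[OF a] by blast+
  have inv: "g y \<in> open_arc p d" "h y \<in> open_arc p d" if "y \<in> open_arc p d" for y
    using aut_image_arc[OF a S(1,2)] aut_image_arc[OF circle_aut_sym[OF a] S(1,2)] that S by auto
  have g: "(g ^^ n) x \<in> open_arc p d" "(h ^^ n) x \<in> open_arc p d" for n
    by (induction n) (auto simp: x inv)
  have xS: "x \<in> S1" using x open_arc_subset_S1 by blast
  have lim: "\<exists>l. (\<lambda>n. (k ^^ n) x) \<longlonglongrightarrow> p * cis l \<and> (\<lambda>n. ang p ((k ^^ n) x)) \<longlonglongrightarrow> l"
    if k: "\<And>n. (k ^^ n) x \<in> open_arc p d" "monoseq (\<lambda>n. ang p ((k ^^ n) x))" for k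
  proof -
    have "Bseq (\<lambda>n. ang p ((k ^^ n) x))"
    proof (rule BseqI')
      show "norm (ang p ((k ^^ n) x)) \<le> 2 * pi" for n
        using ang_lt_2pi[of p "(k ^^ n) x"] ang_ge0[of p "(k ^^ n) x"] by simp
    qed
    then obtain l where l: "(\<lambda>n. ang p ((k ^^ n) x)) \<longlonglongrightarrow> l"
      using Bseq_monoseq_convergent k(2) unfolding convergent_def by blast
    have "(\<lambda>n. p * cis (ang p ((k ^^ n) x))) \<longlonglongrightarrow> p * cis l"
      by (intro tendsto_intros isCont_tendsto_compose[OF _ l] continuous_intros)
    moreover have "p * cis (ang p ((k ^^ n) x)) = (k ^^ n) x" for n
      using ang_eq[OF S(1)] k(1) open_arc_subset_S1 by blast
    ultimately show ?thesis using l by auto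
  qed
  have bd: "0 < ang p y" "ang p y < ang p d" if "y \<in> open_arc p d" for y
    using that S by (auto simp: mem_open_arc0)
  show "(\<lambda>n. (g ^^ n) x) \<longlonglongrightarrow> p"
  proof -
    have dec: "decseq (\<lambda>n. ang p ((g ^^ n) x))"
      using dir[OF g(1)] by (intro decseq_SucI) (auto intro: less_imp_le)
    then obtain l where l: "(\<lambda>n. (g ^^ n) x) \<longlonglongrightarrow> p * cis l" "(\<lambda>n. ang p ((g ^^ n) x)) \<longlonglongrightarrow> l"
      using lim[of g] g(1) decseq_imp_monoseq by blast
    have "l \<le> ang p x" using decseq_ge[OF dec l(2), of 0] by simp
    moreover have "0 \<le> l" using l(2) ang_ge0 by (intro LIMSEQ_le_const) auto
    ultimately have l': "0 \<le> l" "l < ang p d" "l < 2 * pi" using bd[OF x] ang_lt_2pi[of p d] by auto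
    have "p * cis l \<in> Fix g" using limit_of_orbit_fixed[OF a xS _ l(1)] S by simp
    then have "p * cis l \<notin> open_arc p d" using free by blast
    then have "l = 0" using l' S ang_mult_cis[of p l] by (simp add: mem_open_arc0)
    then show ?thesis using l by simp
  qed
  show "(\<lambda>n. (h ^^ n) x) \<longlonglongrightarrow> d"
  proof -
    have up: "ang p y < ang p (h y)" if "y \<in> open_arc p d" for y
      using dir[OF inv(2)[OF that]] circle_autD(4)[OF a] that open_arc_subset_S1 by (metis subsetD)
    have inc: "incseq (\<lambda>n. ang p ((h ^^ n) x))"
      using up[OF g(2)] by (intro incseq_SucI) (auto intro: less_imp_le)
    then obtain l where l: "(\<lambda>n. (h ^^ n) x) \<longlonglongrightarrow> p * cis l" "(\<lambda>n. ang p ((h ^^ n) x)) \<longlonglongrightarrow> l"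
      using lim[of h] g(2) incseq_imp_monoseq by blast
    have "ang p x \<le> l" using incseq_le[OF inc l(2), of 0] by simp
    moreover have "l \<le> ang p d" using l(2) bd(2)[OF g(2)] less_imp_le by (intro LIMSEQ_le_const2) blast+
    ultimately have l': "0 < l" "l \<le> ang p d" "l < 2 * pi" using bd[OF x] ang_lt_2pi[of p d] by auto
    have "p * cis l \<in> Fix g" using limit_of_orbit_fixed[OF circle_aut_sym[OF a] xS _ l(1)] S Fix_inverse[OF a] by simp
    then have "p * cis l \<notin> open_arc p d" using free by blast
    then have "l = ang p d" using l' S ang_mult_cis[of p l] by (simp add: mem_open_arc0)
    then show ?thesis using l ang_eq[of p d] S by simp
  qed
qed

lemma orbits_on_free_arc:
  assumes a: "circle_aut g h" and p: "p \<in> Fix g" "d \<in> Fix g" "p \<noteq> d"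
    and free: "open_arc p d \<inter> Fix g = {}"
  shows "(\<forall>x\<in>open_arc p d. (\<lambda>n. (g ^^ n) x) \<longlonglongrightarrow> p \<and> (\<lambda>n. (h ^^ n) x) \<longlonglongrightarrow> d) \<or>
    (\<forall>x\<in>open_arc p d. (\<lambda>n. (g ^^ n) x) \<longlonglongrightarrow> d \<and> (\<lambda>n. (h ^^ n) x) \<longlonglongrightarrow> p)"
proof -
  have pS: "p \<in> S1" "d \<in> S1" "h p = p" "h d = d" using p Fix_S1 Fix_inverse[OF a] by blast+
  have "open_arc p d \<subseteq> S1 - {p}" using open_arc_subset_S1 open_arc_ends by blast
  from aut_direction[OF a p(1) connected_open_arc this free] show ?thesis
  proof
    assume "\<forall>x\<in>open_arc p d. ang p (g x) < ang p x"
    then show ?thesis using orbits_on_free_arc_aux[OF a p free] by blast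
  next
    assume up: "\<forall>x\<in>open_arc p d. ang p x < ang p (g x)"
    have "ang p (h x) < ang p x" if x: "x \<in> open_arc p d" for x
    proof -
      have "h x \<in> open_arc p d" using aut_image_arc[OF circle_aut_sym[OF a] pS(1,2)] pS x by auto
      then show ?thesis using up circle_autD(4)[OF a] x open_arc_subset_S1 by (metis subsetD)
    qed
    then show ?thesis
      using orbits_on_free_arc_aux[OF circle_aut_sym[OF a], of p d] p free Fix_inverse[OF a] by auto
  qed
qed

lemma closed_Fix: "circle_aut g h \<Longrightarrow> compact (Fix g)"
proof -
  assume "circle_aut g h"
  then have "continuous_on S1 (\<lambda>x. g x - x)" unfolding circle_aut_def by (intro continuous_intros) auto
  then have "closedin (top_of_set S1) (S1 \<inter> (\<lambda>x. g x - x) -` {0})"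
    by (intro continuous_closedin_preimage) auto
  moreover have "S1 \<inter> (\<lambda>x. g x - x) -` {0} = Fix g" by (auto simp: Fix_def)
  ultimately show ?thesis using closedin_compact compact_sphere by metis
qed

text \<open>The fixed set is compact, so the first and the last fixed point met on a turn starting
  at \<open>x\<close> exist; two fixed points are demanded to keep them apart.\<close>

lemma free_arc_around:
  assumes a: "circle_aut g h" and x: "x \<in> S1" "x \<notin> Fix g" and ne: "q1 \<in> Fix g" "q2 \<in> Fix g" "q1 \<noteq> q2"
  obtains p d where "p \<in> Fix g" "d \<in> Fix g" "p \<noteq> d" "x \<in> open_arc p d" "open_arc p d \<inter> Fix g = {}"
proof -
  have sub: "Fix g \<subseteq> S1 - {x}" using x by (auto simp: Fix_def)
  have cont: "continuous_on (Fix g) (ang x)" using continuous_on_ang[OF x(1)] sub continuous_on_subset by blast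
  have F: "Fix g \<noteq> {}" using ne by blast
  obtain d where d: "d \<in> Fix g" "\<And>y. y \<in> Fix g \<Longrightarrow> ang x d \<le> ang x y"
    using continuous_attains_inf[OF closed_Fix[OF a] F cont] by blast
  obtain p where p: "p \<in> Fix g" "\<And>y. y \<in> Fix g \<Longrightarrow> ang x y \<le> ang x p"
    using continuous_attains_sup[OF closed_Fix[OF a] F cont] by blast
  have ne': "p \<noteq> d"
  proof
    assume "p = d"
    then have "ang x q1 = ang x q2" using p(2)[OF ne(1)] p(2)[OF ne(2)] d(2)[OF ne(1)] d(2)[OF ne(2)] by simp
    then show False using ang_inj[OF x(1)] sub ne by blast
  qed
  have pS: "p \<in> S1" "d \<in> S1" "p \<noteq> x" "d \<noteq> x" using p d sub by auto
  have "ang x p \<noteq> ang x d" using ne' ang_inj[OF x(1)] pS by blast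
  then have lt: "ang x d < ang x p" using d(2)[OF p(1)] by linarith
  have "0 < ang x d" using ang_pos x pS by blast
  then have "x \<in> open_arc p d" using lt x pS by (simp add: mem_open_arc[OF x(1)])
  moreover have "z \<notin> Fix g" if "z \<in> open_arc p d" for z
    using that lt d(2)[of z] p(2)[of z] by (auto simp: mem_open_arc[OF x(1)])
  ultimately show thesis using that p d ne' by blast
qed

section \<open>Dynamics at fixed points\<close>

definition lam_aut :: "complex set set \<Rightarrow> (complex \<Rightarrow> complex) \<Rightarrow> (complex \<Rightarrow> complex) \<Rightarrow> bool" where
  "lam_aut L g h \<longleftrightarrow> circle_aut g h \<and> (\<forall>I\<in>L. g ` I \<in> L \<and> h ` I \<in> L)"

lemma lam_aut_sym: "lam_aut L g h \<Longrightarrow> lam_aut L h g"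
  by (auto simp: lam_aut_def circle_aut_sym)

lemma lam_aut_circle: "lam_aut L g h \<Longrightarrow> circle_aut g h"
  by (simp add: lam_aut_def)

lemma lam_aut_mem: "\<lbrakk>lam_aut L g h; I \<in> L\<rbrakk> \<Longrightarrow> g ` I \<in> L"
  by (simp add: lam_aut_def)

lemma pow_image: "(g ^^ Suc n) ` I = g ` (g ^^ n) ` I"
  by (simp add: image_image)

lemma pow_image_swap: "(g ^^ Suc n) ` I = (g ^^ n) ` g ` I"
  by (simp only: funpow_Suc_right image_comp)

lemma lam_aut_pow_mem: "\<lbrakk>lam_aut L g h; I \<in> L\<rbrakk> \<Longrightarrow> (g ^^ n) ` I \<in> L"
proof (induction n)
  case (Suc n)
  then show ?case unfolding pow_image using lam_aut_mem by blast
qed simp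

lemma lam_aut_pow: "lam_aut L g h \<Longrightarrow> lam_aut L (g ^^ n) (h ^^ n)"
  using circle_aut_pow lam_aut_pow_mem lam_aut_sym unfolding lam_aut_def[of L "g ^^ n"] lam_aut_def[of L g]
  by (metis lam_aut_def)

text \<open>If \<open>x\<close> moved, then \<open>x\<close>, \<open>g x\<close> and
  \<open>g (g x)\<close> would be the ends of three leaves at \<open>p\<close>, because angles from
  \<open>p\<close> move monotonically.\<close>

lemma leaf_fixed:
  assumes pf: "pseudo_fibered L M" and a: "lam_aut L g h" and p: "p \<in> Fix g" and l: "open_arc p x \<in> L"
  shows "x \<in> Fix g"
proof (rule ccontr)
  assume n: "x \<notin> Fix g"
  note L = pseudo_fiberedD(3)[OF pf] and c = lam_aut_circle[OF a]
  have S: "p \<in> S1" "x \<in> S1" "g p = p" using lam_arcD[OF L l] p Fix_S1 by blast+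
  have gS: "g x \<in> S1" "g (g x) \<in> S1" using circle_autD[OF c] S by blast+
  have l1: "open_arc p (g x) \<in> L" using lam_aut_mem[OF a l] aut_image_arc[OF c S(1,2)] S by simp
  have l2: "open_arc p (g (g x)) \<in> L" using lam_aut_mem[OF a l1] aut_image_arc[OF c S(1) gS(1)] S by simp
  have "g x \<noteq> x" using n S by (auto simp: Fix_def)
  then have "ang p (g x) \<noteq> ang p x" using ang_inj S gS by blast
  then consider "ang p x < ang p (g x)" | "ang p (g x) < ang p x" by linarith
  then show False
  proof cases
    case 1
    then show False using no_three_leaves[OF pf l l1 l2] aut_ang_mono[OF c p S(2) gS(1)] by blast
  next
    case 2
    then show False using no_three_leaves[OF pf l2 l1 l] aut_ang_mono[OF c p gS(1) S(2)] by blast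
  qed
qed

text \<open>Consecutive vertices are joined by a leaf, so fixedness spreads from one vertex in both
  directions.\<close>

lemma enumeration_fixed:
  assumes pf: "pseudo_fibered L M" and a: "lam_aut L g h" and G: "gap L G" "enumerates t G"
    and j: "t j \<in> Fix g"
  shows "t k \<in> Fix g"
proof -
  note L = pseudo_fiberedD(3)[OF pf]
  have l: "open_arc (t k) (t (k + 1)) \<in> L" for k using enumeratesD(1)[OF L G] gap_mem[OF G(1)] by blast
  show ?thesis
  proof (induction k rule: int_induct[of _ j])
    case (step1 i)
    then show ?case using leaf_fixed[OF pf a _ l] by blast
  next
    case (step2 i)
    have "open_arc (t i) (t (i - 1)) \<in> L" using lam_arc_swap[OF L l[of "i - 1"]] by simp
    then show ?case using leaf_fixed[OF pf a step2(2)] by blast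
  qed (rule j)
qed

lemma gap_image:
  assumes L: "lamination_system L" and a: "lam_aut L g h" and G: "gap L G"
  shows "gap L ((`) g ` G)" "vertices ((`) g ` G) = g ` vertices G"
proof -
  note c = lam_aut_circle[OF a]
  have GS: "I \<subseteq> S1" if "I \<in> G" for I using good_subset_S1[OF lam_good[OF L gap_mem[OF G that]]] .
  show "gap L ((`) g ` G)" unfolding gap_def
  proof (intro conjI ballI)
    show "(`) g ` G \<subseteq> L" using gap_mem[OF G] lam_aut_mem[OF a] by blast
    show "disjoint ((`) g ` G)"
    proof (rule disjointI)
      fix X Y assume h: "X \<in> (`) g ` G" "Y \<in> (`) g ` G" "X \<noteq> Y"
      then obtain I J where IJ: "X = g ` I" "Y = g ` J" "I \<in> G" "J \<in> G" by blast
      then have "I \<inter> J = {}" using h gap_disjoint[OF G] by blast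
      then show "X \<inter> Y = {}" using IJ GS inj_on_image_Int[OF aut_inj[OF c], of I J] by simp
    qed
    fix I assume I: "I \<in> L"
    have gI: "good_interval I" using lam_good[OF L I] .
    have "h ` I \<in> L" using lam_aut_mem[OF lam_aut_sym[OF a] I] .
    then obtain J where J: "J \<in> G" "h ` I \<subseteq> J \<or> dual (h ` I) \<subseteq> J"
      using G unfolding gap_def lies_on_def by blast
    have "dual (h ` I) = h ` dual I" using aut_image_dual[OF circle_aut_sym[OF c] gI] by simp
    moreover have "g ` h ` I = I" "g ` h ` dual I = dual I"
      using aut_image_image[OF circle_aut_sym[OF c]] good_subset_S1 gI good_dual by blast+
    ultimately have "I \<subseteq> g ` J \<or> dual I \<subseteq> g ` J" using J(2) by (metis image_mono)
    then show "\<exists>J\<in>(`) g ` G. lies_on I J" using J(1) unfolding lies_on_def by blast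
  qed
  have "g ` (S1 - \<Union>G) = g ` S1 - g ` \<Union>G"
    using GS by (intro inj_on_image_set_diff[OF aut_inj[OF c]]) auto
  then show "vertices ((`) g ` G) = g ` vertices G"
    unfolding vertices_def aut_image_S1[OF c] image_Union by simp
qed

lemma image_leaf: "\<lbrakk>circle_aut g h; good_interval I\<rbrakk> \<Longrightarrow> (`) g ` leaf I = leaf (g ` I)"
  by (auto simp: leaf_def aut_image_dual)

lemma image_image_family:
  assumes "circle_aut g h" "\<And>I. I \<in> G \<Longrightarrow> I \<subseteq> S1" shows "(`) h ` (`) g ` G = G"
proof -
  have "(`) h ` (`) g ` G = (\<lambda>I. h ` g ` I) ` G" by (rule image_image)
  also have "\<dots> = (\<lambda>I. I) ` G"
    using aut_image_image[OF assms(1) assms(2)] by (intro image_cong refl) blast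
  finally show ?thesis by simp
qed

lemma non_leaf_gap_image:
  assumes L: "lamination_system L" and a: "lam_aut L g h" and G: "non_leaf_gap L G"
  shows "non_leaf_gap L ((`) g ` G)"
proof -
  note c = lam_aut_circle[OF a]
  have gap: "gap L G" using G by (simp add: non_leaf_gap_def)
  have "(`) g ` G \<noteq> leaf I" if I: "I \<in> L" for I
  proof
    assume "(`) g ` G = leaf I"
    then have "(`) h ` (`) g ` G = leaf (h ` I)"
      using image_leaf[OF circle_aut_sym[OF c] lam_good[OF L I]] by simp
    moreover have "(`) h ` (`) g ` G = G"
      using image_image_family[OF c] good_subset_S1[OF lam_good[OF L gap_mem[OF gap]]] by blast
    ultimately show False using G lam_aut_mem[OF lam_aut_sym[OF a] I] by (auto simp: non_leaf_gap_def)
  qed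
  then show ?thesis using gap_image(1)[OF L a gap] by (simp add: non_leaf_gap_def)
qed

text \<open>The gap and its image share the vertex \<open>p\<close>; looseness identifies
  them.\<close>

lemma gap_at_fixed_vertex:
  assumes pf: "pseudo_fibered L M" and a: "lam_aut L g h" and G: "non_leaf_gap L G"
    and p: "p \<in> Fix g" "p \<in> vertices G"
  shows "(`) g ` G = G"
proof -
  note L = pseudo_fiberedD(3)[OF pf]
  have gap: "gap L G" using G by (simp add: non_leaf_gap_def)
  have "p \<in> vertices ((`) g ` G)"
    unfolding gap_image(2)[OF L a gap] using p Fix_S1 by (metis image_eqI)
  then show ?thesis using loose_unique[OF pf non_leaf_gap_image[OF L a G] G] p by blast
qed

text \<open>The images of \<open>I\<close> increase to an invariant connected open set. No fixed
  point enters on the way, as powers of \<open>g\<close> are injective; hence \<open>q\<close> stays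
  outside, and the union is a side or a punctured circle.\<close>

lemma orbit_union:
  assumes L: "lamination_system L" and a: "lam_aut L g h" and I: "I \<in> L" "I \<subseteq> g ` I"
    and q: "q \<in> Fix g" "q \<notin> I"
  obtains V where "V \<in> L \<and> g ` V = V \<or> V = S1 - {q}" "I \<subseteq> V" "q \<notin> V"
    "\<And>x. x \<in> Fix g \<Longrightarrow> x \<in> V \<Longrightarrow> x \<in> I" "\<And>x n. x \<in> I \<Longrightarrow> (g ^^ n) x \<in> V"
proof -
  note c = lam_aut_circle[OF a]
  define J where "J n = (g ^^ n) ` I" for n
  define V where "V = (\<Union>n. J n)"
  have JL: "J n \<in> L" for n using lam_aut_pow_mem[OF a I(1)] by (simp add: J_def)
  have inc: "incseq J" unfolding J_def
    using I(2) by (intro incseq_SucI) (metis image_mono pow_image_swap)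
  have J0: "J 0 = I" by (simp add: J_def)
  then have IV: "I \<subseteq> V" by (auto simp: V_def)
  have IS: "I \<subseteq> S1" using good_subset_S1 lam_good L I by blast
  have fixI: "x \<in> I" if x: "x \<in> Fix g" "x \<in> V" for x
  proof -
    obtain n y where y: "y \<in> I" "x = (g ^^ n) y" using x(2) by (auto simp: V_def J_def)
    have "(g ^^ n) x = x" using Fix_pow[OF x(1)] .
    then have "x = y" using circle_aut_eq_iff[OF circle_aut_pow[OF c, of n], of x y] y IS x Fix_S1 by auto
    then show ?thesis using y by simp
  qed
  obtain z where z: "z \<in> I" using good_nonempty lam_good L I by blast
  have "good_interval (\<Union>(range J)) \<or> \<Union>(range J) = S1 - {q}"
  proof (rule Union_good_cases)
    fix X assume "X \<in> range J"
    then obtain n where n: "X = J n" by blast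
    have "J 0 \<subseteq> J n" using inc by (simp add: incseq_def)
    then show "good_interval X \<and> z \<in> X \<and> q \<notin> X" using lam_good[OF L JL] n z J0 fixI[OF q(1)] q(2)
      by (auto simp: V_def)
  qed (use q Fix_S1 in auto)
  then have "good_interval V \<or> V = S1 - {q}" by (simp add: V_def)
  moreover have "V \<in> L" if "good_interval V"
    using L that inc JL unfolding lamination_system_def V_def by blast
  moreover have "g ` V = V"
  proof
    have gJ: "g ` J n = J (Suc n)" for n by (simp only: J_def pow_image)
    have "g ` V = (\<Union>n. J (Suc n))" unfolding V_def image_UN gJ ..
    moreover have "J n \<subseteq> J (Suc n)" for n using inc by (simp add: incseq_Suc_iff)
    ultimately show "g ` V \<subseteq> V" "V \<subseteq> g ` V" unfolding V_def by blast+
  qed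
  moreover have "(g ^^ n) x \<in> V" if "x \<in> I" for x n using that by (auto simp: V_def J_def)
  moreover have "q \<notin> V" using fixI[OF q(1)] q(2) by blast
  ultimately show thesis using that[of V] IV fixI by blast
qed

section \<open>Rainbow points fixed by an automorphism\<close>

lemma good_nhd:
  assumes "good_interval K" "p \<in> K" obtains T where "open T" "K = S1 \<inter> T" "p \<in> T"
  using good_openin[OF assms(1)] assms(2) unfolding openin_open by auto

lemma orbit_enters:
  assumes "good_interval K" "p \<in> K" "\<And>n. s n \<in> S1" "s \<longlonglongrightarrow> p"
  shows "\<exists>N. \<forall>n\<ge>N. s n \<in> K"
proof -
  obtain T where "open T" "K = S1 \<inter> T" "p \<in> T" using good_nhd[OF assms(1,2)] by blast
  then show ?thesis using topological_tendstoD[OF assms(4), of T] assms(3)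
    unfolding eventually_sequentially by auto
qed

text \<open>A small side around \<open>p\<close> that misses one point on each side of a leaf ending
  at \<open>p\<close> would cross that leaf.\<close>

lemma rainbow_not_endpoint:
  assumes L: "lamination_system L" and r: "rainbow_point L p" shows "p \<notin> endpoints L"
proof
  assume "p \<in> endpoints L"
  then obtain b where b: "open_arc p b \<in> L" using endpoints_iff[OF L] by blast
  define J where "J = open_arc p b"
  have gJ: "good_interval J" and pb: "p \<in> S1" "b \<in> S1" "p \<noteq> b"
    using lam_good[OF L] lam_arcD[OF L b] b J_def by auto
  have pJ: "p \<notin> J" "p \<notin> dual J" using open_arc_ends[of p b] open_arc_ends[of b p] dual_open_arc[OF pb] by (auto simp: J_def)
  obtain x where x: "x \<in> J" using good_nonempty[OF gJ] by blast
  obtain y where y: "y \<in> dual J" using good_nonempty[of "dual J"] gJ by auto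
  obtain K where K: "K \<in> L" "p \<in> K" "K \<inter> {x, y} = {}"
    by (rule rainbow_memE[OF r, of "{x, y}"]) (use x y pJ in auto)
  have gK: "good_interval K" using lam_good[OF L K(1)] .
  obtain T where T: "open T" "K = S1 \<inter> T" "p \<in> T" using good_nhd[OF gK K(2)] by blast
  have "p \<in> closure J" using closure_open_arc[OF pb] by (simp add: J_def)
  then have "T \<inter> J \<noteq> {}" using open_Int_closure_eq_empty[OF T(1), of J] T(3) by blast
  then have "K \<inter> J \<noteq> {}" using T good_subset_S1[OF gJ] by blast
  moreover have "\<not> dual K \<subseteq> J" using dual_subset_swap[OF gK gJ] y K(3) by blast
  ultimately show False using noncross[OF L K(1), of J] b K pJ x J_def by blast
qed

text \<open>The dynamics will iterate the dual of \<open>K\<close>, so the points must lie in this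
  open set; merely avoiding \<open>K\<close> would still allow them to be its ends.\<close>

lemma rainbow_dualE:
  assumes L: "lamination_system L" and r: "rainbow_point L p" and B: "finite B" "B \<subseteq> S1 - {p}"
  obtains K where "K \<in> L" "p \<in> K" "B \<subseteq> dual K"
proof -
  obtain I where I: "decseq I" "range I \<subseteq> L" "(\<Inter>k. I k) = {p}"
    using r unfolding rainbow_point_def by auto
  have gI: "good_interval (I k)" and pI: "p \<in> I k" for k using I lam_good[OF L] by auto
  have pS: "p \<in> S1" using good_subset_S1[OF gI] pI by blast
  have one: "\<exists>k. b \<in> dual (I k)" if b: "b \<in> S1" "b \<noteq> p" for b
  proof -
    \<comment> \<open>The points \<open>u\<close> and \<open>v\<close> enclose \<open>b\<close>: a
      side that contains \<open>p\<close> and misses both stays in the arc beyond them, whose dual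
      contains \<open>b\<close>.\<close>
    obtain u where u: "u \<in> open_arc b p" using open_arc_nonempty b pS by metis
    obtain v where v: "v \<in> open_arc p b" using open_arc_nonempty b pS by metis
    have uv: "u \<in> S1" "v \<in> S1" "0 < ang p v" "ang p v < ang p b" "ang p b < ang p u"
      using u v b pS mem_open_arc0[of p v b] mem_open_arc1[of p b u] by auto
    then have bd: "b \<in> open_arc v u" "p \<in> open_arc u v" "u \<noteq> v" "u \<noteq> p" "v \<noteq> p"
      using b pS by (auto simp: mem_open_arc[of p])
    have "u \<notin> (\<Inter>k. I k)" "v \<notin> (\<Inter>k. I k)" using I(3) bd by auto
    then obtain k l where "u \<notin> I k" "v \<notin> I l" by blast
    moreover have "I (max k l) \<subseteq> I k" "I (max k l) \<subseteq> I l" using I(1) by (auto simp: decseq_def)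
    ultimately have "u \<notin> I (max k l)" "v \<notin> I (max k l)" by blast+
    then have "I (max k l) \<subseteq> open_arc u v"
      using connected_subset_arc[OF good_connected[OF gI] good_subset_S1[OF gI]] pI bd by blast
    then have "dual (open_arc u v) \<subseteq> dual (I (max k l))" using dual_mono gI uv bd by simp
    then show ?thesis using dual_open_arc uv bd by auto
  qed
  have "\<exists>k. B \<subseteq> dual (I k)" using B
  proof (induction B rule: finite_induct)
    case (insert b B)
    then obtain k l where k: "B \<subseteq> dual (I k)" "b \<in> dual (I l)" using one[of b] by auto
    have "I (max k l) \<subseteq> I k" "I (max k l) \<subseteq> I l" using I(1) by (auto simp: decseq_def)
    then have "dual (I k) \<subseteq> dual (I (max k l))" "dual (I l) \<subseteq> dual (I (max k l))"
      using dual_mono gI by blast+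
    then show ?case using k by blast
  qed auto
  then show thesis using that I pI by blast
qed

text \<open>A small side \<open>K\<close> around \<open>p\<close> and its image are nested, and the orbit of \<open>x\<close> decides in which order.
  The forward orbit of \<open>dual K\<close> and the backward orbit of \<open>K\<close> then exhaust either a punctured circle
  or an invariant side of a leaf.\<close>

lemma rainbow_attracting:
  assumes L: "lamination_system L" and a: "lam_aut L g h" and r: "rainbow_point L p"
    and p: "p \<in> Fix g" and q: "q \<in> Fix g" "p \<noteq> q"
    and x: "x \<in> S1" "x \<noteq> p" "(\<lambda>n. (g ^^ n) x) \<longlonglongrightarrow> p"
  shows "attracting g p \<and> (Fix g = {p, q} \<or>
    (\<exists>b d. open_arc b d \<in> L \<and> open_arc b d \<inter> Fix g = {p} \<and> b \<in> Fix g \<and> d \<in> Fix g))"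
proof -
  note c = lam_aut_circle[OF a]
  note c' = circle_aut_sym[OF c]
  have pe: "p \<notin> endpoints L" using rainbow_not_endpoint[OF L r] .
  have S: "p \<in> S1" "q \<in> S1" "g p = p" "g q = q" using p q Fix_S1 by blast+
  obtain K where K: "K \<in> L" "p \<in> K" "{q, x} \<subseteq> dual K"
    by (rule rainbow_dualE[OF L r, of "{q, x}"]) (use S q x in auto)
  have gK: "good_interval K" using lam_good[OF L K(1)] .
  have dK: "dual K \<inter> K = {}" "dual K \<in> L" using dual_disjoint[OF gK] lam_dual[OF L K(1)] by blast+
  have KS: "K \<subseteq> S1" "dual K \<subseteq> S1" using good_subset_S1 gK good_dual by blast+
  have orb: "(g ^^ n) x \<in> S1" for n using circle_autD[OF circle_aut_pow[OF c]] x by blast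
  \<comment> \<open>If \<open>g\<close> expanded \<open>K\<close>, the orbit of \<open>x\<close>
    would be trapped outside, although it converges to a point of \<open>K\<close>.\<close>
  have "\<not> K \<subseteq> g ` K"
  proof
    assume "K \<subseteq> g ` K"
    then have hK: "h ` K \<subseteq> K" using aut_image_image[OF c KS(1)] by (metis image_mono)
    have "(g ^^ n) x \<notin> K" for n
    proof (induction n)
      case 0
      then show ?case using K dK by auto
    next
      case (Suc n)
      have "h ((g ^^ Suc n) x) = (g ^^ n) x" using circle_autD(3)[OF c orb] by simp
      then show ?case using Suc hK by (metis image_subset_iff)
    qed
    moreover have "\<exists>N. \<forall>n\<ge>N. (g ^^ n) x \<in> K" by (rule orbit_enters[OF gK K(2) orb x(3)])
    ultimately show False by blast
  qed
  moreover have "g ` K \<inter> K \<noteq> {}" using K S by (metis IntI empty_iff image_eqI)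
  moreover have "\<not> dual (g ` K) \<subseteq> K"
    unfolding aut_image_dual[OF c gK, symmetric] using K S dK(1) by (metis IntI empty_iff image_subset_iff insert_subset)
  ultimately have gKK: "g ` K \<subseteq> K" using noncross[OF L lam_aut_mem[OF a K(1)] K(1)] by blast
  have dKg: "dual K \<subseteq> g ` dual K"
    unfolding aut_image_dual[OF c gK] using dual_mono[OF aut_image_good[OF c gK] gK gKK] .
  obtain V where V: "V \<in> L \<and> g ` V = V \<or> V = S1 - {p}" "dual K \<subseteq> V" "p \<notin> V"
    "\<And>x. x \<in> Fix g \<Longrightarrow> x \<in> V \<Longrightarrow> x \<in> dual K" "\<And>x n. x \<in> dual K \<Longrightarrow> (g ^^ n) x \<in> V"
    by (rule orbit_union[OF L a dK(2) dKg p]) (use K dK in blast)+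
  \<comment> \<open>\<open>V\<close> contains the orbit of \<open>x\<close>, which converges to
    \<open>p\<close>. A side of a leaf that avoids \<open>p\<close> would therefore end at
    \<open>p\<close>, but rainbow points are not endpoints.\<close>
  have "V \<notin> L"
  proof
    assume VL: "V \<in> L"
    have "(g ^^ n) x \<in> V" for n using V(5)[of x n] K(3) by simp
    then have "p \<in> closure V"
      unfolding closure_sequential using x(3) by (intro exI[of _ "\<lambda>n. (g ^^ n) x"]) simp
    then have "p \<in> vertices (leaf V)" using closure_good lam_good[OF L VL] V(3) by blast
    then show False using pe endpoints_leafI[OF VL] by blast
  qed
  then have V': "V = S1 - {p}" using V(1) by blast
  then have fixd: "y \<in> dual K" if "y \<in> Fix g" "y \<noteq> p" for y using V(4)[of y] that Fix_S1 by blast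
  have FK: "K \<inter> Fix g = {p}" using fixd K p dK by blast
  obtain u v where uv: "K = open_arc u v" "u \<in> S1" "v \<in> S1" "u \<noteq> v" using lam_arcE[OF L K(1)] by metis
  have att: "attracting g p" unfolding attracting_def
  proof (intro exI[of _ K] conjI gK FK)
    have duv: "dual K = open_arc v u" using dual_open_arc uv by simp
    have "u \<notin> Fix g" "v \<notin> Fix g"
      using fixd[of u] fixd[of v] duv open_arc_ends[of v u] open_arc_ends[of u v] K uv by blast+
    then have "g u \<in> K" "g v \<in> K" using aut_subarc_ends[OF c, of u v] gK gKK uv by (auto simp: Fix_def)
    then show "g ` closure K \<subseteq> K" using closure_open_arc[OF uv(2-4)] gKK uv(1) by auto
  qed
  have KhK: "K \<subseteq> h ` K" using gKK aut_image_image[OF c KS(1)] by (metis image_mono)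
  have q': "q \<in> Fix h" "q \<notin> K" using q Fix_inverse[OF c] K dK by auto
  \<comment> \<open>Backward images of \<open>K\<close> fill either everything but \<open>q\<close>,
    leaving two fixed points, or an invariant side, whose ends are fixed.\<close>
  obtain U where U: "U \<in> L \<and> h ` U = U \<or> U = S1 - {q}" "K \<subseteq> U" 
    "\<And>x. x \<in> Fix h \<Longrightarrow> x \<in> U \<Longrightarrow> x \<in> K"
    by (rule orbit_union[OF L lam_aut_sym[OF a] K(1) KhK q']) blast
  have FU: "U \<inter> Fix g = {p}" using U(2,3) FK Fix_inverse[OF c] K p by blast
  show ?thesis
  proof (intro conjI att)
    from U(1) show "Fix g = {p, q} \<or>
      (\<exists>b d. open_arc b d \<in> L \<and> open_arc b d \<inter> Fix g = {p} \<and> b \<in> Fix g \<and> d \<in> Fix g)"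
    proof
      assume u: "U \<in> L \<and> h ` U = U"
      obtain b d where bd: "U = open_arc b d" using lam_arcE[OF L] u by metis
      then have "b \<in> Fix h" "d \<in> Fix h" using arc_fixed_ends[OF c', of b d] u lam_good[OF L] by blast+
      then show ?thesis using u bd FU Fix_inverse[OF c] by blast
    next
      assume "U = S1 - {q}"
      then have "Fix g = {p, q}" using FU p q Fix_S1 by blast
      then show ?thesis by blast
    qed
  qed
qed

text \<open>Otherwise \<open>p\<close> is the pivot of an invariant crown. The point
  \<open>d\<close> is one of its vertices or lies in a side, which is then invariant with fixed
  ends. Either way all \<open>t k\<close> are fixed, and they accumulate at \<open>p\<close> from
  both sides.\<close>

lemma rainbow_of_free_arc:
  assumes pf: "pseudo_fibered L M" and a: "lam_aut L g h" and p: "p \<in> Fix g" "p \<notin> endpoints L"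
    and d: "d \<in> Fix g" "d \<noteq> p" and free: "open_arc p d \<inter> Fix g = {} \<or> open_arc d p \<inter> Fix g = {}"
  shows "rainbow_point L p"
proof (rule ccontr)
  assume r: "\<not> rainbow_point L p"
  note L = pseudo_fiberedD(3)[OF pf] and c = lam_aut_circle[OF a]
  have S: "p \<in> S1" "d \<in> S1" "g d = d" using p d Fix_S1 by blast+
  obtain G t where G: "non_leaf_gap L G" "crown_enum L G p t"
    by (rule pivot_or_rainbow[OF pseudo_fiberedD(1)[OF pf] S(1) p(2) r])
  have gap: "gap L G" "enumerates t G" and V: "vertices G = range t \<union> {p}" using G(2) by (auto simp: crown_enum_def)
  have gG: "(`) g ` G = G" using gap_at_fixed_vertex[OF pf a G(1) p(1)] V by blast
  have "\<exists>j. t j \<in> Fix g"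
  proof (cases "d \<in> range t")
    case False
    then have "d \<notin> vertices G" using V d by blast
    then obtain j where j: "d \<in> open_arc (t j) (t (j + 1))"
      using S gap(2) by (auto simp: vertices_def enumerates_def)
    have in_G: "open_arc (t j) (t (j + 1)) \<in> G" using enumeratesD(1)[OF L gap] .
    then have "g ` open_arc (t j) (t (j + 1)) \<in> G" using gG by blast
    moreover have "d \<in> g ` open_arc (t j) (t (j + 1))" using j S by (metis image_eqI)
    ultimately have "g ` open_arc (t j) (t (j + 1)) = open_arc (t j) (t (j + 1))"
      using gap_disjoint[OF gap(1) _ in_G] j by blast
    then show ?thesis using arc_fixed_ends[OF c] lam_good[OF L gap_mem[OF gap(1) in_G]] by blast
  qed (use d in blast)
  then have "t k \<in> Fix g" for k using enumeration_fixed[OF pf a gap] by blast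
  then show False using crown_approaches_pivot[OF L G(2) S(2) d(2)] free by blast
qed

text \<open>A leaf at \<open>c\<close> must join the two fixed points. No non-leaf gap borders it
  inside \<open>I\<close>, since the further vertices would be fixed too; so sides exhaust
  \<open>I\<close> from inside. One of them containing both \<open>x\<close> and \<open>g x\<close>
  is nested with its image. An orbit kept in it converges to \<open>c\<close> or \<open>d\<close>,
  so this smaller side has a fixed end and then both ends fixed, which is impossible.\<close>

lemma no_isolated_fixed_pair:
  assumes pf: "pseudo_fibered L M" and a: "lam_aut L g h" and F: "Fix g = {c, d}" "c \<noteq> d"
  shows "c \<notin> endpoints L"
proof
  assume ce: "c \<in> endpoints L"
  note L = pseudo_fiberedD(3)[OF pf] and ca = lam_aut_circle[OF a]
  obtain x where x: "open_arc c x \<in> L" using endpoints_iff[OF L] ce by blast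
  have cF: "c \<in> Fix g" "d \<in> Fix g" using F by auto
  have "x \<in> Fix g" using leaf_fixed[OF pf a cF(1) x] .
  then have "x = d" using F lam_arcD[OF L x] by auto
  define I where "I = open_arc c d"
  have IL: "I \<in> L" using x \<open>x = d\<close> by (simp add: I_def)
  have gI: "good_interval I" using lam_good[OF L IL] .
  have S: "c \<in> S1" "d \<in> S1" "g c = c" "g d = d" using cF Fix_S1 by blast+
  have dI: "dual I = open_arc d c" using dual_open_arc S F by (simp add: I_def)
  have no: "dual I \<notin> H" if H: "non_leaf_gap L H" for H
  proof
    assume dH: "dual I \<in> H"
    have gap: "gap L H" using H by (simp add: non_leaf_gap_def)
    obtain t where t: "enumerates t H"
      using gap_cases[OF pseudo_fiberedD(1)[OF pf] gap] by (metis crown_enum_def)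
    obtain k where k: "dual I = open_arc (t k) (t (k + 1))" using dH t by (auto simp: enumerates_def)
    have tk: "d = t k" "c = t (k + 1)" using open_arc_inject[of d c "t k" "t (k + 1)"] k dI S F(2) by auto
    then have "t (k + 2) \<in> Fix g" using enumeration_fixed[OF pf a gap t, of k] cF by simp
    moreover have "t (k + 1) \<noteq> t (k + 2)" using enumeratesD(3)[OF L gap t, of "k + 1"] by (simp add: add.assoc)
    ultimately have "t (k + 2) = d" using F tk by auto
    moreover have "open_arc (t (k + 1)) (t (k + 2)) \<in> H"
      using enumeratesD(1)[OF L gap t, of "k + 1"] by (simp add: add.assoc)
    ultimately have "I \<in> H" using tk I_def by simp
    then have "H = leaf I" using gap_leaf_eq[OF L gap] dH by blast
    then show False using H IL unfolding non_leaf_gap_def by blast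
  qed
  obtain x where x: "x \<in> I" "\<Union>{K \<in> L. K \<subset> I \<and> x \<in> K} = I"
    by (rule gap_or_approx[OF L IL no])
  have imI: "g ` I = I" unfolding I_def using aut_image_arc[OF ca S(1,2)] S by simp
  have "g x \<in> I" using imI x by blast
  then obtain K where K: "K \<in> L" "K \<subset> I" "x \<in> K" "g x \<in> K" using x(2) by blast
  have free: "open_arc c d \<inter> Fix g = {}" using F open_arc_ends[of c d] by auto
  have orbits: "(\<lambda>n. (k ^^ n) x) \<longlonglongrightarrow> c \<or> (\<lambda>n. (k ^^ n) x) \<longlonglongrightarrow> d" if "k = g \<or> k = h" for k
    using orbits_on_free_arc[OF ca cF F(2) free] x(1) that unfolding I_def by (elim disjE) auto
  have bad: False if k: "k = g \<or> k = h" "k ` K \<subseteq> K" for k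
  proof -
    have orb: "(k ^^ n) x \<in> K" for n by (induction n) (use K k in auto)
    obtain e where e: "(\<lambda>n. (k ^^ n) x) \<longlonglongrightarrow> e" "e = c \<or> e = d"
      using orbits[OF k(1)] by blast
    have "e \<in> closure K"
      unfolding closure_sequential using orb e(1) by (intro exI[of _ "\<lambda>n. (k ^^ n) x"]) simp
    note e = this e(2)
    have "e \<notin> K" using e K open_arc_ends[of c d] unfolding I_def by blast
    then have ev: "e \<in> vertices (leaf K)" using closure_good lam_good[OF L K(1)] e by blast
    obtain u v where uv: "K = open_arc u v" "u \<in> S1" "v \<in> S1" "u \<noteq> v" using lam_arcE[OF L K(1)] by metis
    have "open_arc v u \<in> L" using lam_arc_swap[OF L] uv K by blast
    then have "u \<in> Fix g \<and> v \<in> Fix g"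
      using ev vertices_leaf[OF uv(2-4)] leaf_fixed[OF pf a, of u v] leaf_fixed[OF pf a, of v u] uv K e cF by auto
    then have "K = I \<or> K = dual I" using F uv dI I_def by auto
    then show False using K dual_disjoint[OF gI] good_nonempty[of "dual I"] gI by auto
  qed
  have "g x \<in> g ` K" using K by blast
  then have "g ` K \<subseteq> K \<or> K \<subseteq> g ` K"
    using nested_inside[OF L gI lam_aut_mem[OF a K(1)] _ K(1)] K imI by blast
  then show False
  proof
    assume "K \<subseteq> g ` K"
    then have "h ` K \<subseteq> K" using aut_image_image[OF ca good_subset_S1[OF lam_good[OF L K(1)]]] by (metis image_mono)
    then show False using bad by blast
  qed (use bad in blast)
qed

text \<open>Going clockwise from \<open>z\<close>, neither of \<open>b\<close> and \<open>c\<close>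
  is met strictly before the other. Used to identify two fixed points that are both nearest to
  \<open>z\<close>.\<close>

lemma arc_left_eq:
  assumes "z \<in> open_arc b s" "c \<notin> open_arc b s" "b \<notin> open_arc c z" "c \<in> S1" "z \<noteq> c"
  shows "b = c"
proof (rule ccontr)
  assume "b \<noteq> c"
  have S: "b \<in> S1" "s \<in> S1" "z \<in> S1" using open_arc_nonempty_D[OF assms(1)] by auto
  have "0 < ang c b" "0 < ang c z" using ang_pos assms S \<open>b \<noteq> c\<close> by auto
  moreover have "\<not> ang c b < ang c z" using assms S calculation by (auto simp: mem_open_arc0)
  moreover have "ang c s = 0 \<or> 0 < ang c s" using ang_ge0[of c s] by linarith
  ultimately show False using assms S by (auto simp: mem_open_arc[of c])
qed

lemma arc_right_eq:
  assumes "z \<in> open_arc s b" "c \<notin> open_arc s b" "b \<notin> open_arc z c" "c \<in> S1" "z \<noteq> c"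
  shows "b = c"
proof (rule ccontr)
  assume "b \<noteq> c"
  have S: "b \<in> S1" "s \<in> S1" "z \<in> S1" using open_arc_nonempty_D[OF assms(1)] by auto
  have "0 < ang c b" "0 < ang c z" using ang_pos assms S \<open>b \<noteq> c\<close> by auto
  moreover have "\<not> ang c z < ang c b" using assms S mem_open_arc1[of c z b] by auto
  moreover have "ang c s = 0 \<or> 0 < ang c s" using ang_ge0[of c s] by linarith
  ultimately show False using assms S by (auto simp: mem_open_arc[of c])
qed

text \<open>A backward orbit tending to \<open>p\<close> enters the attracting interval, which is
  forward invariant; so the forward orbit stays there and cannot tend to another fixed
  point.\<close>

lemma attracting_orbits:
  assumes c: "circle_aut g h" and att: "attracting g p" and d: "d \<in> Fix g" "d \<noteq> p" and x: "x \<in> S1"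
    and lim: "(\<lambda>n. (h ^^ n) x) \<longlonglongrightarrow> p" "(\<lambda>n. (g ^^ n) x) \<longlonglongrightarrow> d"
  shows False
proof -
  obtain I where I: "good_interval I" "I \<inter> Fix g = {p}" "g ` closure I \<subseteq> I"
    using att unfolding attracting_def by blast
  have hS: "(h ^^ n) x \<in> S1" for n using circle_autD[OF circle_aut_pow[OF c]] x by blast
  obtain N where "(h ^^ N) x \<in> I" using orbit_enters[OF I(1) _ hS lim(1)] I(2) by blast
  moreover have gI: "g ` I \<subseteq> I" using I(3) closure_subset by blast
  have "(g ^^ n) y \<in> I" if "y \<in> I" for n y by (induction n) (use that gI in auto)
  ultimately have "(g ^^ (n + N)) ((h ^^ N) x) \<in> I" for n by blast
  moreover have "(g ^^ (n + N)) ((h ^^ N) x) = (g ^^ n) x" for n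
    using circle_autD(4)[OF circle_aut_pow[OF c] x] by (simp add: funpow_add)
  ultimately have "(g ^^ n) x \<in> I" for n by metis
  then have "d \<in> closure I"
    unfolding closure_sequential using lim(2) by (intro exI[of _ "\<lambda>n. (g ^^ n) x"]) simp
  then have "g d \<in> I" using I(3) by blast
  then have "d \<in> I \<inter> Fix g" using d Fix_S1 by (metis IntI)
  then show False using I(2) d by blast
qed

text \<open>The isolating interval supplies points just after \<open>p\<close> that are not fixed;
  the free arc around such a point begins at \<open>p\<close>.\<close>

lemma free_arc_at_attracting:
  assumes c: "circle_aut g h" and att: "attracting g p" and q: "q \<in> Fix g" "q \<noteq> p"
  obtains d where "d \<in> Fix g" "d \<noteq> p" "open_arc p d \<inter> Fix g = {}"
proof -
  obtain I where I: "good_interval I" "I \<inter> Fix g = {p}"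
    using att unfolding attracting_def by blast
  obtain u v where uv: "I = open_arc u v" "u \<in> S1" "v \<in> S1" "u \<noteq> v" using good_intervalE[OF I(1)] by metis
  have p: "p \<in> I" "p \<in> Fix g" using I by auto
  have pS: "p \<in> S1" using p Fix_S1 by blast
  have "v \<noteq> p" using p uv open_arc_ends by blast
  then obtain x where x: "x \<in> open_arc p v" using open_arc_nonempty pS uv by metis
  have sub: "open_arc p v \<subseteq> I" using open_arc_subarc(2)[of p u v] p uv by blast
  have pv: "p \<notin> open_arc p v" using open_arc_ends by blast
  have xI: "x \<in> I" "x \<noteq> p" "x \<in> S1" using x sub pv open_arc_subset_S1 by blast+
  then have "x \<notin> Fix g" using I(2) by blast
  then obtain b d where b: "b \<in> Fix g" "d \<in> Fix g" "b \<noteq> d" "x \<in> open_arc b d" "open_arc b d \<inter> Fix g = {}"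
    using free_arc_around[OF c xI(3) _ p(2) q(1)] q(2) by metis
  have "b \<notin> open_arc p x"
  proof
    assume "b \<in> open_arc p x"
    then have bv: "b \<in> open_arc p v" using open_arc_subarc(1)[OF x] by blast
    then have "b \<in> I \<inter> Fix g" using b(1) sub by blast
    then show False using bv pv unfolding I(2) by simp
  qed
  moreover have "p \<notin> open_arc b d" using p b(5) by blast
  ultimately have "b = p" using arc_left_eq[OF b(4)] pS xI by blast
  then show thesis using that b by metis
qed

section \<open>Alternation of attracting and repelling fixed endpoints, and the gaps they
  span\<close>

lemma subset_singleton_free: "A \<subseteq> B \<Longrightarrow> B \<inter> F = {x} \<Longrightarrow> x \<notin> A \<Longrightarrow> A \<inter> F = {}"
  by (auto dest!: equalityD1)

text \<open>An attracting endpoint \<open>p\<close> of \<open>L\<close> is a rainbow point of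
  \<open>M\<close>, and \<open>no_isolated_fixed_pair\<close> excludes that only two points are
  fixed; so a leaf of \<open>M\<close> with fixed ends encloses \<open>p\<close> alone. These ends
  are endpoints of \<open>M\<close>, hence rainbow points of \<open>L\<close>, and the orbits in
  between flow away from them.\<close>

lemma attracting_neighbours:
  assumes pf: "pseudo_fibered L M" and a: "lam_aut L g h" "lam_aut M g h"
    and p: "p \<in> endpoints L" "attracting g p" and q: "q \<in> Fix g" "q \<noteq> p"
  obtains b d where "open_arc b d \<in> M" "open_arc b d \<inter> Fix g = {p}" "b \<in> Fix g" "d \<in> Fix g"
    "attracting h b" "attracting h d"
proof -
  note c = lam_aut_circle[OF a(1)] and L = pseudo_fiberedD(3)[OF pf] and M = pseudo_fiberedD(4)[OF pf]
  note pf' = pseudo_fibered_sym[OF pf]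
  have pF: "p \<in> Fix g" using p(2) unfolding attracting_def by blast
  have pM: "p \<notin> endpoints M" using pseudo_fiberedD(5)[OF pf p(1)] .
  have pS: "p \<in> S1" using pF Fix_S1 by blast
  have toward: "(\<lambda>n. (g ^^ n) x) \<longlonglongrightarrow> p \<and> (\<lambda>n. (h ^^ n) x) \<longlonglongrightarrow> e"
    if e: "e \<in> Fix g" "e \<noteq> p" and A: "A = open_arc p e \<or> A = open_arc e p" "A \<inter> Fix g = {}" and x: "x \<in> A" for e A x
  proof -
    have xS: "x \<in> S1" using x A(1) open_arc_subset_S1 by blast
    have "((\<lambda>n. (g ^^ n) x) \<longlonglongrightarrow> p \<and> (\<lambda>n. (h ^^ n) x) \<longlonglongrightarrow> e) \<or>
        ((\<lambda>n. (g ^^ n) x) \<longlonglongrightarrow> e \<and> (\<lambda>n. (h ^^ n) x) \<longlonglongrightarrow> p)"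
      using A(1)
    proof
      assume "A = open_arc p e"
      then show ?thesis using orbits_on_free_arc[OF c pF e(1)] e(2) A(2) x by blast
    next
      assume "A = open_arc e p"
      then show ?thesis using orbits_on_free_arc[OF c e(1) pF e(2)] A(2) x by blast
    qed
    then show ?thesis using attracting_orbits[OF c p(2) e xS] by blast
  qed
  obtain d where d: "d \<in> Fix g" "d \<noteq> p" "open_arc p d \<inter> Fix g = {}"
    by (rule free_arc_at_attracting[OF c p(2) q])
  have "p \<noteq> d" using d by blast
  obtain x where x: "x \<in> open_arc p d" using open_arc_nonempty[OF pS _ \<open>p \<noteq> d\<close>] d Fix_S1 by blast
  have xS: "x \<in> S1" "x \<noteq> p" using x open_arc_subset_S1 open_arc_ends by blast+
  have "rainbow_point M p" using rainbow_of_free_arc[OF pf' a(2) pF pM d(1,2)] d(3) by blast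
  from rainbow_attracting[OF M a(2) this pF d(1) \<open>p \<noteq> d\<close> xS] toward[OF d(1,2) _ d(3) x]
  have "Fix g = {p, d} \<or> (\<exists>b d. open_arc b d \<in> M \<and> open_arc b d \<inter> Fix g = {p} \<and> b \<in> Fix g \<and> d \<in> Fix g)"
    by blast
  then obtain b e where be: "open_arc b e \<in> M" "open_arc b e \<inter> Fix g = {p}" "b \<in> Fix g" "e \<in> Fix g"
    using no_isolated_fixed_pair[OF pf a(1) _ \<open>p \<noteq> d\<close>] p(1) by blast
  have pbe: "p \<in> open_arc b e" using be by blast
  note sub = open_arc_subarc[OF pbe]
  have att: "attracting h y"
    if y: "y \<in> Fix g" "y \<in> endpoints M" "y \<noteq> p" and A: "A = open_arc p y \<or> A = open_arc y p" "A \<inter> Fix g = {}" for y A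
  proof -
    have yL: "y \<notin> endpoints L" using pseudo_fiberedD(5)[OF pf'] y by blast
    have yS: "y \<in> S1" using y Fix_S1 by blast
    have r: "rainbow_point L y"
      using rainbow_of_free_arc[OF pf a(1) y(1) yL pF] A y(3) by blast
    have "A \<noteq> {}" using A(1) y(3) yS pS open_arc_nonempty by (metis emptyE)
    then obtain z where z: "z \<in> A" by blast
    then have zS: "z \<in> S1" "z \<noteq> y" using A(1) open_arc_subset_S1 open_arc_ends by blast+
    have "(\<lambda>n. (h ^^ n) z) \<longlonglongrightarrow> y" using toward[OF y(1,3) A z] by blast
    then show ?thesis
      using rainbow_attracting[OF L lam_aut_sym[OF a(1)] r _ _ y(3) zS] y(1) pF Fix_inverse[OF c] by blast
  qed
  have ne: "b \<noteq> p" "e \<noteq> p" using pbe open_arc_ends by blast+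
  have free: "open_arc b p \<inter> Fix g = {}" "open_arc p e \<inter> Fix g = {}"
    using subset_singleton_free[OF sub(1) be(2) sub(3)] subset_singleton_free[OF sub(2) be(2) sub(4)] by simp_all
  have "attracting h b" using att[OF be(3) endpointsI(1)[OF M be(1)] ne(1) _ free(1)] by blast
  moreover have "attracting h e" using att[OF be(4) endpointsI(2)[OF M be(1)] ne(2) _ free(2)] by blast
  ultimately show thesis using that be by blast
qed

text \<open>Two alternations lead back to \<open>L\<close>: from \<open>p\<close> to a repelling
  neighbour in \<open>M\<close>, and from there on with laminations and time exchanged. The leaf of
  \<open>L\<close> around that neighbour has \<open>p\<close> as its near end, because both are its
  closest fixed point on that side.\<close>

lemma attracting_leaf_step:
  assumes pf: "pseudo_fibered L M" and a: "lam_aut L g h" "lam_aut M g h"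
    and p: "p \<in> endpoints L" "attracting g p" and q: "q \<in> Fix g" "q \<noteq> p"
  shows "\<exists>s d. open_arc p s \<in> L \<and> open_arc p s \<inter> Fix g = {d} \<and> d \<in> endpoints M \<and> attracting g s"
    and "\<exists>s d. open_arc s p \<in> L \<and> open_arc s p \<inter> Fix g = {d} \<and> d \<in> endpoints M \<and> attracting g s"
proof -
  note c = lam_aut_circle[OF a(1)] and M = pseudo_fiberedD(4)[OF pf]
  note pf' = pseudo_fibered_sym[OF pf] and F = Fix_inverse[OF c]
  have pF: "p \<in> Fix g" using p(2) unfolding attracting_def by blast
  have pS: "p \<in> S1" using pF Fix_S1 by blast
  obtain b d where bd: "open_arc b d \<in> M" "open_arc b d \<inter> Fix g = {p}" "b \<in> Fix g" "d \<in> Fix g"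
    "attracting h b" "attracting h d"
    by (rule attracting_neighbours[OF pf a p q])
  have pbd: "p \<in> open_arc b d" using bd by blast
  note sub = open_arc_subarc[OF pbd]
  have ne: "b \<noteq> p" "d \<noteq> p" using pbd open_arc_ends by blast+
  show "\<exists>s d. open_arc p s \<in> L \<and> open_arc p s \<inter> Fix g = {d} \<and> d \<in> endpoints M \<and> attracting g s"
  proof -
    have dM: "d \<in> endpoints M" using endpointsI[OF M bd(1)] by blast
    obtain b' s where s: "open_arc b' s \<in> L" "open_arc b' s \<inter> Fix h = {d}" "b' \<in> Fix h" "attracting g s"
      using attracting_neighbours[OF pf' lam_aut_sym[OF a(2)] lam_aut_sym[OF a(1)] dM bd(6)] F pF ne by metis
    have "d \<in> open_arc b' s" "b' \<in> Fix g" using s(2,3) F by blast+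
    moreover have "p \<notin> open_arc b' s" using s(2) pF ne(2) F by auto
    moreover have "open_arc p d \<inter> Fix g = {}" using subset_singleton_free[OF sub(2) bd(2) sub(4)] .
    ultimately have "b' = p" using arc_left_eq[of d b' s p] pS ne(2) by blast
    then show ?thesis using s F dM by blast
  qed
  show "\<exists>s d. open_arc s p \<in> L \<and> open_arc s p \<inter> Fix g = {d} \<and> d \<in> endpoints M \<and> attracting g s"
  proof -
    have bM: "b \<in> endpoints M" using endpointsI[OF M bd(1)] by blast
    obtain s b' where s: "open_arc s b' \<in> L" "open_arc s b' \<inter> Fix h = {b}" "b' \<in> Fix h" "attracting g s"
      using attracting_neighbours[OF pf' lam_aut_sym[OF a(2)] lam_aut_sym[OF a(1)] bM bd(5)] F pF ne by metis
    have "b \<in> open_arc s b'" "b' \<in> Fix g" using s(2,3) F by blast+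
    moreover have "p \<notin> open_arc s b'" using s(2) pF ne(1) F by auto
    moreover have "open_arc b p \<inter> Fix g = {}" using subset_singleton_free[OF sub(1) bd(2) sub(3)] .
    ultimately have "b' = p" using arc_right_eq[of b s b' p] pS ne(1) by blast
    then show ?thesis using s F bM by blast
  qed
qed

text \<open>Such a leaf would lie on a side of the crown and, as \<open>p\<close> is not inside that
  side, share the end \<open>p\<close> with it; but the ends of sides are the
  \<open>t k\<close>.\<close>

lemma pivot_not_endpoint:
  assumes L: "lamination_system L" and G: "crown_enum L G p t" shows "p \<notin> endpoints L"
proof
  assume "p \<in> endpoints L"
  then obtain x where x: "open_arc p x \<in> L" using endpoints_iff[OF L] by blast
  have S: "p \<in> S1" "x \<in> S1" "p \<noteq> x" using lam_arcD[OF L x] by auto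
  have gap: "gap L G" "enumerates t G" using G by (auto simp: crown_enum_def)
  have "\<exists>J\<in>G. lies_on (open_arc p x) J" using gap(1) x unfolding gap_def by blast
  then obtain k where k: "open_arc p x \<subseteq> open_arc (t k) (t (k + 1)) \<or> open_arc x p \<subseteq> open_arc (t k) (t (k + 1))"
    using gap(2) dual_open_arc[OF S] by (auto simp: enumerates_def lies_on_def)
  have "p \<notin> open_arc (t k) (t (k + 1))"
    using enumeratesD(1)[OF L gap, of k] G by (auto simp: crown_enum_def vertices_def)
  then show False using k open_arc_subset_ends[of p x "t k" "t (k + 1)"]
      open_arc_subset_ends[of x p "t k" "t (k + 1)"] S G by (auto simp: crown_enum_def)
qed

lemma open_contains_arc:
  assumes "open T" "p \<in> T" "p \<in> S1" obtains d where "d \<in> S1" "d \<noteq> p" "open_arc p d \<subseteq> T"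
proof -
  have "open ((\<lambda>t. p * cis t) -` T)"
    using assms(1) continuous_on_mult_cis[of UNIV p] by (simp add: continuous_on_open_vimage)
  moreover have "0 \<in> (\<lambda>t. p * cis t) -` T" using assms(2) by simp
  ultimately obtain e where e: "e > 0" "ball 0 e \<subseteq> (\<lambda>t. p * cis t) -` T" using openE by blast
  define s where "s = min e 1"
  have s: "0 < s" "s \<le> e" "s < 2 * pi" using e pi_gt3 by (auto simp: s_def)
  have d: "ang p (p * cis s) = s" using ang_mult_cis s assms by simp
  have "open_arc p (p * cis s) \<subseteq> T"
  proof
    fix z assume "z \<in> open_arc p (p * cis s)"
    then have z: "z \<in> S1" "0 < ang p z" "ang p z < s" using assms d by (auto simp: mem_open_arc0)
    then have "p * cis (ang p z) \<in> T" using e(2) s by (auto simp: subset_iff)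
    then show "z \<in> T" using ang_eq assms z by metis
  qed
  moreover have "p * cis s \<noteq> p" using d s assms by auto
  ultimately show thesis using that mult_cis_S1[OF assms(3)] by blast
qed

text \<open>Only the pivot has to be excluded, and the other vertices accumulate at it.\<close>

lemma tip_crown:
  assumes L: "lamination_system L" and G: "crown_enum L G p t" and x: "tip G x" shows "x \<in> range t"
proof (rule ccontr)
  assume n: "x \<notin> range t"
  have V: "vertices G = range t \<union> {p}" "p \<notin> range t" using G by (auto simp: crown_enum_def)
  have xv: "x \<in> vertices G" "\<exists>T. open T \<and> T \<inter> vertices G = {x}"
    using x unfolding tip_def isolated_in_def by (auto simp: Int_commute)
  then have "x = p" using n V by blast
  obtain T where T: "open T" "T \<inter> vertices G = {p}" using xv \<open>x = p\<close> by blast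
  have "p \<in> T" using T(2) by blast
  then obtain d where d: "d \<in> S1" "d \<noteq> p" "open_arc p d \<subseteq> T"
    using open_contains_arc[OF T(1) _ crown_pivot_S1[OF G]] by metis
  obtain k where "t k \<in> open_arc p d" using crown_approaches_pivot[OF L G d(1,2)] by blast
  then have "t k \<in> T \<inter> vertices G" using d(3) V(1) by auto
  then show False using V(2) unfolding T(2) by auto
qed

text \<open>The last clause pins the gap down: the single fixed point in a side belongs to the other
  lamination. It makes the gap depend on the fixed set only, and makes such gaps of \<open>L\<close>
  and \<open>M\<close> interleave. Saturation is included for the sake of realness.\<close>

definition fixed_gap :: "complex set set \<Rightarrow> complex set set \<Rightarrow> (complex \<Rightarrow> complex) \<Rightarrow> complex set set \<Rightarrow> bool" where
  "fixed_gap L M g G \<longleftrightarrow> sat_gap L G \<and> (\<forall>I\<in>G. g ` I = I) \<and> vertices G \<subseteq> Fix g \<and>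
     (\<forall>I\<in>G. \<exists>d\<in>endpoints M. I \<inter> Fix g = {d})"

text \<open>A saturated gap at \<open>p\<close> is walked along in both directions. The leaf
  supplied by \<open>attracting_leaf_step\<close> must bound its next side: two different leaves at
  one vertex form a wedge, a non-leaf gap across a side of a saturated gap.\<close>

lemma attracting_gap:
  assumes pf: "pseudo_fibered L M" and a: "lam_aut L g h" "lam_aut M g h"
    and p: "p \<in> endpoints L" "attracting g p" and q: "q \<in> Fix g" "q \<noteq> p"
  obtains G where "fixed_gap L M g G" "\<And>x. tip G x \<Longrightarrow> attracting g x"
proof -
  note c = lam_aut_circle[OF a(1)] and L = pseudo_fiberedD(3)[OF pf] and M = pseudo_fiberedD(4)[OF pf]
  obtain G where sat: "sat_gap L G" and pG: "p \<in> vertices G" by (rule sat_gap_exists[OF pf p(1)])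
  have gap: "gap L G" using sat by (simp add: sat_gap_def)
  obtain t where t: "enumerates t G" and
    V: "vertices G = range t \<or> (\<exists>r. crown_enum L G r t)"
    using gap_cases[OF pseudo_fiberedD(1)[OF pf] gap] by (metis crown_enum_def)
  have pt: "p \<in> range t" using V pG p(1) pivot_not_endpoint[OF L] by (auto simp: crown_enum_def)
  then obtain j where j: "p = t j" by blast
  note tD = enumeratesD[OF L gap t]
  have pF: "p \<in> Fix g" using p(2) unfolding attracting_def by blast
  have tF: "t k \<in> Fix g" for k using enumeration_fixed[OF pf a(1) gap t] pF j by blast
  have tS: "t k \<in> S1" for k using tD(2) .
  have arcL: "open_arc (t k) (t (k + 1)) \<in> L" "open_arc (t (k + 1)) (t k) \<in> L" for k
    using gap_mem[OF gap tD(1)] lam_arc_swap[OF L] by blast+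
  have sat': "open_arc (t (k + 1)) (t k) \<notin> H" if "non_leaf_gap L H" for H k
    using sat tD(1)[of k] that dual_open_arc[OF tS tS tD(3), of k] unfolding sat_gap_def by metis
  have other: "\<exists>r. r \<in> Fix g \<and> r \<noteq> t k" for k
    using tF[of "k + 1"] tD(3)[of k] by metis
  have EM: "t k \<notin> endpoints M" for k using pseudo_fiberedD(5)[OF pf tD(4)] .
  have up: "attracting g (t (k + 1)) \<and> (\<exists>d\<in>endpoints M. open_arc (t k) (t (k + 1)) \<inter> Fix g = {d})"
    if k: "attracting g (t k)" for k
  proof -
    obtain r where "r \<in> Fix g" "r \<noteq> t k" using other by blast
    then obtain s d where s: "open_arc (t k) s \<in> L" "open_arc (t k) s \<inter> Fix g = {d}" "d \<in> endpoints M" "attracting g s"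
      using attracting_leaf_step(1)[OF pf a tD(4) k] by blast
    have sS: "s \<in> S1" "s \<noteq> t k" using lam_arcD[OF L s(1)] by auto
    have "s = t (k + 1)"
    proof (rule ccontr)
      assume n: "s \<noteq> t (k + 1)"
      \<comment> \<open>The only fixed point in this arc is an endpoint of \<open>M\<close>, so the
        fixed vertex \<open>t (k + 1)\<close> is not inside it.\<close>
      have "t (k + 1) \<noteq> d" using s(3) EM[of "k + 1"] by auto
      then have "t (k + 1) \<notin> open_arc (t k) s" using s(2) tF[of "k + 1"] by auto
      then have "ang (t k) s \<le> ang (t k) (t (k + 1))"
        using mem_open_arc0[OF tS] sS tS[of "k + 1"] ang_pos[OF tS[of k] tS[of "k + 1"]] tD(3)[of k] by fastforce
      then have "ang (t k) s < ang (t k) (t (k + 1))" using n ang_inj[OF tS[of k] sS(1) tS[of "k + 1"]] by (auto simp: order_le_less)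
      then obtain H where "non_leaf_gap L H" "open_arc (t (k + 1)) (t k) \<in> H"
        using wedge[OF pf s(1) arcL(1)] by metis
      then show False using sat' by blast
    qed
    then show ?thesis using s by blast
  qed
  have down: "attracting g (t k)" if k: "attracting g (t (k + 1))" for k
  proof -
    obtain r where "r \<in> Fix g" "r \<noteq> t (k + 1)" using other by blast
    then obtain s d where s: "open_arc s (t (k + 1)) \<in> L" "open_arc s (t (k + 1)) \<inter> Fix g = {d}" "d \<in> endpoints M" "attracting g s"
      using attracting_leaf_step(2)[OF pf a tD(4) k] by blast
    have sS: "s \<in> S1" "s \<noteq> t (k + 1)" using lam_arcD[OF L s(1)] by auto
    have "s = t k"
    proof (rule ccontr)
      assume n: "s \<noteq> t k"
      have "t k \<noteq> d" using s(3) EM[of k] by auto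
      then have "t k \<notin> open_arc s (t (k + 1))" using s(2) tF[of k] by auto
      then have "ang (t (k + 1)) (t k) \<le> ang (t (k + 1)) s"
        using mem_open_arc1[OF tS[of "k + 1"] sS(1)] sS tS[of k] by fastforce
      then have "ang (t (k + 1)) (t k) < ang (t (k + 1)) s" using n ang_inj[OF tS[of "k + 1"] sS(1) tS[of k]] by (auto simp: order_le_less)
      then obtain H where "non_leaf_gap L H" "open_arc (t (k + 1)) (t k) \<in> H"
        using wedge[OF pf arcL(2) lam_arc_swap[OF L s(1)]] by metis
      then show False using sat' by blast
    qed
    then show ?thesis using s by blast
  qed
  have att: "attracting g (t k)" for k
  proof (induction k rule: int_induct[of _ j])
    case base
    then show ?case using p(2) j by simp
  next
    case (step1 i)
    then show ?case using up by blast
  next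
    case (step2 i)
    then show ?case using down[of "i - 1"] by simp
  qed
  have imI: "g ` I = I" if "I \<in> G" for I
  proof -
    obtain k where k: "I = open_arc (t k) (t (k + 1))" using \<open>I \<in> G\<close> t by (auto simp: enumerates_def)
    have "g (t k) = t k" "g (t (k + 1)) = t (k + 1)" using tF Fix_S1 by blast+
    then show ?thesis using aut_image_arc[OF c tS tS, of k "k + 1"] k by simp
  qed
  have VF: "vertices G \<subseteq> Fix g"
  proof (cases "vertices G = range t")
    case True
    then show ?thesis using tF by auto
  next
    case False
    then obtain r where r: "crown_enum L G r t" using V by blast
    then have r': "vertices G = range t \<union> {r}" "r \<notin> range t" by (auto simp: crown_enum_def)
    have rS: "r \<in> S1" using crown_pivot_S1[OF r] .
    \<comment> \<open>The vertex set is invariant and all its points but the pivot are fixed, so the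
      pivot is fixed too.\<close>
    have "(`) g ` G = G" using imI by force
    then have "g ` vertices G = vertices G" using gap_image(2)[OF L a(1) gap] by simp
    then have "g r \<in> range t \<union> {r}" using r' by blast
    moreover have "g r \<notin> range t"
    proof
      assume "g r \<in> range t"
      then obtain k where "g r = t k" by blast
      then have "g r = g (t k)" using tF Fix_S1 by metis
      then have "r = t k" using circle_aut_eq_iff[OF c rS tS] by blast
      then show False using r' by blast
    qed
    ultimately have "r \<in> Fix g" using rS by (auto simp: Fix_def)
    then show ?thesis using r' tF by auto
  qed
  have "\<exists>d\<in>endpoints M. I \<inter> Fix g = {d}" if "I \<in> G" for I
  proof -
    obtain k where "I = open_arc (t k) (t (k + 1))" using \<open>I \<in> G\<close> t by (auto simp: enumerates_def)
    then show ?thesis using up[OF att[of k]] by simp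
  qed
  then have "fixed_gap L M g G" using sat imI VF by (simp add: fixed_gap_def)
  moreover have "attracting g x" if "tip G x" for x
  proof -
    have "x \<in> range t"
      using V
    proof
      assume "vertices G = range t"
      then show ?thesis using that by (simp add: tip_def isolated_in_def)
    next
      assume "\<exists>r. crown_enum L G r t"
      then show ?thesis using tip_crown[OF L _ that] by blast
    qed
    then show ?thesis using att by auto
  qed
  ultimately show thesis using that by blast
qed

text \<open>The four instances under exchange of \<open>L\<close> with \<open>M\<close> and of
  \<open>g\<close> with \<open>h\<close> cover all ways in which a fixed endpoint can arise.\<close>

definition pA_gaps where
  "pA_gaps L M g h \<longleftrightarrow> (\<exists>G1 G2. fixed_gap L M g G1 \<and> fixed_gap M L g G2 \<and>
     (\<forall>x. tip G1 x \<longrightarrow> attracting g x) \<and> (\<forall>x. tip G2 x \<longrightarrow> attracting h x))"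

lemma fixed_gap_inverse:
  assumes "lamination_system L" "circle_aut g h" "fixed_gap L M h G" shows "fixed_gap L M g G"
proof -
  have F: "Fix h = Fix g" using Fix_inverse assms(2) by blast
  have "g ` I = I" if "I \<in> G" for I
  proof -
    have "gap L G" "h ` I = I" using assms(3) that by (auto simp: fixed_gap_def sat_gap_def)
    moreover from this have "I \<subseteq> S1"
      using good_subset_S1[OF lam_good[OF assms(1) gap_mem]] that by blast
    ultimately have "h ` I = I" "I \<subseteq> S1" by blast+
    then show ?thesis using aut_image_image[OF circle_aut_sym[OF assms(2)], of I] by simp
  qed
  then show ?thesis using assms(3) F by (simp add: fixed_gap_def)
qed

text \<open>One gap is spanned by attracting endpoints from \<open>p\<close> on, the other one, for
  the inverse, from a repelling neighbour of \<open>p\<close> in \<open>M\<close>.\<close>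

lemma pA_gaps_attracting:
  assumes pf: "pseudo_fibered L M" and a: "lam_aut L g h" "lam_aut M g h"
    and p: "p \<in> endpoints L" "attracting g p" and q: "q \<in> Fix g" "q \<noteq> p"
  shows "pA_gaps L M g h"
proof -
  note c = lam_aut_circle[OF a(1)] and M = pseudo_fiberedD(4)[OF pf]
  have pF: "p \<in> Fix g" using p(2) unfolding attracting_def by blast
  obtain G1 where G1: "fixed_gap L M g G1" "\<And>x. tip G1 x \<Longrightarrow> attracting g x"
    by (rule attracting_gap[OF pf a p q]) blast
  obtain b d where bd: "open_arc b d \<in> M" "open_arc b d \<inter> Fix g = {p}" "attracting h d"
    using attracting_neighbours[OF pf a p q] by metis
  have dM: "d \<in> endpoints M" using endpointsI[OF M bd(1)] by blast
  have "p \<in> Fix h" "p \<noteq> d" using pF Fix_inverse[OF c] bd(2) open_arc_ends[of b d] by blast+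
  then obtain G2 where G2: "fixed_gap M L h G2" "\<And>x. tip G2 x \<Longrightarrow> attracting h x"
    using attracting_gap[OF pseudo_fibered_sym[OF pf] lam_aut_sym[OF a(2)] lam_aut_sym[OF a(1)] dM bd(3)] by metis
  then show ?thesis unfolding pA_gaps_def using G1 fixed_gap_inverse[OF M c] by blast
qed

section \<open>Two fixed points: hyperbolic or pseudo-Anosov dynamics\<close>

lemma pA_gaps_free_arc:
  assumes pf: "pseudo_fibered L M" and a: "lam_aut L g h" "lam_aut M g h"
    and p: "p \<in> endpoints L" "p \<in> Fix g" and d: "d \<in> Fix g" "d \<noteq> p"
    and A: "A = open_arc p d \<or> A = open_arc d p" "A \<inter> Fix g = {}"
    and lim: "\<And>x. x \<in> A \<Longrightarrow> (\<lambda>n. (g ^^ n) x) \<longlonglongrightarrow> p"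
  shows "pA_gaps L M g h"
proof -
  note M = pseudo_fiberedD(4)[OF pf] and pf' = pseudo_fibered_sym[OF pf]
  have S: "p \<in> S1" "d \<in> S1" "p \<noteq> d" using p d Fix_S1 by blast+
  have "p \<notin> endpoints M" using pseudo_fiberedD(5)[OF pf p(1)] .
  then have r: "rainbow_point M p" using rainbow_of_free_arc[OF pf' a(2) p(2) _ d] A by blast
  have "A \<noteq> {}" using A(1) S open_arc_nonempty by (metis emptyE)
  then obtain x where x: "x \<in> A" by blast
  then have "x \<in> S1" "x \<noteq> p" using A(1) open_arc_subset_S1 open_arc_ends by blast+
  then have "attracting g p" using rainbow_attracting[OF M a(2) r p(2) d(1) S(3)] lim[OF x] by blast
  then show ?thesis using pA_gaps_attracting[OF pf a p(1) _ d] by blast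
qed

text \<open>An end of the free arc that is an endpoint of a lamination starts a pseudo-Anosov
  configuration. Otherwise both ends are rainbow points of both laminations, and either nothing else
  is fixed or a leaf around \<open>p\<close> provides a fixed endpoint to start from.\<close>

lemma two_fixed_points_aux:
  assumes pf: "pseudo_fibered L M" and a: "lam_aut L g h" "lam_aut M g h"
    and p: "p \<in> Fix g" "d \<in> Fix g" "p \<noteq> d" "A = open_arc p d \<or> A = open_arc d p" "A \<inter> Fix g = {}"
    and lim: "\<And>x. x \<in> A \<Longrightarrow> (\<lambda>n. (g ^^ n) x) \<longlonglongrightarrow> p \<and> (\<lambda>n. (h ^^ n) x) \<longlonglongrightarrow> d"
  shows "(Fix g = {p, d} \<and> attracting g p \<and> attracting h d \<and>
      (\<forall>x\<in>{p, d}. rainbow_point L x \<and> rainbow_point M x)) \<or>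
    pA_gaps L M g h \<or> pA_gaps M L g h \<or> pA_gaps L M h g \<or> pA_gaps M L h g"
proof (cases "p \<in> endpoints L \<union> endpoints M \<or> d \<in> endpoints L \<union> endpoints M")
  case True
  note c = lam_aut_circle[OF a(1)]
  note a' = lam_aut_sym[OF a(1)] lam_aut_sym[OF a(2)] and pf' = pseudo_fibered_sym[OF pf]
  have F: "Fix h = Fix g" using Fix_inverse[OF c] .
  have A': "A = open_arc d p \<or> A = open_arc p d" using p(4) by blast
  have dp: "d \<noteq> p" using p(3) by blast
  show ?thesis
    using True pA_gaps_free_arc[OF pf a _ p(1,2) dp p(4,5)] pA_gaps_free_arc[OF pf' a(2,1) _ p(1,2) dp p(4,5)]
      pA_gaps_free_arc[OF pf a', of d p A] pA_gaps_free_arc[OF pf' a'(2,1), of d p A] lim F p(1,2,3,5) A' by blast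
next
  case False
  note c = lam_aut_circle[OF a(1)] and L = pseudo_fiberedD(3)[OF pf]
  note a' = lam_aut_sym[OF a(1)] lam_aut_sym[OF a(2)] and pf' = pseudo_fibered_sym[OF pf]
  have F: "Fix h = Fix g" using Fix_inverse[OF c] .
  have S: "p \<in> S1" "d \<in> S1" "d \<noteq> p" using p Fix_S1 by blast+
  have rp: "rainbow_point L p" "rainbow_point M p"
    using rainbow_of_free_arc[OF pf a(1) p(1) _ p(2)] rainbow_of_free_arc[OF pf' a(2) p(1) _ p(2)] False p by blast+
  have rd: "rainbow_point L d" "rainbow_point M d"
    using rainbow_of_free_arc[OF pf a(1) p(2) _ p(1)] rainbow_of_free_arc[OF pf' a(2) p(2) _ p(1)] False p by blast+
  have "A \<noteq> {}" using p(3,4) S open_arc_nonempty by (metis emptyE)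
  then obtain x where x: "x \<in> A" by blast
  have xS: "x \<in> S1" "x \<noteq> p" "x \<noteq> d" using x p(4) open_arc_subset_S1 open_arc_ends by blast+
  have 1: "attracting g p \<and> (Fix g = {p, d} \<or>
    (\<exists>b d. open_arc b d \<in> L \<and> open_arc b d \<inter> Fix g = {p} \<and> b \<in> Fix g \<and> d \<in> Fix g))"
    using rainbow_attracting[OF L a(1) rp(1) p(1,2,3) xS(1,2)] lim[OF x] by blast
  have 2: "attracting h d"
    using rainbow_attracting[OF L a'(1) rd(1) _ _ S(3) xS(1,3)] lim[OF x] F p by blast
  show ?thesis
  proof (cases "Fix g = {p, d}")
    case True
    then show ?thesis using 1 2 rp rd by blast
  next
    case False
    then obtain b e where be: "open_arc b e \<in> L" "open_arc b e \<inter> Fix g = {p}" "b \<in> Fix g" "e \<in> Fix g"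
      using 1 by blast
    have pbe: "p \<in> open_arc b e" using be by blast
    note sub = open_arc_subarc[OF pbe]
    have ep: "p \<noteq> e" "e \<noteq> p" using pbe open_arc_ends by blast+
    have free: "open_arc p e \<inter> Fix g = {}" using subset_singleton_free[OF sub(2) be(2) sub(4)] .
    have eL: "e \<in> endpoints L" using endpointsI[OF L be(1)] by blast
    \<comment> \<open>\<open>p\<close> attracts under \<open>g\<close>, so on the arc next to it the
      inverse flows to the fixed endpoint \<open>e\<close>.\<close>
    have "(\<lambda>n. (h ^^ n) y) \<longlonglongrightarrow> e" if y: "y \<in> open_arc p e" for y
      using orbits_on_free_arc[OF c p(1) be(4) ep(1) free] y
        attracting_orbits[OF c _ be(4) ep(2), of y] 1 open_arc_subset_S1 by blast
    then have "pA_gaps L M h g"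
      using pA_gaps_free_arc[OF pf a' eL, of p "open_arc p e"] F be p free ep by blast
    then show ?thesis by blast
  qed
qed

lemma two_fixed_points:
  assumes pf: "pseudo_fibered L M" and a: "lam_aut L g h" "lam_aut M g h"
    and x: "x \<in> S1" "g x \<noteq> x" and q: "q1 \<in> Fix g" "q2 \<in> Fix g" "q1 \<noteq> q2"
  shows "(\<exists>p d. p \<noteq> d \<and> Fix g = {p, d} \<and> attracting g p \<and> attracting h d \<and>
      (\<forall>x\<in>Fix g. rainbow_point L x \<and> rainbow_point M x)) \<or>
    pA_gaps L M g h \<or> pA_gaps M L g h \<or> pA_gaps L M h g \<or> pA_gaps M L h g"
proof -
  note c = lam_aut_circle[OF a(1)]
  have "x \<notin> Fix g" using x by (simp add: Fix_def)
  then obtain p d where p: "p \<in> Fix g" "d \<in> Fix g" "p \<noteq> d" "open_arc p d \<inter> Fix g = {}"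
    using free_arc_around[OF c x(1) _ q] by metis
  from orbits_on_free_arc[OF c p] show ?thesis
  proof
    assume "\<forall>x\<in>open_arc p d. (\<lambda>n. (g ^^ n) x) \<longlonglongrightarrow> p \<and> (\<lambda>n. (h ^^ n) x) \<longlonglongrightarrow> d"
    then show ?thesis using two_fixed_points_aux[OF pf a p(1,2,3) _ p(4)] p(3) by fastforce
  next
    assume "\<forall>x\<in>open_arc p d. (\<lambda>n. (g ^^ n) x) \<longlonglongrightarrow> d \<and> (\<lambda>n. (h ^^ n) x) \<longlonglongrightarrow> p"
    then show ?thesis
      using two_fixed_points_aux[OF pf a p(2,1) p(3)[symmetric] _ p(4)] p(3) by fastforce
  qed
qed

lemma repelling_if_attracting_inverse:
  assumes c: "circle_aut g h" and att: "attracting h p" shows "repelling g p"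
proof -
  obtain I where I: "good_interval I" "I \<inter> Fix h = {p}" "h ` closure I \<subseteq> I"
    using att unfolding attracting_def by blast
  have "closure I \<subseteq> S1" using closure_S1_subset good_subset_S1 I(1) by blast
  then have "closure I = g ` h ` closure I" using aut_image_image[OF circle_aut_sym[OF c]] by simp
  also have "\<dots> \<subseteq> g ` I" using I(3) by blast
  also have "\<dots> \<subseteq> g ` closure I" using closure_subset by blast
  finally have "I \<subseteq> g ` closure I" using closure_subset by blast
  then show ?thesis unfolding repelling_def using I Fix_inverse[OF c] by blast
qed

text \<open>A moved point drifts off in one direction when angles are taken from \<open>p\<close>,
  and monotonicity keeps its orbit from ever returning.\<close>

lemma fixed_of_pow_fixed:
  assumes c: "circle_aut g h" and p: "p \<in> Fix g" and x: "x \<in> S1" "(g ^^ n) x = x" "n > 0"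
  shows "g x = x"
proof (rule ccontr)
  assume n: "g x \<noteq> x"
  have pS: "p \<in> S1" using p Fix_S1 by blast
  have S: "(g ^^ k) x \<in> S1" for k using circle_autD[OF circle_aut_pow[OF c]] x by blast
  have gS: "g x \<in> S1" using circle_autD c x by blast
  obtain m where m: "n = Suc m" using x(3) by (cases n) auto
  have "ang p (g x) \<noteq> ang p x" using n ang_inj[OF pS gS x(1)] by blast
  then consider "ang p x < ang p (g x)" | "ang p (g x) < ang p x" by linarith
  then show False
  proof cases
    case 1
    have "ang p x < ang p ((g ^^ Suc k) x)" for k
    proof (induction k)
      case (Suc k)
      then show ?case using aut_ang_mono[OF c p x(1) S[of "Suc k"]] 1 by simp
    qed (use 1 in simp)
    then show False using x(2) m by (metis less_irrefl)
  next
    case 2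
    have "ang p ((g ^^ Suc k) x) < ang p x" for k
    proof (induction k)
      case (Suc k)
      then show ?case using aut_ang_mono[OF c p S[of "Suc k"] x(1)] 2 by simp
    qed (use 2 in simp)
    then show False using x(2) m by (metis less_irrefl)
  qed
qed

lemma lam_aut_of_preserves:
  assumes L: "lamination_system L" and c: "circle_aut g h" and p: "preserves g L" shows "lam_aut L g h"
proof -
  have im: "(`) g ` L = L" using p by (simp add: preserves_def)
  have "h ` I \<in> L" if I: "I \<in> L" for I
  proof -
    obtain J where J: "I = g ` J" "J \<in> L" using im I by blast
    then show ?thesis using aut_image_image[OF c good_subset_S1[OF lam_good[OF L J(2)]]] by simp
  qed
  then show ?thesis using c im by (auto simp: lam_aut_def)
qed

section \<open>Invariant gaps of automorphisms without fixed points\<close>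

lemma image_endpoints:
  assumes L: "lamination_system L" and a: "lam_aut L g h" and x: "x \<in> endpoints L"
  shows "g x \<in> endpoints L"
proof -
  obtain y where y: "open_arc x y \<in> L" using endpoints_iff[OF L] x by blast
  have "g ` open_arc x y = open_arc (g x) (g y)"
    using aut_image_arc[OF lam_aut_circle[OF a]] lam_arcD[OF L y] by blast
  then have "open_arc (g x) (g y) \<in> L" using lam_aut_mem[OF a y] by simp
  then show ?thesis using endpoints_iff[OF L] by blast
qed

text \<open>The pivot is the only vertex of a crown that is not an endpoint, and \<open>g\<close>
  permutes the endpoints.\<close>

lemma crown_pivot_fixed:
  assumes L: "lamination_system L" and a: "lam_aut L g h" and G: "crown_enum L G p t" and inv: "(`) g ` G = G"
  shows "p \<in> Fix g"
proof -
  note c = lam_aut_circle[OF a]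
  have gap: "gap L G" "enumerates t G" and V: "vertices G = range t \<union> {p}" using G by (auto simp: crown_enum_def)
  have pS: "p \<in> S1" using crown_pivot_S1[OF G] .
  have "g ` vertices G = vertices G" using gap_image(2)[OF L a gap(1)] inv by simp
  then have "g p \<in> range t \<union> {p}" using V by blast
  moreover have "g p \<noteq> t k" for k
  proof
    assume "g p = t k"
    then have "h (t k) = p" using circle_autD(3)[OF c pS] by metis
    then have "p \<in> endpoints L"
      using image_endpoints[OF L lam_aut_sym[OF a] enumeratesD(4)[OF L gap, of k]] by simp
    then show False using pivot_not_endpoint[OF L G] by blast
  qed
  ultimately show ?thesis using pS by (auto simp: Fix_def)
qed

lemma invariant_gap_polygon:
  assumes qf: "quite_full L" and a: "lam_aut L g h" and G: "gap L G" "(`) g ` G = G" and F: "Fix g = {}"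
  shows "ideal_polygon L G"
  using qf G(1)
proof (cases rule: gap_cases)
  case (crown p t)
  then show ?thesis using crown_pivot_fixed[OF quite_full_lam[OF qf] a crown G(2)] F by blast
qed

lemma image_local_union:
  assumes c: "circle_aut g h" and S: "\<And>I. I \<in> S \<Longrightarrow> I \<subseteq> S1 \<and> g ` I \<in> S \<and> h ` I \<in> S" and x: "x \<in> S1"
  shows "g ` \<Union>{J \<in> S. x \<in> J} = \<Union>{J \<in> S. g x \<in> J}"
proof (intro equalityI subsetI)
  fix y assume "y \<in> \<Union>{J \<in> S. g x \<in> J}"
  then obtain J where J: "J \<in> S" "g x \<in> J" "y \<in> J" by blast
  have "h (g x) \<in> h ` J" "h y \<in> h ` J" using J by blast+
  then have "x \<in> h ` J" "h y \<in> h ` J" using circle_autD(3)[OF c x] by auto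
  then have "h y \<in> \<Union>{J \<in> S. x \<in> J}" using S[OF J(1)] by blast
  moreover have "y = g (h y)" using circle_autD(4)[OF c, of y] S[OF J(1)] J by auto
  ultimately show "y \<in> g ` \<Union>{J \<in> S. x \<in> J}" by blast
qed (use S in blast)

text \<open>Unless some leaf is reversed, exactly one side of each leaf is disjoint from its image. The
  maximal sides of this kind bound the gap around the centre of rotation.\<close>

lemma invariant_polygon:
  assumes qf: "quite_full L" and a: "lam_aut L g h" and F: "Fix g = {}"
  obtains G where "ideal_polygon L G" "(`) g ` G = G"
proof -
  note L = quite_full_lam[OF qf] and c = lam_aut_circle[OF a]
  note c' = circle_aut_sym[OF c] and a' = lam_aut_sym[OF a]
  have "\<exists>G. gap L G \<and> (`) g ` G = G"
  proof (cases "\<exists>I\<in>L. g ` I = dual I")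
    case True
    then obtain I where I: "I \<in> L" "g ` I = dual I" by blast
    have gI: "good_interval I" using lam_good[OF L I(1)] .
    have "(`) g ` leaf I = leaf I"
      using image_leaf[OF c gI] I(2) gI by (auto simp: leaf_def)
    then show ?thesis using leaf_gap[OF L I(1)] by blast
  next
    case nodual: False
    define S where "S = {I \<in> L. g ` I \<inter> I = {}}"
    have good: "good_interval I" "g ` I \<in> L" "good_interval (g ` I)" "I \<subseteq> S1" if "I \<in> L" for I
      using lam_good[OF L] lam_aut_mem[OF a] good_subset_S1 that by blast+
    \<comment> \<open>A side comparable with its image would force a fixed point, by
      \<open>aut_fixed_point\<close> for \<open>g\<close> or for \<open>h\<close>.\<close>
    have noself: "\<not> g ` I \<subseteq> I" "\<not> I \<subseteq> g ` I" if I: "I \<in> L" for I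
    proof -
      show "\<not> g ` I \<subseteq> I" using aut_fixed_point[OF c good(1)[OF I]] F by blast
      show "\<not> I \<subseteq> g ` I"
      proof
        assume "I \<subseteq> g ` I"
        then have "h ` I \<subseteq> I" using aut_image_image[OF c good(4)[OF I]] by (metis image_mono)
        then show False using aut_fixed_point[OF c' good(1)[OF I]] F Fix_inverse[OF c] by blast
      qed
    qed
    have lam: "I \<subseteq> J \<or> J \<subseteq> I \<or> I \<inter> J = {}" if I: "I \<in> S" and J: "J \<in> S" for I J
    proof (rule ccontr)
      assume n: "\<not> ?thesis"
      have IJ: "I \<in> L" "J \<in> L" "g ` I \<inter> I = {}" "g ` J \<inter> J = {}" using I J by (auto simp: S_def)
      \<comment> \<open>If the two sides covered the circle up to ends, \<open>dual I\<close> would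
        lie in the image of \<open>I\<close>, which is itself disjoint from \<open>I\<close>: the
        leaf of \<open>I\<close> would be reversed.\<close>
      have dIJ: "dual I \<subseteq> J" using noncross[OF L IJ(1,2)] n by blast
      have "dual (g ` I) \<subseteq> g ` J" using dIJ aut_image_dual[OF c good(1)[OF IJ(1)]] by blast
      also have "\<dots> \<subseteq> dual J" using subset_dual_iff good IJ by blast
      also have "\<dots> \<subseteq> I" using dual_subset_swap good IJ dIJ by blast
      finally have "dual I \<subseteq> g ` I" using dual_subset_swap good IJ by blast
      moreover have "g ` I \<subseteq> dual I" using subset_dual_iff good IJ by blast
      ultimately show False using nodual IJ by blast
    qed
    have SS: "I \<subseteq> S1 \<and> g ` I \<in> S \<and> h ` I \<in> S" if I: "I \<in> S" for I
    proof -
      have I': "I \<in> L" "g ` I \<inter> I = {}" using I by (auto simp: S_def)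
      have "h ` I \<in> L" using lam_aut_mem[OF a' I'(1)] .
      have hS: "h ` I \<subseteq> S1" using good(4) \<open>h ` I \<in> L\<close> by blast
      have gh: "g ` h ` I = I" "h ` g ` I = I" using aut_image_image[OF c' good(4)[OF I'(1)]]
          aut_image_image[OF c good(4)[OF I'(1)]] by auto
      have "g ` (g ` I \<inter> I) = g ` g ` I \<inter> g ` I"
        using good(4)[OF I'(1)] good(4)[OF good(2)[OF I'(1)]] by (intro inj_on_image_Int[OF aut_inj[OF c]])
      then have "g ` g ` I \<inter> g ` I = {}" using I' by simp
      moreover have "h ` (g ` I \<inter> I) = h ` g ` I \<inter> h ` I"
        using good(4)[OF I'(1)] good(4)[OF good(2)[OF I'(1)]] by (intro inj_on_image_Int[OF aut_inj[OF c']])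
      then have "g ` h ` I \<inter> h ` I = {}" using I' gh by simp
      ultimately show ?thesis using I' good \<open>h ` I \<in> L\<close> by (auto simp: S_def)
    qed
    define G where "G = {\<Union>{J \<in> S. x \<in> J} | x. x \<in> \<Union>S}"
    have "gap L G" unfolding G_def
    proof (rule gap_of_laminar_family[OF L _ lam])
      show "S \<subseteq> L" by (auto simp: S_def)
      show "\<exists>J\<in>S. I \<subseteq> J \<or> dual I \<subseteq> J" if I: "I \<in> L" for I
      proof -
        \<comment> \<open>If \<open>I\<close> meets its image, only the covering alternative
          survives, and then \<open>dual I\<close> is disjoint from its own image.\<close>
        have "I \<in> S \<or> dual I \<in> S"
        proof (cases "g ` I \<inter> I = {}")
          case False
          then have "dual (g ` I) \<subseteq> I" using noncross[OF L good(2)[OF I] I] noself[OF I] by blast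
          then have "g ` dual I \<inter> dual I = {}"
            using aut_image_dual[OF c good(1)[OF I]] dual_disjoint[OF good(1)[OF I]] by auto
          then show ?thesis using lam_dual[OF L I] by (auto simp: S_def)
        qed (use I in \<open>auto simp: S_def\<close>)
        then show ?thesis by blast
      qed
      fix x J assume J: "J \<in> S" "x \<in> J"
      define E where "E = {J \<in> S. x \<in> J}"
      have EL: "E \<noteq> {}" "E \<subseteq> L" using J by (auto simp: E_def S_def)
      have xS: "x \<in> S1" using SS[OF J(1)] J by blast
      have chain: "I \<subseteq> J \<or> J \<subseteq> I" if "I \<in> E" "J \<in> E" for I J using lam[of I J] that by (auto simp: E_def)
      have disj: "g ` I \<inter> J = {}" if "I \<in> E" "J \<in> E" for I J
        using chain[OF that] that by (auto simp: E_def S_def)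
      have gx: "g x \<notin> J" if "J \<in> E" for J using disj[OF that that] that by (auto simp: E_def)
      have "good_interval (\<Union>E) \<or> \<Union>E = S1 - {g x}"
        using EL good gx circle_autD(1)[OF c xS] by (intro Union_good_cases[of E x]) (auto simp: E_def)
      \<comment> \<open>The image of a member is infinite and disjoint from the union, so more than
        \<open>g x\<close> is missing.\<close>
      moreover have "\<Union>E \<noteq> S1 - {g x}"
      proof
        assume U: "\<Union>E = S1 - {g x}"
        obtain I where I: "I \<in> E" using EL by blast
        have "g ` I \<inter> \<Union>E = {}" using disj[OF I] by blast
        moreover have "I \<in> L" using I EL by blast
        then have "g ` I \<subseteq> S1" using good(4)[OF good(2)] by blast
        ultimately have "g ` I \<subseteq> {g x}" using U by auto
        then show False using infinite_good[OF good(3)[OF \<open>I \<in> L\<close>]] finite_subset by blast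
      qed
      ultimately have "\<Union>E \<in> L" using chain_Union_mem[OF L EL chain] by blast
      moreover have "g ` \<Union>E \<inter> \<Union>E = {}" using disj by blast
      ultimately show "\<Union>{J \<in> S. x \<in> J} \<in> S" unfolding E_def[symmetric] by (simp add: S_def)
    qed
    moreover have "(`) g ` G = G"
    proof
      have memS: "g x \<in> \<Union>S \<and> h x \<in> \<Union>S \<and> x \<in> S1" if x: "x \<in> \<Union>S" for x
      proof -
        obtain J where "J \<in> S" "x \<in> J" using x by blast
        then show ?thesis using SS[of J] by blast
      qed
      show "(`) g ` G \<subseteq> G"
      proof
        fix X assume "X \<in> (`) g ` G"
        then obtain x where x: "x \<in> \<Union>S" "X = g ` \<Union>{J \<in> S. x \<in> J}" unfolding G_def by blast
        then have "X = \<Union>{J \<in> S. g x \<in> J}" using image_local_union[OF c SS] memS[OF x(1)] by simp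
        then show "X \<in> G" unfolding G_def using memS[OF x(1)] by blast
      qed
      show "G \<subseteq> (`) g ` G"
      proof
        fix X assume "X \<in> G"
        then obtain x where x: "x \<in> \<Union>S" "X = \<Union>{J \<in> S. x \<in> J}" unfolding G_def by blast
        have "h x \<in> S1" "g (h x) = x" using circle_autD[OF c] memS[OF x(1)] by blast+
        then have "X = g ` \<Union>{J \<in> S. h x \<in> J}" using image_local_union[OF c SS, of "h x"] x(2) by simp
        then show "X \<in> (`) g ` G" unfolding G_def using memS[OF x(1)] by blast
      qed
    qed
    ultimately show ?thesis by blast
  qed
  then show thesis using that invariant_gap_polygon[OF qf a _ _ F] by blast
qed

section \<open>Parabolic automorphisms\<close>

lemma connected_punctured_circle: "p \<in> S1 \<Longrightarrow> connected (S1 - {p})"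
proof -
  assume p: "p \<in> S1"
  have "S1 - {p} = (\<lambda>t. p * cis t) ` {0<..<2 * pi}"
  proof (intro set_eqI iffI)
    fix x assume x: "x \<in> S1 - {p}"
    then show "x \<in> (\<lambda>t. p * cis t) ` {0<..<2 * pi}"
      using ang_eq[of p x] ang_pos[of p x] ang_lt_2pi[of p x] p
      by (intro image_eqI[of _ _ "ang p x"]) auto
  next
    fix x assume "x \<in> (\<lambda>t. p * cis t) ` {0<..<2 * pi}"
    then obtain t where t: "x = p * cis t" "t \<in> {0<..<2 * pi}" by (rule imageE)
    have "ang p x = t" using ang_mult_cis[OF p, of t] t by simp
    then have "x \<noteq> p" using t p by auto
    then show "x \<in> S1 - {p}" using t(1) p by simp
  qed
  then show ?thesis
    using connected_continuous_image[OF continuous_on_mult_cis, of "{0<..<2 * pi}" p] by simp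
qed

lemma crown_ang_mono:
  assumes L: "lamination_system L" and G: "crown_enum L G p t" and lt: "j < k"
  shows "ang p (t j) < ang p (t k)"
proof -
  have gap: "gap L G" "enumerates t G" using G by (auto simp: crown_enum_def)
  note tD = enumeratesD[OF L gap]
  have pS: "p \<in> S1" using crown_pivot_S1[OF G] .
  have step: "ang p (t i) < ang p (t (i + 1))" for i
  proof -
    have "p \<in> vertices G" using G by (auto simp: crown_enum_def)
    then have "p \<notin> open_arc (t i) (t (i + 1))" using tD(1)[of i] by (auto simp: vertices_def)
    moreover have "0 < ang p (t (i + 1))"
      using ang_pos[OF pS tD(2)] G by (metis UNIV_I crown_enum_def image_eqI)
    moreover have "ang p (t i) \<noteq> ang p (t (i + 1))" using ang_inj[OF pS tD(2) tD(2)] tD(3) by metis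
    ultimately show ?thesis using pS tD(2)[of i] tD(2)[of "i + 1"] by (auto simp: mem_open_arc[OF pS])
  qed
  have "ang p (t j) < ang p (t (j + 1 + int n))" for n
  proof (induction n)
    case (Suc n)
    then show ?case using step[of "j + 1 + int n"] by (simp add: algebra_simps)
  qed (simp add: step)
  from this[of "nat (k - j - 1)"] show ?thesis using lt by simp
qed

text \<open>Sides go to sides with their orientation, so the induced map of indices commutes with
  the successor and is a translation.\<close>

lemma crown_shift:
  assumes L: "lamination_system L" and a: "lam_aut L g h" and G: "crown_enum L G p t" and inv: "(`) g ` G = G"
  obtains d where "\<And>k. g (t k) = t (k + d)"
proof -
  note c = lam_aut_circle[OF a]
  have gap: "gap L G" "enumerates t G" using G by (auto simp: crown_enum_def)
  note tD = enumeratesD[OF L gap]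
  have inj: "t i = t j \<longleftrightarrow> i = j" for i j
    using crown_ang_mono[OF L G, of i j] crown_ang_mono[OF L G, of j i] by (cases i j rule: linorder_cases) auto
  have "\<exists>m. g (t k) = t m \<and> g (t (k + 1)) = t (m + 1)" for k
  proof -
    have im: "g ` open_arc (t k) (t (k + 1)) = open_arc (g (t k)) (g (t (k + 1)))"
      using aut_image_arc[OF c tD(2) tD(2)] .
    have "g ` open_arc (t k) (t (k + 1)) \<in> G" using inv tD(1) by blast
    then obtain m where m: "open_arc (g (t k)) (g (t (k + 1))) = open_arc (t m) (t (m + 1))"
      using im gap(2) by (auto simp: enumerates_def)
    have "g (t k) \<noteq> g (t (k + 1))" using circle_aut_eq_iff[OF c tD(2) tD(2)] tD(3) by blast
    then show ?thesis using open_arc_inject[OF m] circle_autD(1)[OF c tD(2)] by blast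
  qed
  then obtain f where f: "\<And>k. g (t k) = t (f k)" "\<And>k. g (t (k + 1)) = t (f k + 1)" by metis
  have step: "f (k + 1) = f k + 1" for k using f(1)[of "k + 1"] f(2)[of k] inj by metis
  have fk: "f k = k + f 0" for k
  proof (induction k rule: int_induct[of _ 0])
    case base
    show ?case by simp
  next
    case (step1 i)
    then show ?case using step[of i] by linarith
  next
    case (step2 i)
    have "f (i - 1 + 1) = f (i - 1) + 1" by (rule step)
    then show ?case using step2(2) by simp
  qed
  show thesis
  proof (rule that)
    show "g (t k) = t (k + f 0)" for k using f(1)[of k] by (subst fk[symmetric])
  qed
qed

text \<open>Small sides around \<open>p\<close> would cross their images: both ends of such a side
  move counter-clockwise, whereas for nested sides around \<open>p\<close> they may not both move in
  the same sense.\<close>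

lemma parabolic_not_rainbow:
  assumes L: "lamination_system L" and a: "lam_aut L g h" and p: "p \<in> Fix g" "p \<notin> endpoints L"
    and up: "\<And>x. x \<in> S1 \<Longrightarrow> x \<noteq> p \<Longrightarrow> ang p x < ang p (g x)"
  shows "\<not> rainbow_point L p"
proof
  assume r: "rainbow_point L p"
  note c = lam_aut_circle[OF a]
  have pS: "p \<in> S1" "g p = p" using p Fix_S1 by blast+
  have gS: "g x \<in> S1 \<and> g x \<noteq> p" if "x \<in> S1" "x \<noteq> p" for x
    using circle_autD[OF c that(1)] circle_aut_eq_iff[OF c that(1) pS(1)] pS that by auto
  obtain x where x: "x \<in> S1" "x \<noteq> p" using infinite_open_arc[of 1 "-1"] open_arc_subset_S1[of 1 "-1"]
    by (metis one_S1 ang_pos good_avoid_finite good_interval_open_arc insertI1 finite.emptyI finite.insertI mem_sphere_0 norm_minus_cancel norm_one one_neq_neg_one subsetD)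
  \<comment> \<open>With three consecutive orbit points outside \<open>K\<close>, the complement of
    \<open>K\<close> is so long that the image of its first end still precedes its last end; this
    also refutes the covering alternative.\<close>
  define y where "y = g x"
  define z where "z = g y"
  have y: "y \<in> S1" "y \<noteq> p" and z: "z \<in> S1" "z \<noteq> p" using gS x by (auto simp: y_def z_def)
  obtain K where K: "K \<in> L" "p \<in> K" "K \<inter> {x, y, z} = {}"
    by (rule rainbow_memE[OF r, of "{x, y, z}"]) (use x y z in auto)
  obtain u v where uv: "K = open_arc u v" "u \<in> S1" "v \<in> S1" "u \<noteq> v" using lam_arcE[OF L K(1)] by metis
  have ne: "u \<noteq> p" "v \<noteq> p" using uv K open_arc_ends by blast+
  define \<alpha> \<beta> where "\<alpha> = ang p u" and "\<beta> = ang p v"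
  define \<alpha>' \<beta>' where "\<alpha>' = ang p (g u)" and "\<beta>' = ang p (g v)"
  have ab: "0 < \<beta>" "\<beta> < \<alpha>" "\<alpha> < \<alpha>'" "\<beta> < \<beta>'" "\<alpha>' < 2 * pi"
    using K(2) uv pS ang_pos[OF pS(1) uv(2) ne(1)] ang_pos[OF pS(1) uv(3) ne(2)] up[OF uv(2) ne(1)] up[OF uv(3) ne(2)] ang_lt_2pi
    by (auto simp: mem_open_arc[OF pS(1)] \<alpha>_def \<beta>_def \<alpha>'_def \<beta>'_def)
  have ab': "\<beta>' < \<alpha>'" using aut_ang_mono[OF c p(1) uv(3,2)] ab(2) by (simp add: \<alpha>_def \<beta>_def \<alpha>'_def \<beta>'_def)
  have memK: "w \<in> K \<longleftrightarrow> ang p w < \<beta> \<or> \<alpha> < ang p w" if "w \<in> S1" for w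
    using that uv ab by (auto simp: mem_open_arc[OF pS(1)] \<alpha>_def \<beta>_def)
  have gK: "g ` K = open_arc (g u) (g v)" using aut_image_arc[OF c uv(2,3)] uv(1) by simp
  have guv: "g u \<in> S1" "g v \<in> S1" "g u \<noteq> g v" using gS uv ne circle_aut_eq_iff[OF c uv(2,3)] by auto
  have memgK: "w \<in> g ` K \<longleftrightarrow> ang p w < \<beta>' \<or> \<alpha>' < ang p w" if "w \<in> S1" for w
    unfolding gK using that guv ab' by (auto simp: mem_open_arc[OF pS(1)] \<alpha>'_def \<beta>'_def)
  have dgK: "w \<in> dual (g ` K) \<longleftrightarrow> \<beta>' < ang p w \<and> ang p w < \<alpha>'" if "w \<in> S1" for w
    unfolding gK dual_open_arc[OF guv] using that guv ab' by (auto simp: mem_open_arc[OF pS(1)] \<alpha>'_def \<beta>'_def)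
  have xyz: "\<beta> \<le> ang p x" "ang p y < ang p z" "ang p z \<le> \<alpha>"
    using memK[OF x(1)] memK[OF z(1)] K(3) up[OF y] z_def by auto
  have "\<beta>' \<le> ang p y"
  proof (cases "v = x")
    case False
    then have "\<beta> < ang p x" using xyz(1) ang_inj[OF pS(1) uv(3) x(1)] by (auto simp: \<beta>_def order_le_less)
    then show ?thesis using aut_ang_mono[OF c p(1) uv(3) x(1)] by (simp add: \<beta>_def \<beta>'_def y_def)
  qed (simp add: \<beta>'_def y_def)
  then have lt: "\<beta>' < \<alpha>" using xyz by linarith
  \<comment> \<open>\<open>w1\<close>, \<open>w2\<close> and \<open>w3\<close> refute in turn the
    two inclusions and the covering alternative of \<open>noncross\<close>.\<close>
  obtain w1 where w1: "w1 \<in> S1" "\<beta> < ang p w1" "ang p w1 < \<beta>'"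
    by (rule open_arc_between[OF pS(1), of \<beta> \<beta>']) (use ab ab' in auto)
  obtain w2 where w2: "w2 \<in> S1" "\<alpha> < ang p w2" "ang p w2 < \<alpha>'"
    by (rule open_arc_between[OF pS(1), of \<alpha> \<alpha>']) (use ab ab' in auto)
  obtain w3 where w3: "w3 \<in> S1" "\<beta>' < ang p w3" "ang p w3 < \<alpha>"
    by (rule open_arc_between[OF pS(1), of \<beta>' \<alpha>]) (use ab ab' lt in auto)
  have "\<not> g ` K \<subseteq> K" using w1 memK[OF w1(1)] memgK[OF w1(1)] lt by auto
  moreover have "\<not> K \<subseteq> g ` K" using w2 memK[OF w2(1)] memgK[OF w2(1)] lt by auto
  moreover have "g ` K \<inter> K \<noteq> {}" using K(2) pS by (metis IntI empty_iff image_eqI)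
  moreover have "\<not> dual (g ` K) \<subseteq> K" using w3 memK[OF w3(1)] dgK[OF w3(1)] ab by auto
  ultimately show False using noncross[OF L lam_aut_mem[OF a K(1)] K(1)] by blast
qed

text \<open>A leaf at \<open>p\<close> would have a second fixed end, so \<open>p\<close> is not an
  endpoint. The direction given by \<open>up\<close> makes the shift positive, as weak interleaving
  of crowns demands.\<close>

lemma parabolic_crown:
  assumes pf: "pseudo_fibered L M" and a: "lam_aut L g h" and F: "Fix g = {p}"
    and up: "\<And>x. x \<in> S1 \<Longrightarrow> x \<noteq> p \<Longrightarrow> ang p x < ang p (g x)"
  obtains G t d where "crown_enum L G p t" "(`) g ` G = G" "d > 0" "\<And>k. g (t k) = t (k + d)"
proof -
  note L = pseudo_fiberedD(3)[OF pf]
  have p: "p \<in> Fix g" "p \<in> S1" using F Fix_S1 by blast+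
  have pe: "p \<notin> endpoints L"
  proof
    assume "p \<in> endpoints L"
    then obtain x where x: "open_arc p x \<in> L" using endpoints_iff[OF L] by blast
    then have "x \<in> Fix g" using leaf_fixed[OF pf a p(1)] by blast
    then show False using F lam_arcD[OF L x] by auto
  qed
  obtain G t where G: "non_leaf_gap L G" "crown_enum L G p t"
    by (rule pivot_or_rainbow[OF pseudo_fiberedD(1)[OF pf] p(2) pe parabolic_not_rainbow[OF L a p(1) pe up]])
  have inv: "(`) g ` G = G" using gap_at_fixed_vertex[OF pf a G(1) p(1)] G(2) by (simp add: crown_enum_def)
  obtain d where d: "\<And>k. g (t k) = t (k + d)" using crown_shift[OF L a G(2) inv] by blast
  have "t 0 \<in> S1" "t 0 \<noteq> p"
    using enumeratesD(2)[OF L, of G t 0] G(2) by (auto simp: crown_enum_def)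
  then have "ang p (t 0) < ang p (t d)" using up[of "t 0"] d[of 0] by simp
  then have "d > 0" using crown_ang_mono[OF L G(2), of d 0] by (cases "d = 0") force+
  then show thesis using that G(2) inv d by blast
qed

text \<open>Weak interleaving asks for a common symmetry of the two vertex families, and
  \<open>g\<close> is one.\<close>

lemma shift_compatible_of_aut:
  assumes c: "circle_aut g h" and S: "\<forall>k. w k \<in> S1"
    and sh: "\<forall>k. g (u k) = u (k + a)" "\<forall>k. g (w k) = w (k + b)"
  shows "shift_compatible u a w b"
  unfolding shift_compatible_def
proof (intro allI impI)
  fix n m assume "u n \<in> open_arc (w m) (w (m + 1))"
  then have "g (u n) \<in> open_arc (g (w m)) (g (w (m + 1)))" using aut_image_arc[OF c, of "w m" "w (m + 1)"] S by blast
  then show "u (n + a) \<in> open_arc (w (m + b)) (w (m + b + 1))"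
    using sh by (simp add: algebra_simps)
qed

lemma parabolic_case:
  assumes pf: "pseudo_fibered L M" and a: "lam_aut L g h" "lam_aut M g h" and F: "Fix g = {p}"
    and up: "\<And>x. x \<in> S1 \<Longrightarrow> x \<noteq> p \<Longrightarrow> ang p x < ang p (g x)"
  shows "\<exists>G1 G2. crown_with_pivot L G1 p \<and> crown_with_pivot M G2 p \<and>
     weakly_interleaving_pair L M G1 G2 \<and> (`) g ` G1 = G1 \<and> (`) g ` G2 = G2"
proof -
  note c = lam_aut_circle[OF a(1)] and L = pseudo_fiberedD(3)[OF pf] and M = pseudo_fiberedD(4)[OF pf]
  obtain G1 t d where 1: "crown_enum L G1 p t" "(`) g ` G1 = G1" "d > 0" "\<forall>k. g (t k) = t (k + d)"
    by (rule parabolic_crown[OF pf a(1) F up]) blast+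
  obtain G2 w e where 2: "crown_enum M G2 p w" "(`) g ` G2 = G2" "e > 0" "\<forall>k. g (w k) = w (k + e)"
    by (rule parabolic_crown[OF pseudo_fibered_sym[OF pf] a(2) F up]) blast+
  have gap: "gap L G1" "enumerates t G1" "gap M G2" "enumerates w G2" using 1(1) 2(1) by (auto simp: crown_enum_def)
  have tS: "t k \<in> S1" "w k \<in> S1" for k using enumeratesD(2)[OF L gap(1,2)] enumeratesD(2)[OF M gap(3,4)] by blast+
  have sc: "shift_compatible t (int (nat d)) w (int (nat e))" "shift_compatible w (int (nat e)) t (int (nat d))"
    using shift_compatible_of_aut[OF c _ 1(4) 2(4)] shift_compatible_of_aut[OF c _ 2(4) 1(4)] tS 1(3) 2(3) by simp_all
  have pos: "nat d \<ge> 1" "nat e \<ge> 1" using 1(3) 2(3) by auto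
  have "weakly_interleaving_pair L M G1 G2"
    unfolding weakly_interleaving_pair_def
    by (intro conjI gap(1,3) disjI2 exI[of _ t] exI[of _ w] exI[of _ "nat d"] exI[of _ "nat e"]
        gap(2,4)[unfolded enumerates_def] sc pos)
  moreover have "crown_with_pivot L G1 p" "crown_with_pivot M G2 p"
    using 1(1) 2(1) crown_with_pivot_iff by blast+
  ultimately show ?thesis using 1(2) 2(2) by blast
qed

text \<open>With \<open>d = 1\<close> the shifts are full periods, so compatibility is vacuous.\<close>

lemma polygons_weakly_interleave:
  assumes "lamination_system L" "lamination_system M" "ideal_polygon L G" "ideal_polygon M H"
  shows "weakly_interleaving_pair L M G H"
proof -
  obtain n t where 1: "n \<ge> 2" "\<forall>k. t (k + int n) = t k" "enumerates t G"
    by (rule polygon_enumeration[OF assms(1,3)]) blast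
  obtain m w where 2: "m \<ge> 2" "\<forall>k. w (k + int m) = w k" "enumerates w H"
    by (rule polygon_enumeration[OF assms(2,4)]) blast
  have p: "t (k + int n + 1) = t (k + 1)" "w (k + int m + 1) = w (k + 1)" for k
    using 1(2)[rule_format, of "k + 1"] 2(2)[rule_format, of "k + 1"] by (simp_all add: algebra_simps)
  have "shift_compatible t (int (n div 1)) w (int (m div 1))" "shift_compatible w (int (m div 1)) t (int (n div 1))"
    unfolding shift_compatible_def by (simp_all add: 1(2) 2(2) p)
  moreover have "1 dvd gcd n m" by simp
  ultimately show ?thesis
    using assms(3,4) 1 2 unfolding weakly_interleaving_pair_def ideal_polygon_def enumerates_def by blast
qed

section \<open>Interleaving gaps of pseudo-Anosov type\<close>

text \<open>Inside a side the only fixed point is an endpoint of \<open>M\<close>, and no point is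
  an endpoint of both laminations.\<close>

lemma fixed_gap_vertex:
  assumes pf: "pseudo_fibered L M" and G: "fixed_gap L M g G" and d: "d \<in> Fix g" "d \<in> endpoints L"
  shows "d \<in> vertices G"
proof (rule ccontr)
  assume "d \<notin> vertices G"
  then obtain J where J: "J \<in> G" "d \<in> J" using d Fix_S1 by (auto simp: vertices_def)
  then obtain x where "x \<in> endpoints M" "J \<inter> Fix g = {x}" using G by (auto simp: fixed_gap_def)
  then show False using J d pseudo_fiberedD(5)[OF pf d(2)] by auto
qed

text \<open>The one fixed point in a side is an endpoint of the other lamination and therefore a
  vertex of the other gap; conversely all vertices are fixed.\<close>

lemma fixed_gaps_interleave:
  assumes pf: "pseudo_fibered L M" and G: "fixed_gap L M g G" and H: "fixed_gap M L g H"
  shows "interleaving_pair L M G H" "vertices G \<union> vertices H = Fix g"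
proof -
  note pf' = pseudo_fibered_sym[OF pf]
  have V: "vertices G \<subseteq> Fix g" "vertices H \<subseteq> Fix g" using G H by (auto simp: fixed_gap_def)
  have one: "is_singleton (I \<inter> vertices H')"
    if h: "pseudo_fibered L' M'" "fixed_gap L' M' g G'" "fixed_gap M' L' g H'" "I \<in> G'" for L' M' G' H' I
  proof -
    obtain d where d: "d \<in> endpoints M'" "I \<inter> Fix g = {d}" using h(2,4) by (auto simp: fixed_gap_def)
    then have "d \<in> vertices H'" using fixed_gap_vertex[OF pseudo_fibered_sym[OF h(1)] h(3)] by blast
    moreover have "vertices H' \<subseteq> Fix g" using h(3) by (simp add: fixed_gap_def)
    ultimately have "I \<inter> vertices H' = {d}" using d(2) by blast
    then show ?thesis by simp
  qed
  show "interleaving_pair L M G H"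
    using G H one[OF pf G H] one[OF pf' H G] by (auto simp: interleaving_pair_def fixed_gap_def sat_gap_def)
  have "x \<in> vertices H" if x: "x \<in> Fix g" "x \<notin> vertices G" for x
  proof -
    obtain I where I: "I \<in> G" "x \<in> I" using x Fix_S1 by (auto simp: vertices_def)
    then obtain d where d: "d \<in> endpoints M" "I \<inter> Fix g = {d}" using G by (auto simp: fixed_gap_def)
    then have "x \<in> endpoints M" using I x by auto
    then show ?thesis using fixed_gap_vertex[OF pf' H x(1)] by blast
  qed
  then show "vertices G \<union> vertices H = Fix g" using V by blast
qed

text \<open>A side of \<open>G\<close> meets a side of \<open>H\<close>. The ends of both are fixed
  endpoints of \<open>L\<close>, whereas fixed points inside a side are endpoints of
  \<open>M\<close>; so neither side contains an end of the other.\<close>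

lemma fixed_gap_unique_aux:
  assumes L: "lamination_system L" and pf: "pseudo_fibered L M"
    and G: "gap L G" "vertices G \<subseteq> Fix f" "\<And>I. I \<in> G \<Longrightarrow> \<exists>d\<in>endpoints M. I \<inter> Fix f = {d}"
    and H: "gap L H" "vertices H \<subseteq> Fix f" "\<And>I. I \<in> H \<Longrightarrow> \<exists>d\<in>endpoints M. I \<inter> Fix f = {d}"
  shows "G \<subseteq> H"
proof
  fix I assume I: "I \<in> G"
  have IL: "I \<in> L" using gap_mem[OF G(1) I] .
  obtain u v where uv: "I = open_arc u v" "u \<in> S1" "v \<in> S1" "u \<noteq> v" using lam_arcE[OF L IL] by metis
  obtain d where d: "I \<inter> Fix f = {d}" using G(3)[OF I] by blast
  \<comment> \<open>A point of \<open>I\<close> that is not fixed, hence not a vertex of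
    \<open>H\<close>.\<close>
  obtain y where y: "y \<in> I" "y \<noteq> d" by (rule good_avoid_finite[OF lam_good[OF L IL], of "{d}"]) auto
  then have "y \<notin> Fix f" using d by blast
  then have "y \<notin> vertices H" "y \<in> S1" using H(2) y good_subset_S1[OF lam_good[OF L IL]] by blast+
  then obtain J where J: "J \<in> H" "y \<in> J" by (auto simp: vertices_def)
  have JL: "J \<in> L" using gap_mem[OF H(1) J(1)] .
  obtain u' v' where uv': "J = open_arc u' v'" using lam_arcE[OF L JL] by metis
  have out: "e \<notin> K" if e: "e \<in> Fix f" "e \<in> endpoints L" "\<exists>d\<in>endpoints M. K \<inter> Fix f = {d}" for e K
  proof
    assume "e \<in> K"
    obtain d where "d \<in> endpoints M" "K \<inter> Fix f = {d}" using e(3) by blast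
    moreover have "e \<in> K \<inter> Fix f" using \<open>e \<in> K\<close> e(1) by blast
    ultimately show False using pseudo_fiberedD(5)[OF pf e(2)] by simp
  qed
  have F: "u \<in> Fix f" "v \<in> Fix f" "u' \<in> Fix f" "v' \<in> Fix f"
    using gap_vertices[OF L G(1)] gap_vertices[OF L H(1)] I J G(2) H(2) uv uv' by blast+
  have E: "u \<in> endpoints L" "v \<in> endpoints L" "u' \<in> endpoints L" "v' \<in> endpoints L"
    using endpointsI[OF L] IL JL uv uv' by blast+
  have "I = J" unfolding uv(1) uv'
    by (rule good_eqI) (use y J uv uv' out F E G(3)[OF I] H(3)[OF J(1)] in auto)
  then show "I \<in> H" using J by simp
qed

text \<open>\<open>g\<close> commutes with its power \<open>f\<close> and so preserves the fixed set
  of \<open>f\<close>. The image gap has the same description, and uniqueness applies.\<close>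

lemma fixed_gap_invariant:
  assumes pf: "pseudo_fibered L M" and a: "lam_aut L g h" "lam_aut M g h"
    and f: "f = g ^^ n" and G: "fixed_gap L M f G"
  shows "(`) g ` G = G"
proof -
  note L = pseudo_fiberedD(3)[OF pf] and M = pseudo_fiberedD(4)[OF pf] and c = lam_aut_circle[OF a(1)]
  have G': "gap L G" "vertices G \<subseteq> Fix f" "\<And>I. I \<in> G \<Longrightarrow> \<exists>d\<in>endpoints M. I \<inter> Fix f = {d}"
    using G by (auto simp: fixed_gap_def sat_gap_def)
  have Ff: "g x \<in> Fix f \<longleftrightarrow> x \<in> Fix f" if x: "x \<in> S1" for x
  proof -
    have "f (g x) = g (f x)" unfolding f by (simp add: funpow_swap1)
    moreover have "f x \<in> S1" unfolding f using circle_autD[OF circle_aut_pow[OF c] x] by blast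
    ultimately show ?thesis
      using circle_aut_eq_iff[OF c, of "f x" x] x circle_autD(1)[OF c x] by (auto simp: Fix_def)
  qed
  have H: "gap L ((`) g ` G)" "vertices ((`) g ` G) \<subseteq> Fix f"
    "\<And>I. I \<in> (`) g ` G \<Longrightarrow> \<exists>d\<in>endpoints M. I \<inter> Fix f = {d}"
  proof -
    show "gap L ((`) g ` G)" using gap_image(1)[OF L a(1) G'(1)] .
    show "vertices ((`) g ` G) \<subseteq> Fix f"
      unfolding gap_image(2)[OF L a(1) G'(1)] using G'(2) Ff Fix_S1 by blast
    fix I assume "I \<in> (`) g ` G"
    then obtain J where J: "J \<in> G" "I = g ` J" by blast
    obtain d where d: "d \<in> endpoints M" "J \<inter> Fix f = {d}" using G'(3)[OF J(1)] by blast
    have JS: "J \<subseteq> S1" using good_subset_S1[OF lam_good[OF L gap_mem[OF G'(1) J(1)]]] .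
    have "I \<inter> Fix f = g ` (J \<inter> Fix f)" using J(2) JS Ff by blast
    then show "\<exists>d\<in>endpoints M. I \<inter> Fix f = {d}" using d image_endpoints[OF M a(2) d(1)] by auto
  qed
  show ?thesis using fixed_gap_unique_aux[OF L pf H G'] fixed_gap_unique_aux[OF L pf G' H] by blast
qed

definition pA_pair :: "complex set set \<Rightarrow> complex set set \<Rightarrow> (complex \<Rightarrow> complex) \<Rightarrow>
    complex set set \<Rightarrow> complex set set \<Rightarrow> bool" where
  "pA_pair L M g G1 G2 \<longleftrightarrow> fixed_gap L M g G1 \<and> fixed_gap M L g G2 \<and>
     ((\<forall>p. tip G1 p \<longrightarrow> attracting g p) \<and> (\<forall>p. tip G2 p \<longrightarrow> repelling g p) \<or>
      (\<forall>p. tip G2 p \<longrightarrow> attracting g p) \<and> (\<forall>p. tip G1 p \<longrightarrow> repelling g p))"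

lemma pA_pair_exists:
  assumes pf: "pseudo_fibered L M" and c: "circle_aut g h"
    and "pA_gaps L M g h \<or> pA_gaps M L g h \<or> pA_gaps L M h g \<or> pA_gaps M L h g"
  shows "\<exists>G1 G2. pA_pair L M g G1 G2"
proof -
  note L = pseudo_fiberedD(3)[OF pf] and M = pseudo_fiberedD(4)[OF pf]
  have rep: "attracting h x \<Longrightarrow> repelling g x" for x using repelling_if_attracting_inverse[OF c] .
  from assms(3) show ?thesis
  proof (elim disjE)
    assume "pA_gaps L M g h"
    then obtain G1 G2 where "fixed_gap L M g G1" "fixed_gap M L g G2"
      "\<forall>x. tip G1 x \<longrightarrow> attracting g x" "\<forall>x. tip G2 x \<longrightarrow> attracting h x" unfolding pA_gaps_def by metis
    then show ?thesis using rep unfolding pA_pair_def by blast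
  next
    assume "pA_gaps M L g h"
    then obtain G1 G2 where "fixed_gap M L g G1" "fixed_gap L M g G2"
      "\<forall>x. tip G1 x \<longrightarrow> attracting g x" "\<forall>x. tip G2 x \<longrightarrow> attracting h x" unfolding pA_gaps_def by metis
    then show ?thesis using rep unfolding pA_pair_def by blast
  next
    assume "pA_gaps L M h g"
    then obtain G1 G2 where "fixed_gap L M h G1" "fixed_gap M L h G2"
      "\<forall>x. tip G1 x \<longrightarrow> attracting h x" "\<forall>x. tip G2 x \<longrightarrow> attracting g x" unfolding pA_gaps_def by metis
    then show ?thesis
      using rep fixed_gap_inverse[OF L c] fixed_gap_inverse[OF M c] unfolding pA_pair_def by blast
  next
    assume "pA_gaps M L h g"
    then obtain G1 G2 where "fixed_gap M L h G1" "fixed_gap L M h G2"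
      "\<forall>x. tip G1 x \<longrightarrow> attracting h x" "\<forall>x. tip G2 x \<longrightarrow> attracting g x" unfolding pA_gaps_def by metis
    then show ?thesis
      using rep fixed_gap_inverse[OF L c] fixed_gap_inverse[OF M c] unfolding pA_pair_def by blast
  qed
qed

lemma fixed_gapD:
  assumes "lamination_system L" "fixed_gap L M g G"
  shows "real_gap L G" "gap L G" "(`) g ` G = G"
proof -
  show "real_gap L G" using sat_gap_real[OF assms(1)] assms(2) by (simp add: fixed_gap_def)
  show "gap L G" using assms(2) by (simp add: fixed_gap_def sat_gap_def)
  have "(`) g ` G = (\<lambda>I. I) ` G" using assms(2) by (intro image_cong) (auto simp: fixed_gap_def)
  then show "(`) g ` G = G" by simp
qed

text \<open>Pigeonhole on the finite set \<open>V\<close>, cancelling the smaller power by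
  injectivity.\<close>

lemma periodic_vertex:
  assumes c: "circle_aut g h" and V: "finite V" "V \<subseteq> S1" "g ` V = V" "v \<in> V"
  obtains n where "n > 0" "(g ^^ n) v = v"
proof -
  have orb: "(g ^^ k) v \<in> V" for k by (induction k) (use V in auto)
  then have "\<not> inj (\<lambda>k. (g ^^ k) v)"
    using finite_subset[OF _ V(1), of "range (\<lambda>k. (g ^^ k) v)"] range_inj_infinite by blast
  then obtain i j where "(g ^^ i) v = (g ^^ j) v" "i \<noteq> j" unfolding inj_def by blast
  then obtain i j where ij: "(g ^^ i) v = (g ^^ j) v" "i < j" by (metis linorder_neqE_nat)
  have "(g ^^ j) v = (g ^^ i) ((g ^^ (j - i)) v)" 
    using funpow_add[of i "j - i" g] ij(2) by simp
  then have "(g ^^ (j - i)) v = v"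
    using circle_aut_eq_iff[OF circle_aut_pow[OF c, of i], of "(g ^^ (j - i)) v" v] ij(1) orb V by auto
  then show thesis using that[of "j - i"] ij(2) by simp
qed

theorem theorem15p9:
  fixes L1 L2 :: "complex set set" and g :: "complex \<Rightarrow> complex"
  assumes "pseudo_fibered L1 L2"
    and "g \<in> laminar_Aut L1 L2"
    and "nontrivial g"
  shows
    "(elliptic g \<and>
        (\<exists>G1 G2. ideal_polygon L1 G1 \<and> ideal_polygon L2 G2 \<and>
           weakly_interleaving_pair L1 L2 G1 G2 \<and> preserves g G1 \<and> preserves g G2)) \<or>
     (parabolic g \<and>
        (\<exists>G1 G2 p. crown_with_pivot L1 G1 p \<and> crown_with_pivot L2 G2 p \<and>
           weakly_interleaving_pair L1 L2 G1 G2 \<and> preserves g G1 \<and> preserves g G2 \<and>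
           Fix g = {p})) \<or>
     (hyperbolic g \<and> (\<forall>p\<in>Fix g. rainbow_point L1 p \<and> rainbow_point L2 p)) \<or>
     (pA_like L1 L2 g \<and> Fix g = {} \<and>
        (\<exists>G1 G2. interleaving_pair L1 L2 G1 G2 \<and>
           real_gap L1 G1 \<and> ideal_polygon L1 G1 \<and> real_gap L2 G2 \<and> ideal_polygon L2 G2 \<and>
           preserves g G1 \<and> preserves g G2 \<and>
           vertices G1 \<union> vertices G2 = Per g)) \<or>
     (properly_pseudo_Anosov L1 L2 g \<and>
        (\<exists>G1 G2. interleaving_pair L1 L2 G1 G2 \<and> real_gap L1 G1 \<and> real_gap L2 G2 \<and>
           preserves g G1 \<and> preserves g G2 \<and>
           vertices G1 \<union> vertices G2 = Fix g \<and>
           ((\<forall>p. tip G1 p \<longrightarrow> attracting g p) \<and> (\<forall>p. tip G2 p \<longrightarrow> repelling g p) \<or>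
            (\<forall>p. tip G2 p \<longrightarrow> attracting g p) \<and> (\<forall>p. tip G1 p \<longrightarrow> repelling g p))))"
proof -
  note pf = assms(1)
  note pf' = pseudo_fibered_sym[OF pf]
  note L1 = pseudo_fiberedD(3)[OF pf] and L2 = pseudo_fiberedD(4)[OF pf]
  have "circle_homeo_op g" and pres: "preserves g L1" "preserves g L2"
    using assms(2) by (auto simp: laminar_Aut_def)
  then obtain h where c: "circle_aut g h" using circle_homeo_op_aut by blast
  note c' = circle_aut_sym[OF c]
  have a: "lam_aut L1 g h" "lam_aut L2 g h" using lam_aut_of_preserves c pres L1 L2 by blast+
  note a' = lam_aut_sym[OF a(1)] lam_aut_sym[OF a(2)]
  have pr: "preserves g G" if "(`) g ` G = G" for G using that by (simp add: preserves_def)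
  obtain x where x: "x \<in> S1" "g x \<noteq> x" using assms(3) by (auto simp: nontrivial_def)
  consider (none) "Fix g = {}" | (one) p where "Fix g = {p}" | (two) q1 q2 where "q1 \<in> Fix g" "q2 \<in> Fix g" "q1 \<noteq> q2"
    by blast
  then show ?thesis
  proof cases
    case none
    obtain P1 where P1: "ideal_polygon L1 P1" "(`) g ` P1 = P1"
      by (rule invariant_polygon[OF pseudo_fiberedD(1)[OF pf] a(1) none])
    obtain P2 where P2: "ideal_polygon L2 P2" "(`) g ` P2 = P2"
      by (rule invariant_polygon[OF pseudo_fiberedD(2)[OF pf] a(2) none])
    show ?thesis
    proof (cases "elliptic g")
      \<comment> \<open>Ideal polygons always interleave weakly, so any two invariant ones will
        do.\<close>
      case True
      have "preserves g P1" "preserves g P2" using pr P1(2) P2(2) by blast+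
      then show ?thesis
        using True P1(1) P2(1) polygons_weakly_interleave[OF L1 L2 P1(1) P2(1)] by (intro disjI1) blast
    next
      case ell: False
      have gapP: "gap L1 P1" "finite (vertices P1)" using P1 by (auto simp: ideal_polygon_def)
      obtain k t where t: "enumerates t P1" "vertices P1 = range t"
        by (rule polygon_enumeration[OF L1 P1(1)]) blast
      define v where "v = t 0"
      have v: "v \<in> vertices P1" "v \<in> endpoints L1"
        using t enumeratesD(4)[OF L1 gapP(1) t(1)] by (auto simp: v_def)
      have VS: "vertices P1 \<subseteq> S1" by (auto simp: vertices_def)
      have gV: "g ` vertices P1 = vertices P1" using gap_image(2)[OF L1 a(1) gapP(1)] P1(2) by simp
      \<comment> \<open>The polygon only serves to find a power of \<open>g\<close> with a fixed
        endpoint; the interleaving pair comes from that power.\<close>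
      obtain n where n: "n > 0" "(g ^^ n) v = v" by (rule periodic_vertex[OF c gapP(2) VS gV v(1)])
      define f where "f = g ^^ n"
      define f' where "f' = h ^^ n"
      have fa: "lam_aut L1 f f'" "lam_aut L2 f f'" using lam_aut_pow a by (auto simp: f_def f'_def)
      have fc: "circle_aut f f'" using lam_aut_circle[OF fa(1)] .
      have vS: "v \<in> S1" using v by (auto simp: vertices_def)
      have vF: "v \<in> Fix f" using n vS by (simp add: Fix_def f_def)
      obtain y where y: "open_arc v y \<in> L1" using endpoints_iff[OF L1] v by blast
      have yF: "y \<in> Fix f" "v \<noteq> y" using leaf_fixed[OF pf fa(1) vF y] lam_arcD[OF L1 y] by auto
      obtain z where z: "z \<in> S1" "f z \<noteq> z"
        using ell assms(3) n(1) unfolding elliptic_def f_def by blast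
      \<comment> \<open>The fixed endpoint \<open>v\<close> rules out the hyperbolic alternative for
        \<open>f\<close>, in which all fixed points are rainbow points.\<close>
      have "\<not> rainbow_point L1 v" using rainbow_not_endpoint[OF L1] v by blast
      then obtain H1 H2 where H: "pA_pair L1 L2 f H1 H2"
        using two_fixed_points[OF pf fa z vF yF] vF pA_pair_exists[OF pf fc] by blast
      have H1: "fixed_gap L1 L2 f H1" and H2: "fixed_gap L2 L1 f H2" using H by (auto simp: pA_pair_def)
      have inv: "(`) g ` H1 = H1" "(`) g ` H2 = H2"
        using fixed_gap_invariant[OF pf a f_def H1] fixed_gap_invariant[OF pf' a(2,1) f_def H2] by auto
      have poly: "ideal_polygon L1 H1" "ideal_polygon L2 H2"
        using invariant_gap_polygon[OF pseudo_fiberedD(1)[OF pf] a(1) fixed_gapD(2)[OF L1 H1] inv(1) none]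
          invariant_gap_polygon[OF pseudo_fiberedD(2)[OF pf] a(2) fixed_gapD(2)[OF L2 H2] inv(2) none] by auto
      have inter: "interleaving_pair L1 L2 H1 H2" "vertices H1 \<union> vertices H2 = Fix f"
        using fixed_gaps_interleave[OF pf H1 H2] by auto
      have "Fix f = Per g"
      proof
        show "Fix f \<subseteq> Per g" using n(1) by (auto simp: Fix_def Per_def f_def)
        show "Per g \<subseteq> Fix f"
        proof
          fix w assume "w \<in> Per g"
          then obtain m where m: "w \<in> S1" "m > 0" "(g ^^ m) w = w" by (auto simp: Per_def)
          \<comment> \<open>A point periodic for \<open>g\<close> is periodic for \<open>f\<close>,
            and since \<open>f\<close> fixes \<open>v\<close>, its periodic points are
            fixed.\<close>
          have "(f ^^ m) w = ((g ^^ m) ^^ n) w" by (simp add: f_def funpow_mult mult.commute)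
          also have "\<dots> = w" using Fix_pow[of w "g ^^ m" n] m by (simp add: Fix_def)
          finally have "f w = w" using fixed_of_pow_fixed[OF fc vF m(1) _ m(2)] by blast
          then show "w \<in> Fix f" using m by (simp add: Fix_def)
        qed
      qed
      moreover have "pA_like L1 L2 g"
        unfolding pA_like_def using assms(2) ell none inter(1) pr inv by (auto simp: parabolic_def)
      ultimately show ?thesis
        using none inter poly pr inv fixed_gapD(1)[OF L1 H1] fixed_gapD(1)[OF L2 H2] by metis
    qed
  next
    case (one p)
    have p: "p \<in> Fix g" "p \<in> S1" using one Fix_S1 by blast+
    have "parabolic g" using assms(3) one by (auto simp: parabolic_def)
    have Fh: "Fix h = {p}" using Fix_inverse[OF c] one by simp
    have "\<exists>G1 G2. crown_with_pivot L1 G1 p \<and> crown_with_pivot L2 G2 p \<and>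
       weakly_interleaving_pair L1 L2 G1 G2 \<and> (`) g ` G1 = G1 \<and> (`) g ` G2 = G2"
      using aut_direction[OF c p(1) connected_punctured_circle[OF p(2)]] one
    proof (elim meta_impE disjE)
      assume "\<forall>x\<in>S1 - {p}. ang p x < ang p (g x)"
      then show ?thesis using parabolic_case[OF pf a one] by blast
    next
      \<comment> \<open>Clockwise motion is counter-clockwise for the inverse, which has the same
        invariant crowns.\<close>
      assume down: "\<forall>x\<in>S1 - {p}. ang p (g x) < ang p x"
      have up: "ang p x < ang p (h x)" if x: "x \<in> S1" "x \<noteq> p" for x
      proof -
        have "h x \<in> S1" "g (h x) = x" using circle_autD[OF c x(1)] by auto
        moreover have "h x \<noteq> p" using p(1) x(2) calculation(2) Fix_S1 by metis
        ultimately show ?thesis using down by force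
      qed
      from parabolic_case[OF pf a' Fh up]
      obtain G1 G2 where G: "crown_with_pivot L1 G1 p" "crown_with_pivot L2 G2 p"
        "weakly_interleaving_pair L1 L2 G1 G2" "(`) h ` G1 = G1" "(`) h ` G2 = G2"
        by blast
      have "gap L1 G1" "gap L2 G2" using G by (auto simp: crown_with_pivot_def)
      then have "I \<in> G1 \<Longrightarrow> I \<subseteq> S1" "I \<in> G2 \<Longrightarrow> I \<subseteq> S1" for I
        using good_subset_S1[OF lam_good[OF L1 gap_mem]] good_subset_S1[OF lam_good[OF L2 gap_mem]] by auto
      then have "(`) g ` (`) h ` G1 = G1" "(`) g ` (`) h ` G2 = G2"
        using image_image_family[OF c', of G1] image_image_family[OF c', of G2] by simp_all
      then show ?thesis using G by metis
    qed auto
    then show ?thesis using \<open>parabolic g\<close> one pr by metis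
  next
    case (two q1 q2)
    \<comment> \<open>A map of finite order with a fixed point would be trivial on the
      circle.\<close>
    have nell: "\<not> elliptic g"
    proof
      assume "elliptic g"
      then obtain n where "n > 0" "(g ^^ n) x = x" using x(1) by (auto simp: elliptic_def)
      then show False using fixed_of_pow_fixed[OF c two(1) x(1)] x(2) by blast
    qed
    have npar: "\<not> parabolic g" using two by (auto simp: parabolic_def)
    from two_fixed_points[OF pf a x two] show ?thesis
    proof (elim disjE[where P = "\<exists>p d. p \<noteq> d \<and> Fix g = {p, d} \<and> attracting g p \<and> attracting h d \<and>
      (\<forall>x\<in>Fix g. rainbow_point L1 x \<and> rainbow_point L2 x)"])
      assume "\<exists>p d. p \<noteq> d \<and> Fix g = {p, d} \<and> attracting g p \<and> attracting h d \<and>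
        (\<forall>x\<in>Fix g. rainbow_point L1 x \<and> rainbow_point L2 x)"
      then have "hyperbolic g \<and> (\<forall>p\<in>Fix g. rainbow_point L1 p \<and> rainbow_point L2 p)"
        unfolding hyperbolic_def using assms(3) repelling_if_attracting_inverse[OF c] by blast
      then show ?thesis by blast
    next
      assume "pA_gaps L1 L2 g h \<or> pA_gaps L2 L1 g h \<or> pA_gaps L1 L2 h g \<or> pA_gaps L2 L1 h g"
      then obtain G1 G2 where G: "pA_pair L1 L2 g G1 G2" using pA_pair_exists[OF pf c] by blast
      have G1: "fixed_gap L1 L2 g G1" and G2: "fixed_gap L2 L1 g G2" using G by (auto simp: pA_pair_def)
      have pres: "preserves g G1" "preserves g G2"
        using pr fixed_gapD(3)[OF L1 G1] fixed_gapD(3)[OF L2 G2] by blast+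
      have "properly_pseudo_Anosov L1 L2 g"
        unfolding properly_pseudo_Anosov_def pA_like_def
        using assms(2) nell npar two fixed_gaps_interleave(1)[OF pf G1 G2] pres by blast
      then show ?thesis
        using fixed_gaps_interleave[OF pf G1 G2] pres fixed_gapD(1)[OF L1 G1] fixed_gapD(1)[OF L2 G2] G
        unfolding pA_pair_def by blast
    qed
  qed
qed

end
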